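(* Let $G$ be a finite simple graph. The following statements are equivalent: (1) $G$ is basic; (2) $G$ is a 3-connected, wheel-free, planar line graph; (3) $G$ is 3-connected, planar, and contains none of $K_4$, the claw, the diamond, or the butterfly as an induced subgraph.
   Context: A graph is basic if it is the line graph $L(H)$ of a graph $H$ such that either $H = K_{2,3}$, or $H$ is obtained from a 3-connected cubic planar graph by subdividing every edge exactly once. The line graph $L(H)$ has vertex set $E(H)$, two vertices adjacent iff the corresponding edges share an end. A wheel is a graph formed by a chordless cycle $C$ and a vertex $u$ not in $C$ having at least three neighbors in $C$ (so $K_4$ is a wheel); wheel-free means no induced subgraph is a wheel. The claw is $K_{1,3}$; the diamond is $K_4$ minus one edge; the butterfly is the graph consisting of two triangles sharing exactly one vertex (5 vertices, 6 edges). *)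

theory Defs
  imports "HOL-Analysis.Analysis" "Graph_Theory.Graph_Theory"
begin

text \<open>
  A finite simple graph is a symmetric, loop-free, finite digraph on pairs, i.e. an
  \<^locale>\<open>pair_graph\<close>: every undirected edge is represented by its two orientations.
\<close>

definition uedges :: "'a pair_pre_digraph \<Rightarrow> 'a set set" where
  "uedges G = {{u, v} | u v. (u, v) \<in> parcs G}"

text \<open>Since \<^term>\<open>G\<close> is symmetric, the out-degree is the degree.\<close>

definition cubic :: "'a pair_pre_digraph \<Rightarrow> bool" where
  "cubic G \<longleftrightarrow> (\<forall>v \<in> pverts G. out_degree (with_proj G) v = 3)"

text \<open>
  The unqualified name \<open>connected\<close> would be ambiguous with topological connectedness. A
  \<open>k\<close>-connected graph has more than \<open>k\<close> vertices.
\<close>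

definition k_connected :: "nat \<Rightarrow> 'a pair_pre_digraph \<Rightarrow> bool" where
  "k_connected k G \<longleftrightarrow> k < card (pverts G) \<and>
     (\<forall>S \<subseteq> pverts G. card S < k \<longrightarrow>
        Digraph_Component.connected (with_proj G \<restriction> (pverts G - S)))"

text \<open>
  A drawing maps vertices to distinct points and edges to simple arcs in the plane (the type
  \<^typ>\<open>complex\<close>). An arc joins the points of the two ends of its edge and meets no other vertex;
  two distinct arcs meet only in common ends.
\<close>

definition plane_drawing ::
    "'a pair_pre_digraph \<Rightarrow> ('a \<Rightarrow> complex) \<Rightarrow> ('a set \<Rightarrow> real \<Rightarrow> complex) \<Rightarrow> bool" where
  "plane_drawing G p \<gamma> \<longleftrightarrow>
     inj_on p (pverts G) \<and>
     (\<forall>e \<in> uedges G. arc (\<gamma> e) \<and> {pathstart (\<gamma> e), pathfinish (\<gamma> e)} = p ` e \<and>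
        path_image (\<gamma> e) \<inter> p ` pverts G = p ` e) \<and>
     (\<forall>e \<in> uedges G. \<forall>f \<in> uedges G. e \<noteq> f \<longrightarrow>
        path_image (\<gamma> e) \<inter> path_image (\<gamma> f) = p ` (e \<inter> f))"

definition planar :: "'a pair_pre_digraph \<Rightarrow> bool" where
  "planar G \<longleftrightarrow> (\<exists>p \<gamma>. plane_drawing G p \<gamma>)"

definition line_graph :: "'a pair_pre_digraph \<Rightarrow> 'a set pair_pre_digraph" where
  "line_graph H = \<lparr> pverts = uedges H,
     parcs = {(e, f). e \<in> uedges H \<and> f \<in> uedges H \<and> e \<noteq> f \<and> e \<inter> f \<noteq> {}} \<rparr>"

text \<open>Every finite simple graph has a copy on the natural numbers, so \<open>H\<close> may be taken there.\<close>

definition is_line_graph :: "'a pair_pre_digraph \<Rightarrow> bool" where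
  "is_line_graph G \<longleftrightarrow>
     (\<exists>H :: nat pair_pre_digraph. pair_graph H \<and>
        digraph_iso (with_proj G) (with_proj (line_graph H)))"

text \<open>
  Every edge subdivided exactly once: \<open>Inl v\<close> is the old vertex \<open>v\<close>, and \<open>Inr e\<close> is the new
  vertex in the middle of the edge \<open>e\<close>.
\<close>

definition subdivide_all :: "'a pair_pre_digraph \<Rightarrow> ('a + 'a set) pair_pre_digraph" where
  "subdivide_all J = (let A = {(Inl v, Inr e) | v e. e \<in> uedges J \<and> v \<in> e} in
     \<lparr> pverts = Inl ` pverts J \<union> Inr ` uedges J, parcs = A \<union> A\<inverse> \<rparr>)"

definition basic :: "'a pair_pre_digraph \<Rightarrow> bool" where
  "basic G \<longleftrightarrow>
     (\<exists>H :: nat pair_pre_digraph. pair_graph H \<and>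
        (complete_bipartite_digraph 2 3 (with_proj H) \<or>
         (\<exists>J :: nat pair_pre_digraph. pair_graph J \<and> k_connected 3 J \<and> cubic J \<and> planar J \<and>
            digraph_iso (with_proj H) (with_proj (subdivide_all J)))) \<and>
        digraph_iso (with_proj G) (with_proj (line_graph H)))"

text \<open>The class \<open>P\<close> is meant to be closed under isomorphism.\<close>

definition has_induced :: "('a pair_pre_digraph \<Rightarrow> bool) \<Rightarrow> 'a pair_pre_digraph \<Rightarrow> bool" where
  "has_induced P G \<longleftrightarrow> (\<exists>W. induced_subgraph (with_proj W) (with_proj G) \<and> P W)"

definition cycle_graph :: "nat \<Rightarrow> nat pair_pre_digraph" where
  "cycle_graph n = (let A = {(i, Suc i mod n) | i. i < n} in
     \<lparr> pverts = {..<n}, parcs = A \<union> A\<inverse> \<rparr>)"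

text \<open>
  A wheel is its hub \<open>u\<close> together with a chordless cycle on all remaining vertices. As \<open>W\<close> is
  loop-free, the degree of \<open>u\<close> counts its neighbours on the cycle. Not every vertex of the cycle
  need be adjacent to \<open>u\<close>.
\<close>

definition is_wheel :: "'a pair_pre_digraph \<Rightarrow> bool" where
  "is_wheel W \<longleftrightarrow> pair_graph W \<and>
     (\<exists>u \<in> pverts W.
        (\<exists>n \<ge> 3. digraph_iso (with_proj W \<restriction> (pverts W - {u})) (with_proj (cycle_graph n))) \<and>
        out_degree (with_proj W) u \<ge> 3)"

definition wheel_free :: "'a pair_pre_digraph \<Rightarrow> bool" where
  "wheel_free G \<longleftrightarrow> \<not> has_induced is_wheel G"

definition is_K4 :: "'a pair_pre_digraph \<Rightarrow> bool" where
  "is_K4 W \<longleftrightarrow> complete_digraph 4 (with_proj W)"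

definition is_claw :: "'a pair_pre_digraph \<Rightarrow> bool" where
  "is_claw W \<longleftrightarrow> complete_bipartite_digraph 1 3 (with_proj W)"

definition diamond_graph :: "nat pair_pre_digraph" where
  "diamond_graph = \<lparr> pverts = {..<4},
     parcs = {(u, v). u < 4 \<and> v < 4 \<and> u \<noteq> v \<and> {u, v} \<noteq> {0, 1}} \<rparr>"

definition is_diamond :: "'a pair_pre_digraph \<Rightarrow> bool" where
  "is_diamond W \<longleftrightarrow> digraph_iso (with_proj W) (with_proj diamond_graph)"

definition butterfly_graph :: "nat pair_pre_digraph" where
  "butterfly_graph = (let A = {(0, 1), (0, 2), (1, 2), (0, 3), (0, 4), (3, 4)} in
     \<lparr> pverts = {..<5}, parcs = A \<union> A\<inverse> \<rparr>)"

definition is_butterfly :: "'a pair_pre_digraph \<Rightarrow> bool" where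
  "is_butterfly W \<longleftrightarrow> digraph_iso (with_proj W) (with_proj butterfly_graph)"

end

theory Submission
  imports Defs
begin

text \<open>
  (1) \<open>\<Longrightarrow>\<close> (2): the line graph of a basic \<open>H\<close> arises from a cubic graph \<open>J\<close> (or from the theta
  multigraph, for \<open>K\<^sub>2\<^sub>,\<^sub>3\<close>) by replacing every vertex by a triangle. In a drawing of \<open>J\<close> two of the
  three arcs at a vertex carry corners of the triangle near the vertex, which is itself the third
  corner; by Janiszewski's theorem the third arc does not separate them locally, so the last side of
  the triangle can be added. The hub of a wheel would have all its three neighbours on the rim, and
  then the rim contains a triangle.

  (2) \<open>\<Longrightarrow>\<close> (3): line graphs are claw-free. Given a diamond or a butterfly, 3-connectedness yields
  one or two induced paths that close up to a chordless cycle with a hub; claw-freeness excludes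
  the chords.

  (3) \<open>\<Longrightarrow>\<close> (1): the neighbourhood of every vertex is an edge and an isolated vertex, so the graph is
  a disjoint union of triangles joined by a perfect matching. Contracting the triangles yields \<open>J\<close>,
  unless two triangles are joined by two edges, and then the graph is the prism \<open>L(K\<^sub>2\<^sub>,\<^sub>3)\<close>. Since \<open>J\<close>
  is a topological minor, it is planar.
\<close>

section \<open>Graphs and their separations\<close>

text \<open>The obstacle is that contracting the triangles may create parallel edges: the prism
  contracts to the theta multigraph, which no \<open>pair_graph\<close> represents. Both kinds of
  basic graph are therefore described on \<open>G\<close> itself, by a label \<open>f x\<close> of
  the triangle of \<open>x\<close> and an involution \<open>m\<close> without fixed points; the
  quotient is used only when it is simple. The vertices of the line graph of a subdivision are the
  incidences (v, e), two of them adjacent iff they share a coordinate. So \<open>f\<close> is the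
  first coordinate, and \<open>m\<close> exchanges the two incidences with equal second coordinate.

  The disjoint paths needed to exclude a butterfly would follow from Menger's theorem; a pair of
  disjoint connected sets, rerouted along one edge at a time, serves instead.

  For planarity, every edge of the contracted graph is split into two halves, and triangles are
  inserted into any such system of half edges. One construction thus covers an arbitrary drawing of
  \<open>J\<close> and an explicit drawing of the theta multigraph by segments.\<close>

definition linked :: "'a set \<Rightarrow> 'a rel \<Rightarrow> bool" where
  "linked W E \<longleftrightarrow> (\<forall>A \<subseteq> W. A \<noteq> {} \<longrightarrow> (\<forall>x \<in> A. \<forall>y \<in> W. (x, y) \<in> E \<longrightarrow> y \<in> A) \<longrightarrow> A = W)"

lemma linkedD:
  "linked W E \<Longrightarrow> A \<subseteq> W \<Longrightarrow> x \<in> A \<Longrightarrow> (\<And>x y. x \<in> A \<Longrightarrow> y \<in> W \<Longrightarrow> (x, y) \<in> E \<Longrightarrow> y \<in> A) \<Longrightarrow> A = W"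
  unfolding linked_def by blast

text \<open>Most connectivity arguments exhibit a closed set and conclude that it is everything,
  which is the form of the definition. The description by walks serves to extract paths and
  components and to compare with \<open>connected\<close>.\<close>

lemma linked_iff_rtrancl_on: "linked W E \<longleftrightarrow> (\<forall>x \<in> W. \<forall>y \<in> W. (x, y) \<in> rtrancl_on W E)"
proof
  assume L: "linked W E"
  show "\<forall>x \<in> W. \<forall>y \<in> W. (x, y) \<in> rtrancl_on W E"
  proof (intro ballI)
    fix x y assume xy: "x \<in> W" "y \<in> W"
    have "{z. (x, z) \<in> rtrancl_on W E} = W"
      by (rule linkedD[OF L, where x = x])
        (use xy in \<open>auto dest: in_rtrancl_on_in_F intro: rtrancl_on_into_rtrancl_on\<close>)
    then show "(x, y) \<in> rtrancl_on W E" using xy by blast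
  qed
next
  assume R: "\<forall>x \<in> W. \<forall>y \<in> W. (x, y) \<in> rtrancl_on W E"
  show "linked W E"
    unfolding linked_def
  proof (intro allI impI)
    fix A assume A: "A \<subseteq> W" "A \<noteq> {}" "\<forall>x \<in> A. \<forall>y \<in> W. (x, y) \<in> E \<longrightarrow> y \<in> A"
    then obtain x where x: "x \<in> A" by blast
    have "y \<in> A" if "(x, y) \<in> rtrancl_on W E" for y
      using that by (induction rule: rtrancl_on_induct) (use A x in blast)+
    then show "A = W" using R A(1) x by blast
  qed
qed

text \<open>The relation on the left is what unfolding \<open>mk_symmetric\<close> produces for a
  restricted graph; on a symmetric relation it adds nothing to the walks.\<close>

lemma rtrancl_on_symcl_iff:
  assumes "sym E"
  shows "rtrancl_on W (\<Union>e \<in> {e \<in> E. fst e \<in> W \<and> snd e \<in> W}. {(fst e, snd e), (snd e, fst e)})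
    = rtrancl_on W E" (is "rtrancl_on W ?R = _")
proof (intro set_eqI iffI)
  fix z assume z: "z \<in> rtrancl_on W ?R"
  have "?R \<subseteq> E" using assms by (auto dest: symD)
  from rtrancl_on_mono[OF this order_refl] show "z \<in> rtrancl_on W E"
    using z by (cases z) blast
next
  fix z assume "z \<in> rtrancl_on W E"
  then obtain x y where z: "z = (x, y)" "(x, y) \<in> rtrancl_on W E" by (cases z) auto
  from z(2) have "(x, y) \<in> rtrancl_on W ?R"
  proof (induction rule: rtrancl_on_induct)
    case (step y z)
    then have "(y, z) \<in> ?R" by force
    with step show ?case by (blast intro: rtrancl_on_into_rtrancl_on)
  qed simp
  then show "z \<in> rtrancl_on W ?R" using z by simp
qed

lemma pair_graphD:
  assumes "pair_graph G"
  shows "finite (pverts G)" "finite (parcs G)" "parcs G \<subseteq> pverts G \<times> pverts G"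
    "sym (parcs G)" "irrefl (parcs G)"
proof -
  interpret pair_graph G by fact
  show "finite (pverts G)" "finite (parcs G)" by simp_all
  show "parcs G \<subseteq> pverts G \<times> pverts G" by (auto dest: in_arcsD1 in_arcsD2)
  show "sym (parcs G)" using pair_sym_arcs by (simp add: symmetric_def)
  show "irrefl (parcs G)" by (auto simp: irrefl_def dest: no_loops')
qed

lemma pair_graphI:
  assumes "finite (pverts G)" "parcs G \<subseteq> pverts G \<times> pverts G" "sym (parcs G)" "irrefl (parcs G)"
  shows "pair_graph G"
proof -
  have "finite (parcs G)" using assms by (meson finite_SigmaI finite_subset)
  then show ?thesis
    using assms by unfold_locales (auto simp: symmetric_def irrefl_def)
qed

lemma k_connected_iff_linked:
  assumes "pair_graph G"
  shows "k_connected k G \<longleftrightarrow> k < card (pverts G) \<and>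
    (\<forall>S \<subseteq> pverts G. card S < k \<longrightarrow> linked (pverts G - S) (parcs G))"
proof -
  \<comment> \<open>The bound on \<open>card S\<close> keeps the remaining vertex set nonempty,
    which \<open>connected\<close> demands and \<open>linked\<close> does not.\<close>
  have "Digraph_Component.connected (with_proj G \<restriction> (pverts G - S)) \<longleftrightarrow> linked (pverts G - S) (parcs G)"
    if S: "S \<subseteq> pverts G" "card S < k" and k: "k < card (pverts G)" for S
  proof -
    have "pverts G - S \<noteq> {}"
      using S k pair_graphD(1)[OF assms] by (metis Diff_eq_empty_iff card_mono finite_subset linorder_not_less
          order_less_trans)
    moreover have "arcs (with_proj G \<restriction> (pverts G - S))
      = {e \<in> parcs G. fst e \<in> pverts G - S \<and> snd e \<in> pverts G - S}" by auto
    ultimately show ?thesis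
      using rtrancl_on_symcl_iff[OF pair_graphD(4)[OF assms], of "pverts G - S"]
      unfolding Digraph_Component.connected_def strongly_connected_def mk_symmetric_def reachable_def
        linked_iff_rtrancl_on
      by (simp del: induce_subgraph_arcs)
  qed
  then show ?thesis unfolding k_connected_def by blast
qed

lemma out_degree_eq_card: "out_degree (with_proj G) v = card {w. (v, w) \<in> parcs G}"
proof -
  have "out_arcs (with_proj G) v = Pair v ` {w. (v, w) \<in> parcs G}"
    by (auto simp: out_arcs_def)
  then show ?thesis by (simp add: out_degree_def card_image inj_on_def)
qed

section \<open>Isomorphisms and induced subgraphs of pair graphs\<close>

text \<open>Arcs are pairs, so the vertex map determines the arc map and an isomorphism can be
  described without the latter.\<close>

definition is_pair_iso :: "('a \<Rightarrow> 'b) \<Rightarrow> 'a set \<Rightarrow> 'a rel \<Rightarrow> 'b set \<Rightarrow> 'b rel \<Rightarrow> bool" where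
  "is_pair_iso h V E W F \<longleftrightarrow> bij_betw h V W \<and> (\<forall>x \<in> V. \<forall>y \<in> V. (x, y) \<in> E \<longleftrightarrow> (h x, h y) \<in> F)"

lemma digraph_iso_iff:
  assumes "parcs G \<subseteq> pverts G \<times> pverts G" "parcs H \<subseteq> pverts H \<times> pverts H"
  shows "digraph_iso (with_proj G) (with_proj H) \<longleftrightarrow>
    (\<exists>h. is_pair_iso h (pverts G) (parcs G) (pverts H) (parcs H))"
proof
  assume "digraph_iso (with_proj G) (with_proj H)"
  then obtain f where f: "pre_digraph.digraph_isomorphism (with_proj G) f" "with_proj H = app_iso f (with_proj G)"
    unfolding digraph_iso_def by blast
  have V: "pverts H = iso_verts f ` pverts G" using f(2) by (metis verts_app_iso with_proj_simps(1))
  have A: "parcs H = iso_arcs f ` parcs G" using f(2) by (metis arcs_app_iso with_proj_simps(2))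
  have T: "iso_tail f = fst" "iso_head f = snd"
    using f(2) by (metis tail_app_iso with_proj_simps(4), metis f(2) head_app_iso with_proj_simps(5))
  have inj: "inj_on (iso_verts f) (pverts G)" and
    ends: "\<And>a. a \<in> parcs G \<Longrightarrow> iso_arcs f a = (iso_verts f (fst a), iso_verts f (snd a))"
    using f(1) T unfolding pre_digraph.digraph_isomorphism_def by (auto simp: prod_eq_iff)
  have "(x, y) \<in> parcs G \<longleftrightarrow> (iso_verts f x, iso_verts f y) \<in> parcs H" if "x \<in> pverts G" "y \<in> pverts G" for x y
  proof
    assume "(iso_verts f x, iso_verts f y) \<in> parcs H"
    then obtain a where "a \<in> parcs G" "iso_verts f (fst a) = iso_verts f x" "iso_verts f (snd a) = iso_verts f y"
      using A ends by auto
    moreover from this have "fst a \<in> pverts G" "snd a \<in> pverts G" using assms(1) by auto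
    ultimately show "(x, y) \<in> parcs G" using inj that by (metis inj_onD prod.collapse)
  qed (use A ends in force)
  then show "\<exists>h. is_pair_iso h (pverts G) (parcs G) (pverts H) (parcs H)"
    using inj V unfolding is_pair_iso_def bij_betw_def by blast
next
  assume "\<exists>h. is_pair_iso h (pverts G) (parcs G) (pverts H) (parcs H)"
  then obtain h where h: "inj_on h (pverts G)" "h ` pverts G = pverts H"
    "\<And>x y. x \<in> pverts G \<Longrightarrow> y \<in> pverts G \<Longrightarrow> (x, y) \<in> parcs G \<longleftrightarrow> (h x, h y) \<in> parcs H"
    unfolding is_pair_iso_def bij_betw_def by blast
  define f where "f = \<lparr>iso_verts = h, iso_arcs = map_prod h h, iso_head = snd, iso_tail = fst\<rparr>"
  have "wf_digraph (with_proj G)" using assms(1) by unfold_locales auto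
  moreover have "inj_on (map_prod h h) (parcs G)"
    by (rule inj_on_subset[OF map_prod_inj_on[OF h(1) h(1)] assms(1)])
  ultimately have "pre_digraph.digraph_isomorphism (with_proj G) f"
    unfolding pre_digraph.digraph_isomorphism_def f_def using h(1) by auto
  moreover have "map_prod h h ` parcs G = parcs H"
  proof (intro set_eqI iffI)
    fix z assume z: "z \<in> parcs H"
    then obtain x y where "z = (h x, h y)" "x \<in> pverts G" "y \<in> pverts G"
      using assms(2) h(2) by (cases z) blast
    then show "z \<in> map_prod h h ` parcs G" using z h(3) by force
  qed (use assms(1) h(3) in auto)
  then have "with_proj H = app_iso f (with_proj G)"
    unfolding app_iso_def f_def with_proj_def using h(2) by simp
  ultimately show "digraph_iso (with_proj G) (with_proj H)" unfolding digraph_iso_def by blast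
qed

lemma is_pair_iso_inv_into:
  assumes "is_pair_iso h V E W F"
  shows "is_pair_iso (inv_into V h) W F V E"
  unfolding is_pair_iso_def
proof (intro conjI ballI)
  have h: "bij_betw h V W" using assms by (simp add: is_pair_iso_def)
  then show "bij_betw (inv_into V h) W V" by (rule bij_betw_inv_into)
  fix x y assume "x \<in> W" "y \<in> W"
  then have "inv_into V h x \<in> V" "h (inv_into V h x) = x" "inv_into V h y \<in> V" "h (inv_into V h y) = y"
    using h unfolding bij_betw_def by (auto simp: f_inv_into_f inv_into_into)
  then show "(x, y) \<in> F \<longleftrightarrow> (inv_into V h x, inv_into V h y) \<in> E" using assms unfolding is_pair_iso_def by metis
qed

lemma induced_subgraph_iff:
  assumes "pair_graph G"
  shows "induced_subgraph (with_proj W) (with_proj G) \<longleftrightarrow>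
    pverts W \<subseteq> pverts G \<and> parcs W = parcs G \<inter> pverts W \<times> pverts W"
proof -
  have "wf_digraph (with_proj G)" using pair_graphD(3)[OF assms] by unfold_locales auto
  moreover have "wf_digraph (with_proj W)" if "parcs W \<subseteq> pverts W \<times> pverts W"
    using that by unfold_locales auto
  ultimately show ?thesis
    unfolding induced_subgraph_def subgraph_def by (auto simp: compatible_def)
qed

lemma has_induced_iff:
  assumes "pair_graph G"
  shows "has_induced P G \<longleftrightarrow> (\<exists>U \<subseteq> pverts G. P \<lparr>pverts = U, parcs = parcs G \<inter> U \<times> U\<rparr>)"
proof
  assume "has_induced P G"
  then obtain W where W: "pverts W \<subseteq> pverts G" "parcs W = parcs G \<inter> pverts W \<times> pverts W" "P W"
    unfolding has_induced_def induced_subgraph_iff[OF assms] by blast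
  moreover have "W = \<lparr>pverts = pverts W, parcs = parcs G \<inter> pverts W \<times> pverts W\<rparr>"
    by (rule pair_pre_digraph.equality) (use W(2) in auto)
  ultimately show "\<exists>U \<subseteq> pverts G. P \<lparr>pverts = U, parcs = parcs G \<inter> U \<times> U\<rparr>" by metis
next
  assume "\<exists>U \<subseteq> pverts G. P \<lparr>pverts = U, parcs = parcs G \<inter> U \<times> U\<rparr>"
  then obtain U where "U \<subseteq> pverts G" "P \<lparr>pverts = U, parcs = parcs G \<inter> U \<times> U\<rparr>" by blast
  then show "has_induced P G"
    unfolding has_induced_def induced_subgraph_iff[OF assms]
    by (intro exI[of _ "\<lparr>pverts = U, parcs = parcs G \<inter> U \<times> U\<rparr>"]) simp
qed

text \<open>Turns the diamond and the butterfly, given as concrete graphs on numbers, into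
  conditions on named vertices of \<open>G\<close>.\<close>

lemma has_induced_iso_iff:
  assumes "pair_graph G" "parcs H \<subseteq> pverts H \<times> pverts H"
  shows "has_induced (\<lambda>W. digraph_iso (with_proj W) (with_proj H)) G \<longleftrightarrow>
    (\<exists>g. inj_on g (pverts H) \<and> g ` pverts H \<subseteq> pverts G \<and>
      (\<forall>i \<in> pverts H. \<forall>j \<in> pverts H. (g i, g j) \<in> parcs G \<longleftrightarrow> (i, j) \<in> parcs H))"
    (is "?L \<longleftrightarrow> ?R")
proof
  assume ?L
  then obtain U h where U: "U \<subseteq> pverts G" and h: "is_pair_iso h U (parcs G \<inter> U \<times> U) (pverts H) (parcs H)"
    unfolding has_induced_iff[OF assms(1)] by (auto simp: digraph_iso_iff assms(2))
  from is_pair_iso_inv_into[OF h] show ?R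
    using U by (intro exI[of _ "inv_into U h"]) (auto simp: is_pair_iso_def bij_betw_def)
next
  assume ?R
  then obtain g where g: "inj_on g (pverts H)" "g ` pverts H \<subseteq> pverts G"
    "\<And>i j. i \<in> pverts H \<Longrightarrow> j \<in> pverts H \<Longrightarrow> (g i, g j) \<in> parcs G \<longleftrightarrow> (i, j) \<in> parcs H" by blast
  let ?U = "g ` pverts H"
  have "is_pair_iso g (pverts H) (parcs H) ?U (parcs G \<inter> ?U \<times> ?U)"
    using g unfolding is_pair_iso_def by (auto simp: inj_on_imp_bij_betw)
  note is_pair_iso_inv_into[OF this]
  then have "digraph_iso (with_proj \<lparr>pverts = ?U, parcs = parcs G \<inter> ?U \<times> ?U\<rparr>) (with_proj H)"
    by (subst digraph_iso_iff) (use assms(2) in auto)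
  then show ?L
    unfolding has_induced_iff[OF assms(1)] using g(2) by blast
qed

section \<open>Induced paths and wheels\<close>

text \<open>The equivalence records the edges of the path and, at once, the absence of chords. A
  single vertex is a path.\<close>

definition ipath :: "'a rel \<Rightarrow> 'a list \<Rightarrow> bool" where
  "ipath E p \<longleftrightarrow> p \<noteq> [] \<and> distinct p \<and>
    (\<forall>i < length p. \<forall>j < length p. (p ! i, p ! j) \<in> E \<longleftrightarrow> j = Suc i \<or> i = Suc j)"

lemma ipathD:
  "ipath E p \<Longrightarrow> i < length p \<Longrightarrow> j < length p \<Longrightarrow> (p ! i, p ! j) \<in> E \<longleftrightarrow> j = Suc i \<or> i = Suc j"
  by (simp add: ipath_def)

lemma ipath_single: "irrefl E \<Longrightarrow> ipath E [x]"
  by (simp add: ipath_def irrefl_def)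

lemma ipath_take: "ipath E p \<Longrightarrow> 0 < n \<Longrightarrow> ipath E (take n p)"
  by (auto simp: ipath_def)

lemma ipath_drop: "ipath E p \<Longrightarrow> n < length p \<Longrightarrow> ipath E (drop n p)"
  by (auto simp: ipath_def)

lemma ipath_snoc:
  assumes p: "ipath E p" and E: "sym E" "irrefl E" and z: "z \<notin> set p" "(last p, z) \<in> E"
    and na: "\<And>i. Suc i < length p \<Longrightarrow> (p ! i, z) \<notin> E"
  shows "ipath E (p @ [z])"
proof -
  have e: "(p ! i, z) \<in> E \<longleftrightarrow> Suc i = length p" if "i < length p" for i
  proof (cases "Suc i = length p")
    case True
    moreover from this have "last p = p ! i" by (metis diff_Suc_1 last_conv_nth list.size(3) nat.simps(3))
    ultimately show ?thesis using z by simp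
  qed (use na[of i] that in auto)
  then have e': "(z, p ! i) \<in> E \<longleftrightarrow> Suc i = length p" if "i < length p" for i
    using that E(1) by (meson symD)
  have zz: "(z, z) \<notin> E" using E(2) by (simp add: irrefl_def)
  show ?thesis
    unfolding ipath_def
  proof (intro conjI allI impI)
    fix i j assume "i < length (p @ [z])" "j < length (p @ [z])"
    then consider "i < length p" "j < length p" | "i = length p" "j < length p"
      | "i < length p" "j = length p" | "i = length p" "j = length p" by (auto simp: less_Suc_eq)
    then show "((p @ [z]) ! i, (p @ [z]) ! j) \<in> E \<longleftrightarrow> j = Suc i \<or> i = Suc j"
      by cases (use p e e' zz in \<open>auto simp: nth_append ipath_def\<close>)
  qed (use p z in \<open>auto simp: ipath_def\<close>)
qed

text \<open>Induction along a walk. If the next vertex \<open>z\<close> already lies on the path,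
  the path is cut there; otherwise it is cut at its first vertex adjacent to \<open>z\<close>, so
  that appending \<open>z\<close> creates no chord.\<close>

lemma ex_ipath:
  assumes L: "linked W E" and E: "sym E" "irrefl E" and ab: "a \<in> W" "b \<in> W"
  shows "\<exists>p. ipath E p \<and> set p \<subseteq> W \<and> hd p = a \<and> last p = b"
proof -
  have "(a, b) \<in> rtrancl_on W E" using L ab by (simp add: linked_iff_rtrancl_on)
  then show ?thesis
  proof (induction rule: rtrancl_on_induct)
    case base
    then show ?case using E by (intro exI[of _ "[a]"]) (auto simp: ipath_single)
  next
    case (step y z)
    then obtain p where p: "ipath E p" "set p \<subseteq> W" "hd p = a" "last p = y" by blast
    then have ne: "p \<noteq> []" by (simp add: ipath_def)
    show ?case
    proof (cases "z \<in> set p")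
      case True
      then obtain i where i: "i < length p" "p ! i = z" by (metis in_set_conv_nth)
      then have "last (take (Suc i) p) = z" by (simp add: take_Suc_conv_app_nth)
      then show ?thesis
        using p i ne by (intro exI[of _ "take (Suc i) p"]) (auto simp: ipath_take dest: in_set_takeD)
    next
      case False
      define k where "k = (LEAST k. k < length p \<and> (p ! k, z) \<in> E)"
      have "length p - 1 < length p \<and> (p ! (length p - 1), z) \<in> E"
        using ne p(4) step(2) by (simp add: last_conv_nth)
      then have k: "k < length p \<and> (p ! k, z) \<in> E" unfolding k_def by (rule LeastI)
      have na: "(p ! i, z) \<notin> E" if "i < k" for i
        using not_less_Least[of i "\<lambda>k. k < length p \<and> (p ! k, z) \<in> E"] that k
        unfolding k_def[symmetric] by auto
      have "last (take (Suc k) p) = p ! k" using k by (simp add: take_Suc_conv_app_nth)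
      then have "ipath E (take (Suc k) p @ [z])"
        using p(1) E False k na by (intro ipath_snoc) (auto simp: ipath_take dest: in_set_takeD)
      then show ?thesis
        using p(2,3) ne step by (intro exI[of _ "take (Suc k) p @ [z]"]) (auto dest: in_set_takeD)
    qed
  qed
qed

lemma cycle_graph_wf: "n > 0 \<Longrightarrow> parcs (cycle_graph n) \<subseteq> pverts (cycle_graph n) \<times> pverts (cycle_graph n)"
  by (auto simp: cycle_graph_def Let_def)

lemma parcs_cycle_graph:
  assumes "i < n" "j < n"
  shows "(i, j) \<in> parcs (cycle_graph n) \<longleftrightarrow> j = Suc i mod n \<or> i = Suc j mod n"
  using assms by (auto simp: cycle_graph_def Let_def)

text \<open>A chordless cycle with vertices \<open>c 0\<close>, ..., \<open>c (n - 1)\<close>.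
  Triangles are included, so \<open>K_4\<close> counts as a wheel.\<close>

definition is_hole :: "'a rel \<Rightarrow> nat \<Rightarrow> (nat \<Rightarrow> 'a) \<Rightarrow> bool" where
  "is_hole E n c \<longleftrightarrow> 3 \<le> n \<and> inj_on c {..<n} \<and>
    (\<forall>i < n. \<forall>j < n. (c i, c j) \<in> E \<longleftrightarrow> j = Suc i mod n \<or> i = Suc j mod n)"

lemma wheel_free_iff:
  assumes G: "pair_graph G"
  shows "wheel_free G \<longleftrightarrow>
    (\<nexists>n c u. is_hole (parcs G) n c \<and> u \<in> pverts G \<and> u \<notin> c ` {..<n} \<and> c ` {..<n} \<subseteq> pverts G \<and>
      3 \<le> card {w \<in> c ` {..<n}. (u, w) \<in> parcs G})"
proof -
  let ?E = "parcs G"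
  note g = pair_graphD[OF G]
  have wheel: "is_wheel \<lparr>pverts = U, parcs = ?E \<inter> U \<times> U\<rparr> \<longleftrightarrow>
      (\<exists>u \<in> U. \<exists>n c. is_hole ?E n c \<and> c ` {..<n} = U - {u} \<and> 3 \<le> card {w \<in> c ` {..<n}. (u, w) \<in> ?E})"
    if U: "U \<subseteq> pverts G" for U
  proof -
    let ?W = "\<lparr>pverts = U, parcs = ?E \<inter> U \<times> U\<rparr>"
    have pg: "pair_graph ?W"
      using g U by (intro pair_graphI) (auto intro: finite_subset simp: sym_def irrefl_def)
    have del: "with_proj ?W \<restriction> (pverts ?W - {u}) =
        with_proj \<lparr>pverts = U - {u}, parcs = ?E \<inter> (U - {u}) \<times> (U - {u})\<rparr>" for u
      by (auto simp: induce_subgraph_def with_proj_def)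
    have deg: "out_degree (with_proj ?W) u = card {w \<in> U - {u}. (u, w) \<in> ?E}" if "u \<in> U" for u
      unfolding out_degree_eq_card using that g(5) by (intro arg_cong[where f = card]) (auto simp: irrefl_def)
    have iso: "digraph_iso (with_proj ?W \<restriction> (pverts ?W - {u})) (with_proj (cycle_graph n)) \<longleftrightarrow>
        (\<exists>c. is_hole ?E n c \<and> c ` {..<n} = U - {u})" (is "?L \<longleftrightarrow> ?R") if "3 \<le> n" for n u
    proof -
      let ?V = "U - {u}"
      let ?X = "\<lparr>pverts = ?V, parcs = ?E \<inter> ?V \<times> ?V\<rparr>"
      have "?L \<longleftrightarrow> (\<exists>h. is_pair_iso h ?V (?E \<inter> ?V \<times> ?V) {..<n} (parcs (cycle_graph n)))"
        unfolding del using digraph_iso_iff[of ?X "cycle_graph n"] cycle_graph_wf[of n] that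
        by (simp add: cycle_graph_def Let_def)
      also have "\<dots> \<longleftrightarrow> ?R"
      proof
        assume "\<exists>h. is_pair_iso h ?V (?E \<inter> ?V \<times> ?V) {..<n} (parcs (cycle_graph n))"
        then obtain h where "is_pair_iso h ?V (?E \<inter> ?V \<times> ?V) {..<n} (parcs (cycle_graph n))" by blast
        from is_pair_iso_inv_into[OF this] have "is_hole ?E n (inv_into ?V h)" "inv_into ?V h ` {..<n} = ?V"
          using \<open>3 \<le> n\<close> parcs_cycle_graph by (auto simp: is_hole_def is_pair_iso_def bij_betw_def)
        then show ?R by blast
      next
        assume ?R
        then obtain c where c: "is_hole ?E n c" "c ` {..<n} = ?V" by blast
        then have "is_pair_iso c {..<n} (parcs (cycle_graph n)) ?V (?E \<inter> ?V \<times> ?V)"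
          using parcs_cycle_graph by (auto simp: is_hole_def is_pair_iso_def bij_betw_def)
        from is_pair_iso_inv_into[OF this] show "\<exists>h. is_pair_iso h ?V (?E \<inter> ?V \<times> ?V) {..<n} (parcs (cycle_graph n))"
          by blast
      qed
      finally show ?thesis .
    qed
    show ?thesis
      unfolding is_wheel_def
    proof (intro iffI)
      assume "pair_graph ?W \<and> (\<exists>u \<in> pverts ?W. (\<exists>n\<ge>3. digraph_iso (with_proj ?W \<restriction> (pverts ?W - {u}))
        (with_proj (cycle_graph n))) \<and> 3 \<le> out_degree (with_proj ?W) u)"
      then obtain u n where u: "u \<in> U" "3 \<le> n" "3 \<le> out_degree (with_proj ?W) u"
        "digraph_iso (with_proj ?W \<restriction> (pverts ?W - {u})) (with_proj (cycle_graph n))"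
        by (metis pair_pre_digraph.select_convs(1))
      then obtain c where c: "is_hole ?E n c" "c ` {..<n} = U - {u}" using iso[of n u] by blast
      have "3 \<le> card {w \<in> c ` {..<n}. (u, w) \<in> ?E}" using u(1,3) deg[of u] c(2) by simp
      with u(1) c show "\<exists>u\<in>U. \<exists>n c. is_hole ?E n c \<and> c ` {..<n} = U - {u} \<and> 3 \<le> card {w \<in> c ` {..<n}. (u, w) \<in> ?E}"
        by (intro bexI[of _ u] exI[of _ n] exI[of _ c] conjI)
    next
      assume "\<exists>u\<in>U. \<exists>n c. is_hole ?E n c \<and> c ` {..<n} = U - {u} \<and> 3 \<le> card {w \<in> c ` {..<n}. (u, w) \<in> ?E}"
      then obtain u n c where c: "u \<in> U" "is_hole ?E n c" "c ` {..<n} = U - {u}"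
        and c3: "3 \<le> card {w \<in> c ` {..<n}. (u, w) \<in> ?E}"
        by (elim bexE exE conjE)
      have n: "3 \<le> n" using c(2) by (simp add: is_hole_def)
      have "digraph_iso (with_proj ?W \<restriction> (pverts ?W - {u})) (with_proj (cycle_graph n))"
        using iso[OF n, of u] c by blast
      then show "pair_graph ?W \<and> (\<exists>u \<in> pverts ?W. (\<exists>n\<ge>3. digraph_iso (with_proj ?W \<restriction> (pverts ?W - {u}))
        (with_proj (cycle_graph n))) \<and> 3 \<le> out_degree (with_proj ?W) u)"
        using pg n c(1) c3[unfolded c(3)] deg[OF c(1)]
        by (intro conjI bexI[of _ u] exI[of _ n]) simp_all
    qed
  qed
  show ?thesis
    unfolding wheel_free_def has_induced_iff[OF G]
  proof (intro arg_cong[where f = Not] iffI)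
    assume "\<exists>U\<subseteq>pverts G. is_wheel \<lparr>pverts = U, parcs = ?E \<inter> U \<times> U\<rparr>"
    then obtain U where U: "U \<subseteq> pverts G" "is_wheel \<lparr>pverts = U, parcs = ?E \<inter> U \<times> U\<rparr>" by blast
    from U(2)[unfolded wheel[OF U(1)]] obtain u n c where "u \<in> U" "is_hole ?E n c" "c ` {..<n} = U - {u}"
        "3 \<le> card {w \<in> c ` {..<n}. (u, w) \<in> ?E}" by (elim bexE exE conjE)
    with U(1) show "\<exists>n c u. is_hole ?E n c \<and> u \<in> pverts G \<and> u \<notin> c ` {..<n} \<and> c ` {..<n} \<subseteq> pverts G \<and>
      3 \<le> card {w \<in> c ` {..<n}. (u, w) \<in> ?E}" by (intro exI[of _ n] exI[of _ c] exI[of _ u] conjI) auto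
  next
    assume "\<exists>n c u. is_hole ?E n c \<and> u \<in> pverts G \<and> u \<notin> c ` {..<n} \<and> c ` {..<n} \<subseteq> pverts G \<and>
      3 \<le> card {w \<in> c ` {..<n}. (u, w) \<in> ?E}"
    then obtain n c u where c: "is_hole ?E n c" "u \<in> pverts G" "u \<notin> c ` {..<n}" "c ` {..<n} \<subseteq> pverts G"
      "3 \<le> card {w \<in> c ` {..<n}. (u, w) \<in> ?E}" by (elim exE conjE)
    define U where "U = insert u (c ` {..<n})"
    have U: "U \<subseteq> pverts G" "u \<in> U" "c ` {..<n} = U - {u}" using c(2-4) by (auto simp: U_def)
    have "is_wheel \<lparr>pverts = U, parcs = ?E \<inter> U \<times> U\<rparr>"
      unfolding wheel[OF U(1)] using U(2,3) c(1,5) by (intro bexI[of _ u] exI[of _ n] exI[of _ c] conjI)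
    then show "\<exists>U\<subseteq>pverts G. is_wheel \<lparr>pverts = U, parcs = ?E \<inter> U \<times> U\<rparr>" using U(1) by blast
  qed
qed

text \<open>The form in which wheels are found: the rim is \<open>p\<close> followed by the reverse
  of \<open>q\<close>. The condition on cross edges also covers a path with one vertex, which is
  both its start and its end; the bound on the lengths excludes degenerate cycles.\<close>

lemma two_ipaths_wheel:
  assumes G: "pair_graph G" and wf: "wheel_free G"
    and p: "ipath (parcs G) p" "set p \<subseteq> pverts G" and q: "ipath (parcs G) q" "set q \<subseteq> pverts G"
    and disj: "set p \<inter> set q = {}" and len: "3 \<le> length p + length q"
    and cross: "\<And>i j. i < length p \<Longrightarrow> j < length q \<Longrightarrow>
      (p ! i, q ! j) \<in> parcs G \<longleftrightarrow> i = 0 \<and> j = 0 \<or> Suc i = length p \<and> Suc j = length q"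
    and u: "u \<in> pverts G" "u \<notin> set p \<union> set q"
    and xyz: "{x, y, z} \<subseteq> set p \<union> set q" "x \<noteq> y" "x \<noteq> z" "y \<noteq> z"
      "(u, x) \<in> parcs G" "(u, y) \<in> parcs G" "(u, z) \<in> parcs G"
  shows False
proof -
  let ?E = "parcs G"
  define n where "n = length p + length q"
  define c where "c i = (p @ rev q) ! i" for i
  have s: "sym ?E" using pair_graphD(4)[OF G] .
  have pos: "0 < length p" "0 < length q" using p q by (auto simp: ipath_def)
  have c1: "c i = p ! i" if "i < length p" for i using that by (simp add: c_def nth_append)
  \<comment> \<open>On the reversed part, position \<open>length p\<close> of the rim is the end of
    \<open>q\<close> and position \<open>n - 1\<close> is its start.\<close>
  have c2: "c i = q ! (n - Suc i)" if "length p \<le> i" "i < n" for i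
    using that by (auto simp: c_def nth_append n_def rev_nth intro!: arg_cong[where f = "(!) q"])
  have cim: "c ` {..<n} = set p \<union> set q"
  proof -
    have "c ` {..<n} = set (p @ rev q)"
      unfolding c_def n_def set_conv_nth by (auto simp: image_def)
    then show ?thesis by simp
  qed
  have "is_hole ?E n c"
    unfolding is_hole_def
  proof (intro conjI allI impI)
    have "distinct (p @ rev q)" using p q disj by (auto simp: ipath_def)
    then show "inj_on c {..<n}" unfolding c_def n_def by (auto simp: inj_on_def nth_eq_iff_index_eq)
    fix i j assume ij: "i < n" "j < n"
    have suc: "Suc i mod n = (if Suc i = n then 0 else Suc i)" "Suc j mod n = (if Suc j = n then 0 else Suc j)"
      using ij by auto
    consider "i < length p" "j < length p" | "i < length p" "length p \<le> j"
      | "length p \<le> i" "j < length p" | "length p \<le> i" "length p \<le> j" by linarith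
    then show "(c i, c j) \<in> ?E \<longleftrightarrow> j = Suc i mod n \<or> i = Suc j mod n"
    proof cases
      case 1
      moreover from this have "Suc i \<noteq> n" "Suc j \<noteq> n" using pos unfolding n_def by linarith+
      ultimately show ?thesis using ipathD[OF p(1), of i j] unfolding suc by (simp add: c1)
    next
      case 2
      then show ?thesis
        using cross[of i "n - Suc j"] ij pos len unfolding suc by (auto simp: c1 c2 n_def)
    next
      case 3
      then have "(c i, c j) \<in> ?E \<longleftrightarrow> (c j, c i) \<in> ?E" using s by (auto dest: symD)
      then show ?thesis
        using 3 cross[of j "n - Suc i"] ij pos len unfolding suc by (auto simp: c1 c2 n_def)
    next
      case 4
      show ?thesis
      proof -
        have "n - Suc i < length q" "n - Suc j < length q" using 4 ij n_def by linarith+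
        moreover have "n - Suc j = Suc (n - Suc i) \<longleftrightarrow> i = Suc j" "n - Suc i = Suc (n - Suc j) \<longleftrightarrow> j = Suc i"
          using ij by linarith+
        moreover have "i \<noteq> 0" "j \<noteq> 0" using 4 pos by linarith+
        ultimately show ?thesis
          using ipathD[OF q(1), of "n - Suc i" "n - Suc j"] ij unfolding suc c2[OF 4(1) ij(1)] c2[OF 4(2) ij(2)]
          by auto
      qed
    qed
  qed (use len n_def in simp)
  moreover have "3 \<le> card {w \<in> c ` {..<n}. (u, w) \<in> ?E}"
  proof -
    have "card {x, y, z} \<le> card {w \<in> c ` {..<n}. (u, w) \<in> ?E}"
      using xyz cim by (intro card_mono) auto
    then show ?thesis using xyz by simp
  qed
  ultimately show False
    using wf u p(2) q(2) cim unfolding wheel_free_iff[OF G]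
    by (elim notE, intro exI[of _ n] exI[of _ c] exI[of _ u] conjI) auto
qed

section \<open>Forbidden induced subgraphs\<close>

text \<open>Irreflexivity makes pairwise adjacent vertices distinct.\<close>

lemma has_K4_iff:
  assumes G: "pair_graph G"
  shows "has_induced is_K4 G \<longleftrightarrow> (\<exists>a b c d. {(a, b), (a, c), (a, d), (b, c), (b, d), (c, d)} \<subseteq> parcs G)"
proof
  note g = pair_graphD[OF G]
  {
    assume "has_induced is_K4 G"
    then obtain U where U: "U \<subseteq> pverts G" "card U = 4"
      "parcs G \<inter> U \<times> U = {(u, v). (u, v) \<in> U \<times> U \<and> u \<noteq> v}"
      unfolding has_induced_iff[OF G] is_K4_def complete_digraph_pair_def by auto
    from U(2) obtain a b c d where "U = {a, b, c, d}" "distinct [a, b, c, d]"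
      by (auto simp: numeral_eq_Suc card_Suc_eq)
    then have "{(a, b), (a, c), (a, d), (b, c), (b, d), (c, d)} \<subseteq> {(u, v). (u, v) \<in> U \<times> U \<and> u \<noteq> v}"
      by auto
    then show "\<exists>a b c d. {(a, b), (a, c), (a, d), (b, c), (b, d), (c, d)} \<subseteq> parcs G"
      unfolding U(3)[symmetric] by blast
  next
    assume "\<exists>a b c d. {(a, b), (a, c), (a, d), (b, c), (b, d), (c, d)} \<subseteq> parcs G"
    then obtain a b c d where e: "{(a, b), (a, c), (a, d), (b, c), (b, d), (c, d)} \<subseteq> parcs G" by blast
    then have e': "{(b, a), (c, a), (d, a), (c, b), (d, b), (d, c)} \<subseteq> parcs G" using g(4) by (auto dest: symD)
    have ne: "distinct [a, b, c, d]" using e g(5) by (auto simp: irrefl_def)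
    let ?U = "{a, b, c, d}"
    have "?U \<subseteq> pverts G" "card ?U = 4" using e g(3) ne by auto
    moreover have "parcs G \<inter> ?U \<times> ?U = {(u, v). (u, v) \<in> ?U \<times> ?U \<and> u \<noteq> v}"
      using e e' g(5) by (auto simp: irrefl_def)
    ultimately show "has_induced is_K4 G"
      unfolding has_induced_iff[OF G] is_K4_def complete_digraph_pair_def by (intro exI[of _ ?U]) auto
  }
qed

lemma has_claw_iff:
  assumes G: "pair_graph G"
  shows "has_induced is_claw G \<longleftrightarrow> (\<exists>u x y z. {(u, x), (u, y), (u, z)} \<subseteq> parcs G \<and> distinct [x, y, z] \<and>
    (x, y) \<notin> parcs G \<and> (x, z) \<notin> parcs G \<and> (y, z) \<notin> parcs G)"
    (is "_ \<longleftrightarrow> ?R")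
proof
  note g = pair_graphD[OF G]
  {
    assume "has_induced is_claw G"
    then obtain W U V where W: "W \<subseteq> pverts G" "W = U \<union> V" "U \<inter> V = {}" "card U = 1" "card V = 3"
      "parcs G \<inter> W \<times> W = U \<times> V \<union> V \<times> U"
      unfolding has_induced_iff[OF G] is_claw_def complete_bipartite_digraph_pair_def by auto
    then obtain u x y z where UV: "U = {u}" "V = {x, y, z}" "distinct [x, y, z]"
      by (auto simp: card_1_singleton_iff card_3_iff)
    have "{(u, x), (u, y), (u, z)} \<subseteq> U \<times> V \<union> V \<times> U" "(x, y) \<notin> U \<times> V \<union> V \<times> U"
      "(x, z) \<notin> U \<times> V \<union> V \<times> U" "(y, z) \<notin> U \<times> V \<union> V \<times> U"
      using UV W(3) by auto
    then have "{(u, x), (u, y), (u, z)} \<subseteq> parcs G \<and> distinct [x, y, z] \<and>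
      (x, y) \<notin> parcs G \<and> (x, z) \<notin> parcs G \<and> (y, z) \<notin> parcs G"
      using UV W(2) unfolding W(6)[symmetric] by simp
    then show ?R by (intro exI)
  next
    assume ?R
    then obtain u x y z where e: "{(u, x), (u, y), (u, z)} \<subseteq> parcs G" "distinct [x, y, z]"
      "(x, y) \<notin> parcs G" "(x, z) \<notin> parcs G" "(y, z) \<notin> parcs G" by blast
    have e': "{(x, u), (y, u), (z, u)} \<subseteq> parcs G" "(y, x) \<notin> parcs G" "(z, x) \<notin> parcs G" "(z, y) \<notin> parcs G"
      using e g(4) by (auto dest: symD)
    have ne: "u \<notin> {x, y, z}" using e g(5) by (auto simp: irrefl_def)
    let ?U = "{u} \<union> {x, y, z}"
    have "?U \<subseteq> pverts G" using e g(3) by auto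
    moreover have "parcs G \<inter> ?U \<times> ?U = {u} \<times> {x, y, z} \<union> {x, y, z} \<times> {u}"
      using e e' g(5) by (auto simp: irrefl_def)
    moreover have "card {x, y, z} = 3" "card {u} = 1" "{u} \<inter> {x, y, z} = {}" using e(2) ne by auto
    ultimately show "has_induced is_claw G"
      unfolding has_induced_iff[OF G] is_claw_def complete_bipartite_digraph_pair_def
      by (intro exI[of _ ?U] conjI exI[of _ "{u}"] exI[of _ "{x, y, z}"]) simp_all
  }
qed

text \<open>Distinctness has to be stated only for \<open>a\<close> and \<open>b\<close>; the
  vertices of every other pair are adjacent.\<close>

lemma has_diamond_iff:
  assumes G: "pair_graph G"
  shows "has_induced is_diamond G \<longleftrightarrow> (\<exists>a b u v. {(u, v), (a, u), (a, v), (b, u), (b, v)} \<subseteq> parcs G \<and> a \<noteq> b \<and>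
    (a, b) \<notin> parcs G)" (is "_ \<longleftrightarrow> ?R")
proof -
  note g = pair_graphD[OF G]
  have lt: "i < 4 \<longleftrightarrow> i \<in> {0, 1, 2, 3}" for i :: nat by auto
  have "has_induced is_diamond G \<longleftrightarrow> (\<exists>g. inj_on g (pverts diamond_graph) \<and> g ` pverts diamond_graph \<subseteq> pverts G \<and>
      (\<forall>i \<in> pverts diamond_graph. \<forall>j \<in> pverts diamond_graph. (g i, g j) \<in> parcs G \<longleftrightarrow> (i, j) \<in> parcs diamond_graph))"
    unfolding is_diamond_def by (rule has_induced_iso_iff[OF G]) (auto simp: diamond_graph_def)
  also have "\<dots> \<longleftrightarrow> ?R"
  proof
    assume "\<exists>g. inj_on g (pverts diamond_graph) \<and> g ` pverts diamond_graph \<subseteq> pverts G \<and>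
      (\<forall>i \<in> pverts diamond_graph. \<forall>j \<in> pverts diamond_graph. (g i, g j) \<in> parcs G \<longleftrightarrow> (i, j) \<in> parcs diamond_graph)"
    then obtain g where h: "inj_on g {..<4::nat}"
      and e: "\<And>i j. i < 4 \<Longrightarrow> j < 4 \<Longrightarrow> (g i, g j) \<in> parcs G \<longleftrightarrow> i \<noteq> j \<and> {i, j} \<noteq> {0, 1}"
      by (auto simp: diamond_graph_def)
    have "g 0 \<noteq> g 1" using h by (auto dest: inj_onD)
    moreover have "(g 0, g 1) \<notin> parcs G" using e[of 0 1] by simp
    moreover have "{(g 2, g 3), (g 0, g 2), (g 0, g 3), (g 1, g 2), (g 1, g 3)} \<subseteq> parcs G"
      using e[of 2 3] e[of 0 2] e[of 0 3] e[of 1 2] e[of 1 3] by (auto simp: doubleton_eq_iff)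
    ultimately show ?R by blast
  next
    assume ?R
    then obtain a b u v where e: "{(u, v), (a, u), (a, v), (b, u), (b, v)} \<subseteq> parcs G" "a \<noteq> b" "(a, b) \<notin> parcs G"
      by blast
    have e': "{(v, u), (u, a), (v, a), (u, b), (v, b)} \<subseteq> parcs G" "(b, a) \<notin> parcs G"
      using e g(4) by (auto dest: symD)
    have ir: "(x, x) \<notin> parcs G" for x using g(5) by (simp add: irrefl_def)
    have ne: "distinct [a, b, u, v]" using e ir by auto
    have V: "{a, b, u, v} \<subseteq> pverts G" using e(1) g(3) by blast
    define f where "f i = [a, b, u, v] ! i" for i
    have f: "f 0 = a" "f (Suc 0) = b" "f 2 = u" "f 3 = v" by (simp_all add: f_def eval_nat_numeral)
    show "\<exists>g. inj_on g (pverts diamond_graph) \<and> g ` pverts diamond_graph \<subseteq> pverts G \<and>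
      (\<forall>i \<in> pverts diamond_graph. \<forall>j \<in> pverts diamond_graph. (g i, g j) \<in> parcs G \<longleftrightarrow> (i, j) \<in> parcs diamond_graph)"
    proof (intro exI[of _ f] conjI ballI)
      show "inj_on f (pverts diamond_graph)"
        using ne by (auto simp: diamond_graph_def inj_on_def lt f)
      show "f ` pverts diamond_graph \<subseteq> pverts G"
        using V by (auto simp: diamond_graph_def lt f)
      fix i j assume "i \<in> pverts diamond_graph" "j \<in> pverts diamond_graph"
      then show "(f i, f j) \<in> parcs G \<longleftrightarrow> (i, j) \<in> parcs diamond_graph"
        using e e' ir by (auto simp: diamond_graph_def lt f doubleton_eq_iff)
    qed
  qed
  finally show ?thesis .
qed

text \<open>Distinctness across the two triangles follows from the nonedges: \<open>a = d\<close>,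
  for instance, would make \<open>(a, e)\<close> an arc.\<close>

lemma has_butterfly_iff:
  assumes G: "pair_graph G"
  shows "has_induced is_butterfly G \<longleftrightarrow> (\<exists>c a b d e. {(c, a), (c, b), (c, d), (c, e), (a, b), (d, e)} \<subseteq> parcs G \<and>
    (a, d) \<notin> parcs G \<and> (a, e) \<notin> parcs G \<and> (b, d) \<notin> parcs G \<and> (b, e) \<notin> parcs G)" (is "_ \<longleftrightarrow> ?R")
proof -
  note g = pair_graphD[OF G]
  let ?B = "butterfly_graph"
  have lt: "i < 5 \<longleftrightarrow> i \<in> {0, 1, 2, 3, 4}" for i :: nat by auto
  have "has_induced is_butterfly G \<longleftrightarrow> (\<exists>g. inj_on g (pverts ?B) \<and> g ` pverts ?B \<subseteq> pverts G \<and>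
      (\<forall>i \<in> pverts ?B. \<forall>j \<in> pverts ?B. (g i, g j) \<in> parcs G \<longleftrightarrow> (i, j) \<in> parcs ?B))"
    unfolding is_butterfly_def by (rule has_induced_iso_iff[OF G]) (auto simp: butterfly_graph_def Let_def)
  also have "\<dots> \<longleftrightarrow> ?R"
  proof
    assume "\<exists>g. inj_on g (pverts ?B) \<and> g ` pverts ?B \<subseteq> pverts G \<and>
      (\<forall>i \<in> pverts ?B. \<forall>j \<in> pverts ?B. (g i, g j) \<in> parcs G \<longleftrightarrow> (i, j) \<in> parcs ?B)"
    then obtain g where g': "\<forall>i \<in> pverts ?B. \<forall>j \<in> pverts ?B. (g i, g j) \<in> parcs G \<longleftrightarrow> (i, j) \<in> parcs ?B"
      by (elim exE conjE)
    have "pverts ?B = {..<5}" by (simp add: butterfly_graph_def Let_def)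
    then have e: "(g i, g j) \<in> parcs G \<longleftrightarrow> (i, j) \<in> parcs ?B" if "i < 5" "j < 5" for i j
      using g' that by blast
    have "{(g 0, g 1), (g 0, g 2), (g 0, g 3), (g 0, g 4), (g 1, g 2), (g 3, g 4)} \<subseteq> parcs G \<and>
      (g 1, g 3) \<notin> parcs G \<and> (g 1, g 4) \<notin> parcs G \<and> (g 2, g 3) \<notin> parcs G \<and> (g 2, g 4) \<notin> parcs G"
      using e[of 0 1] e[of 0 2] e[of 0 3] e[of 0 4] e[of 1 2] e[of 3 4] e[of 1 3] e[of 1 4] e[of 2 3] e[of 2 4]
      by (simp add: butterfly_graph_def Let_def)
    then show ?R by (intro exI)
  next
    assume ?R
    then obtain c a b d e where e: "{(c, a), (c, b), (c, d), (c, e), (a, b), (d, e)} \<subseteq> parcs G"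
      "(a, d) \<notin> parcs G" "(a, e) \<notin> parcs G" "(b, d) \<notin> parcs G" "(b, e) \<notin> parcs G"
      by (elim exE conjE)
    have e': "{(a, c), (b, c), (d, c), (e, c), (b, a), (e, d)} \<subseteq> parcs G"
      "(d, a) \<notin> parcs G" "(e, a) \<notin> parcs G" "(d, b) \<notin> parcs G" "(e, b) \<notin> parcs G"
      using e g(4) by (auto dest: symD)
    have ir: "(x, x) \<notin> parcs G" for x using g(5) by (simp add: irrefl_def)
    have ne: "distinct [c, a, b, d, e]" using e e' ir by auto
    have V: "{c, a, b, d, e} \<subseteq> pverts G" using e(1) g(3) by blast
    define f where "f i = [c, a, b, d, e] ! i" for i
    have f: "f 0 = c" "f (Suc 0) = a" "f 2 = b" "f 3 = d" "f 4 = e" by (simp_all add: f_def eval_nat_numeral)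
    show "\<exists>g. inj_on g (pverts ?B) \<and> g ` pverts ?B \<subseteq> pverts G \<and>
      (\<forall>i \<in> pverts ?B. \<forall>j \<in> pverts ?B. (g i, g j) \<in> parcs G \<longleftrightarrow> (i, j) \<in> parcs ?B)"
    proof (intro exI[of _ f] conjI ballI)
      show "inj_on f (pverts ?B)"
        using ne by (auto simp: butterfly_graph_def inj_on_def lt f Let_def)
      show "f ` pverts ?B \<subseteq> pverts G"
        using V by (auto simp: butterfly_graph_def lt f Let_def)
      fix i j assume "i \<in> pverts ?B" "j \<in> pverts ?B"
      then have "i \<in> {0, 1, 2, 3, 4}" "j \<in> {0, 1, 2, 3, 4}" by (auto simp: butterfly_graph_def Let_def)
      then show "(f i, f j) \<in> parcs G \<longleftrightarrow> (i, j) \<in> parcs ?B"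
        using e e' by (elim insertE emptyE; simp add: butterfly_graph_def f Let_def ir)
    qed
  qed
  finally show ?thesis .
qed

text \<open>The leaves of a claw would be three pairwise disjoint edges of \<open>H\<close>, each
  meeting the edge at the centre, which has only two ends.\<close>

lemma line_graph_claw_free:
  assumes G: "pair_graph G" and L: "is_line_graph G"
  shows "\<not> has_induced is_claw G"
proof
  assume "has_induced is_claw G"
  then obtain u x y z where c: "{(u, x), (u, y), (u, z)} \<subseteq> parcs G" "distinct [x, y, z]"
    "(x, y) \<notin> parcs G" "(x, z) \<notin> parcs G" "(y, z) \<notin> parcs G" unfolding has_claw_iff[OF G] by blast
  from c(1) pair_graphD(3)[OF G] have V: "{u, x, y, z} \<subseteq> pverts G" by auto
  from L obtain H :: "nat pair_pre_digraph" and h where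
    h: "is_pair_iso h (pverts G) (parcs G) (pverts (line_graph H)) (parcs (line_graph H))"
    unfolding is_line_graph_def
    by (subst (asm) digraph_iso_iff[OF pair_graphD(3)[OF G]]) (auto simp: line_graph_def)
  then have mem: "h v \<in> uedges H" if "v \<in> pverts G" for v
    using that by (auto simp: is_pair_iso_def bij_betw_def line_graph_def)
  have adj: "(v, w) \<in> parcs G \<longleftrightarrow> h v \<noteq> h w \<and> h v \<inter> h w \<noteq> {}" if "v \<in> pverts G" "w \<in> pverts G" for v w
    using h that mem[OF that(1)] mem[OF that(2)] unfolding is_pair_iso_def line_graph_def by auto
  have inj: "inj_on h (pverts G)" using h by (simp add: is_pair_iso_def bij_betw_def)
  obtain s t where st: "h u = {s, t}" using mem[of u] V by (auto simp: uedges_def)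
  have ne: "h x \<noteq> h y" "h x \<noteq> h z" "h y \<noteq> h z" using inj c(2) V by (auto dest: inj_onD)
  have "h u \<inter> h x \<noteq> {}" "h u \<inter> h y \<noteq> {}" "h u \<inter> h z \<noteq> {}" using adj V c(1) by auto
  moreover have "h x \<inter> h y = {}" "h x \<inter> h z = {}" "h y \<inter> h z = {}" using adj V c(3-5) ne by auto
  ultimately show False using st by auto
qed

section \<open>Fans\<close>

lemma linked_Un:
  assumes "linked A E" "linked B E" "x \<in> A" "y \<in> B" "(x, y) \<in> E" "sym E"
  shows "linked (A \<union> B) E"
  unfolding linked_iff_rtrancl_on
proof (intro ballI)
  have m: "rtrancl_on W E \<subseteq> rtrancl_on (A \<union> B) E" if "W \<subseteq> A \<union> B" for W
    using rtrancl_on_mono[OF order_refl that, of _ _ E] by (auto simp: subset_iff)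
  have xy: "(x, y) \<in> rtrancl_on (A \<union> B) E" "(y, x) \<in> rtrancl_on (A \<union> B) E"
    using assms by (auto intro!: rtrancl_on_into_rtrancl_on[OF rtrancl_on_refl] dest: symD)
  have A: "(u, v) \<in> rtrancl_on (A \<union> B) E" if "u \<in> A" "v \<in> A" for u v
    using that assms(1) m[of A] by (auto simp: linked_iff_rtrancl_on)
  have B: "(u, v) \<in> rtrancl_on (A \<union> B) E" if "u \<in> B" "v \<in> B" for u v
    using that assms(2) m[of B] by (auto simp: linked_iff_rtrancl_on)
  have X: "(u, x) \<in> rtrancl_on (A \<union> B) E \<and> (x, u) \<in> rtrancl_on (A \<union> B) E" if "u \<in> A \<union> B" for u
    using that
  proof
    assume "u \<in> B"
    then show ?thesis using B[OF _ assms(4)] B[OF assms(4)] xy by (blast intro: rtrancl_on_trans)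
  qed (use A assms(3) in blast)
  fix u v assume "u \<in> A \<union> B" "v \<in> A \<union> B"
  then show "(u, v) \<in> rtrancl_on (A \<union> B) E"
    using X rtrancl_on_trans[of u x "A \<union> B" E v] by blast
qed

lemma linked_singleton: "linked {x} E"
  by (auto simp: linked_def)

lemma linked_insert:
  assumes "linked A E" "x \<in> A" "(x, y) \<in> E" "sym E"
  shows "linked (insert y A) E"
  using linked_Un[OF assms(1) linked_singleton[of y] assms(2) _ assms(3,4)] by simp

definition component :: "'a set \<Rightarrow> 'a rel \<Rightarrow> 'a \<Rightarrow> 'a set" where
  "component W E x = {y. (x, y) \<in> rtrancl_on W E}"

lemma component_props:
  assumes "sym E" "x \<in> W"
  shows "component W E x \<subseteq> W" "x \<in> component W E x" "linked (component W E x) E"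
    "\<And>y z. y \<in> component W E x \<Longrightarrow> z \<in> W \<Longrightarrow> (y, z) \<in> E \<Longrightarrow> z \<in> component W E x"
proof -
  let ?C = "component W E x"
  show "?C \<subseteq> W" "x \<in> ?C" using assms(2) by (auto simp: component_def dest: in_rtrancl_on_in_F)
  show "\<And>y z. y \<in> ?C \<Longrightarrow> z \<in> W \<Longrightarrow> (y, z) \<in> E \<Longrightarrow> z \<in> ?C"
    unfolding component_def by (auto intro: rtrancl_on_into_rtrancl_on)
  have "(x, y) \<in> rtrancl_on ?C E" if "(x, y) \<in> rtrancl_on W E" for y
    using that
  proof (induction rule: rtrancl_on_induct)
    case base
    then show ?case using \<open>x \<in> ?C\<close> by blast
  next
    case (step y z)
    then have "z \<in> ?C" unfolding component_def by (auto intro: rtrancl_on_into_rtrancl_on)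
    with step show ?case by (blast intro: rtrancl_on_into_rtrancl_on)
  qed
  then have R: "(x, y) \<in> rtrancl_on ?C E" if "y \<in> ?C" for y
    using that by (simp add: component_def)
  have S: "(y, x) \<in> rtrancl_on ?C E" if "y \<in> ?C" for y
    using R[OF that] rtrancl_on_sym[OF assms(1)] by (meson symD)
  show "linked ?C E"
    unfolding linked_iff_rtrancl_on
  proof (intro ballI)
    fix y z assume "y \<in> ?C" "z \<in> ?C"
    then show "(y, z) \<in> rtrancl_on ?C E" using rtrancl_on_trans[OF S R] by blast
  qed
qed

text \<open>If no arc led from the component of \<open>x\<close> in \<open>W - C\<close> to
  \<open>C\<close>, this component would be closed in all of \<open>W\<close>.\<close>

lemma linked_attach:
  assumes L: "linked W E" and E: "sym E" and x: "x \<in> W" "x \<notin> C" and C: "C \<subseteq> W" "C \<noteq> {}"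
  shows "\<exists>R \<subseteq> W - C. x \<in> R \<and> linked R E \<and> (\<exists>y \<in> R. \<exists>z \<in> C. (y, z) \<in> E)"
proof -
  let ?R = "component (W - C) E x"
  have xW: "x \<in> W - C" using x by blast
  note c = component_props[OF E xW]
  have "\<exists>y \<in> ?R. \<exists>z \<in> C. (y, z) \<in> E"
  proof (rule ccontr)
    assume "\<not> ?thesis"
    then have "?R = W"
      using c(4) by (intro linkedD[OF L _ c(2)]) (use c(1) in blast)+
    then show False using c(1) C by blast
  qed
  then show ?thesis using c(1-3) by (intro exI[of _ ?R] conjI)
qed

text \<open>The component of \<open>a\<close> after deletion of \<open>b\<close> must still touch
  \<open>b\<close>, or else it would be closed in \<open>A\<close>. In this way a connected set is
  cut off just in front of a vertex.\<close>

lemma linked_detach: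
  assumes L: "linked A E" and E: "sym E" and ab: "a \<in> A" "b \<in> A" "a \<noteq> b"
  shows "\<exists>A' \<subseteq> A - {b}. a \<in> A' \<and> linked A' E \<and> (\<exists>x \<in> A'. (x, b) \<in> E)"
proof -
  let ?R = "component (A - {b}) E a"
  have aA: "a \<in> A - {b}" using ab by blast
  note c = component_props[OF E aA]
  have "\<exists>y \<in> ?R. (y, b) \<in> E"
  proof (rule ccontr)
    assume "\<not> ?thesis"
    then have "?R = A"
      using c(4) by (intro linkedD[OF L _ c(2)]) (use c(1) in blast)+
    then show False using c(1) ab by blast
  qed
  then show ?thesis using c(1-3) by (intro exI[of _ ?R] conjI)
qed

text \<open>This amounts to two paths from \<open>a\<close> and \<open>b\<close> to \<open>w\<close>
  that meet only in \<open>w\<close>. Connected sets replace the paths because they can be enlarged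
  and cut without keeping track of an order.\<close>

definition fan :: "'a set \<Rightarrow> 'a rel \<Rightarrow> 'a \<Rightarrow> 'a \<Rightarrow> 'a \<Rightarrow> bool" where
  "fan V E a b w \<longleftrightarrow> (\<exists>A B. A \<subseteq> V - {w} \<and> B \<subseteq> V - {w} \<and> A \<inter> B = {} \<and> a \<in> A \<and> b \<in> B \<and>
     linked A E \<and> linked B E \<and> (\<exists>x \<in> A. (x, w) \<in> E) \<and> (\<exists>y \<in> B. (y, w) \<in> E))"

lemma fan_swap:
  assumes "fan V E a b w"
  shows "fan V E b a w"
proof -
  from assms obtain A B where "A \<subseteq> V - {w}" "B \<subseteq> V - {w}" "A \<inter> B = {}" "a \<in> A" "b \<in> B"
    "linked A E" "linked B E" "\<exists>x \<in> A. (x, w) \<in> E" "\<exists>y \<in> B. (y, w) \<in> E"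
    unfolding fan_def by blast
  then show ?thesis unfolding fan_def by (intro exI[of _ B] exI[of _ A]) (simp add: Int_commute)
qed

text \<open>One set is \<open>{a}\<close>; the other is the part of \<open>V - {a}\<close> that
  stays attached to \<open>b\<close> when \<open>w\<close> is cut off.\<close>

lemma fan_start:
  assumes L: "linked (V - {a}) E" and E: "sym E" "irrefl E" and ab: "a \<in> V" "b \<in> V" "a \<noteq> b"
    and w: "(a, w) \<in> E" "w \<in> V" "w \<noteq> b"
  shows "fan V E a b w"
proof -
  have "w \<noteq> a" using w E by (auto simp: irrefl_def)
  then obtain B where "B \<subseteq> V - {a} - {w}" "b \<in> B" "linked B E" "\<exists>x \<in> B. (x, w) \<in> E"
    using linked_detach[OF L E(1), of b w] ab w by auto
  then show ?thesis
    unfolding fan_def using ab w \<open>w \<noteq> a\<close>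
    by (intro exI[of _ "{a}"] exI[of _ B]) (auto simp: linked_singleton)
qed

text \<open>As \<open>V - {w}\<close> is connected, some connected piece contains \<open>w'\<close>,
  avoids \<open>w\<close> and touches the two sets; it is added to one that it touches.\<close>

lemma fan_detour:
  assumes L: "linked (V - {w}) E" and E: "sym E"
    and A: "A \<subseteq> V - {w}" "a \<in> A" "linked A E" and B: "B \<subseteq> V - {w}" "b \<in> B" "linked B E"
    and AB: "A \<inter> B = {}" and w': "w' \<in> V" "w' \<noteq> w"
  obtains A' B' where "A' \<subseteq> V - {w}" "B' \<subseteq> V - {w}" "A' \<inter> B' = {}" "a \<in> A'" "b \<in> B'"
    "linked A' E" "linked B' E" "A \<subseteq> A'" "B \<subseteq> B'" "w' \<in> A' \<union> B'"
proof (cases "w' \<in> A \<union> B")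
  case True
  then show ?thesis using A B AB by (intro that[of A B]) simp_all
next
  case False
  then obtain R y z where R: "R \<subseteq> V - {w} - (A \<union> B)" "w' \<in> R" "linked R E" and yz: "y \<in> R" "z \<in> A \<union> B" "(y, z) \<in> E"
    using linked_attach[OF L E, of w' "A \<union> B"] A B w' by blast
  have zy: "(z, y) \<in> E" using yz E by (meson symD)
  show ?thesis
  proof (cases "z \<in> A")
    case True
    then have "linked (A \<union> R) E" using linked_Un[OF A(3) R(3) _ yz(1) zy E] by blast
    then show ?thesis
      using R A B AB by (intro that[of "A \<union> R" B]) auto
  next
    case False
    then have "linked (B \<union> R) E" using linked_Un[OF B(3) R(3) _ yz(1) zy E] yz(2) by blast
    then show ?thesis
      using R A B AB by (intro that[of A "B \<union> R"]) auto
  qed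
qed

text \<open>
  The disjoint connected sets that reach \<open>w\<close> from \<open>a\<close> and \<open>b\<close> are rerouted to its neighbour \<open>w'\<close>: the
  set containing \<open>w'\<close> (after a detour avoiding \<open>w\<close>) is cut off before \<open>w'\<close>, the other one absorbs \<open>w\<close>.
\<close>

lemma fan_step:
  assumes f: "fan V E a b w" and L: "linked (V - {w}) E" and E: "sym E"
    and w: "w \<in> V" "w \<noteq> a" "w \<noteq> b" and w': "(w, w') \<in> E" "w' \<in> V" "w' \<noteq> w" "w' \<noteq> a" "w' \<noteq> b"
  shows "fan V E a b w'"
proof -
  have half: "fan V E a b w'"
    if A: "A \<subseteq> V - {w}" "a \<in> A" "linked A E" and B: "B \<subseteq> V - {w}" "linked B E"
      and AB: "A \<inter> B = {}" and b: "b \<in> B" and y: "\<exists>y \<in> B. (y, w) \<in> E" and wA: "w' \<in> A"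
      and w': "(w, w') \<in> E" "w' \<noteq> a" and w: "w \<in> V"
    for A B a b
  proof -
    obtain A' where "A' \<subseteq> A - {w'}" "a \<in> A'" "linked A' E" "\<exists>x \<in> A'. (x, w') \<in> E"
      using linked_detach[OF A(3) E A(2) wA] w' by metis
    moreover have "linked (insert w B) E" using y linked_insert[OF B(2) _ _ E] by blast
    ultimately show ?thesis
      unfolding fan_def using A B AB b w wA w'
      by (intro exI[of _ A'] exI[of _ "insert w B"]) auto
  qed
  obtain A B where AB: "A \<subseteq> V - {w}" "B \<subseteq> V - {w}" "A \<inter> B = {}" "a \<in> A" "b \<in> B"
    "linked A E" "linked B E" "\<exists>x \<in> A. (x, w) \<in> E" "\<exists>y \<in> B. (y, w) \<in> E"
    using f unfolding fan_def by blast
  obtain A' B' where d: "A' \<subseteq> V - {w}" "B' \<subseteq> V - {w}" "A' \<inter> B' = {}" "a \<in> A'" "b \<in> B'"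
    "linked A' E" "linked B' E" "A \<subseteq> A'" "B \<subseteq> B'" "w' \<in> A' \<union> B'"
    by (rule fan_detour[OF L E AB(1,4,6) AB(2,5,7) AB(3) w'(2,3)])
  have n: "\<exists>x \<in> A'. (x, w) \<in> E" "\<exists>y \<in> B'. (y, w) \<in> E" using d AB by blast+
  from d(10) show ?thesis
  proof
    assume wA: "w' \<in> A'"
    show ?thesis by (rule half[OF d(1,4,6) d(2,7) d(3,5) n(2) wA w'(1,4) w(1)])
  next
    assume wB: "w' \<in> B'"
    have BA: "B' \<inter> A' = {}" using d(3) by blast
    show ?thesis by (rule fan_swap, rule half[OF d(2,5,7) d(1,6) BA d(4) n(1) wB w'(1,5) w(1)])
  qed
qed

section \<open>Wheel-free graphs without claws\<close>

lemma k_connected_linkedD: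
  assumes "pair_graph G" "k_connected k G" "S \<subseteq> pverts G" "card S < k"
  shows "linked (pverts G - S) (parcs G)"
  using assms k_connected_iff_linked by blast

text \<open>Otherwise deleting the vertices of \<open>S\<close> isolates \<open>x\<close>, so
  \<open>x\<close> is all that remains, and there are at most \<open>k\<close> vertices.\<close>

lemma k_connected_neighbour:
  assumes G: "pair_graph G" and k: "k_connected k G" and x: "x \<in> pverts G" and S: "finite S" "card S < k"
  shows "\<exists>y. (x, y) \<in> parcs G \<and> y \<notin> S"
proof (rule ccontr)
  assume neg: "\<not> ?thesis"
  let ?S = "S \<inter> pverts G - {x}"
  have "card ?S \<le> card S" using S by (intro card_mono) auto
  then have L: "linked (pverts G - ?S) (parcs G)"
    using S(2) by (intro k_connected_linkedD[OF G k]) auto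
  have "{x} = pverts G - ?S"
    using neg x pair_graphD(5)[OF G]
    by (intro linkedD[OF L, where x = x]) (auto simp: irrefl_def)
  then have "pverts G \<subseteq> insert x ?S" by blast
  then have "card (pverts G) \<le> card (insert x ?S)" using S by (intro card_mono) auto
  also have "\<dots> \<le> Suc (card ?S)" by (intro card_insert_le_m1) (use S in auto)
  finally show False
    using k \<open>card ?S \<le> card S\<close> S(2) unfolding k_connected_def by linarith
qed

lemma ipath_pair:
  assumes "(x, y) \<in> E" "sym E" "irrefl E"
  shows "ipath E [x, y]"
  unfolding ipath_def using assms
  by (auto simp: irrefl_def less_Suc_eq dest: symD)

section \<open>Excluding \<open>K_4\<close> and the diamond\<close>

lemma wheel_free_K4_free:
  assumes G: "pair_graph G" and wf: "wheel_free G"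
    and e: "{(a, b), (a, c), (a, d), (b, c), (b, d), (c, d)} \<subseteq> parcs G"
  shows False
proof -
  note g = pair_graphD[OF G]
  have e': "{(b, a), (c, a), (d, a), (c, b), (d, b), (d, c)} \<subseteq> parcs G" using g(4) e by (auto dest: symD)
  have ne: "distinct [a, b, c, d]" using e g(5) by (auto simp: irrefl_def)
  have V: "{a, b, c, d} \<subseteq> pverts G" using e(1) g(3) by blast
  show False
    by (rule two_ipaths_wheel[OF G wf, of "[a, b]" "[c]" d a b c])
      (use e e' V ne g in \<open>auto simp: ipath_pair ipath_single less_Suc_eq\<close>)
qed

text \<open>An induced path \<open>p\<close> joins the nonadjacent vertices \<open>a\<close> and
  \<open>b\<close> outside \<open>{u, v}\<close>. If one of \<open>u\<close>, \<open>v\<close> has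
  no neighbour inside \<open>p\<close>, it closes \<open>p\<close> to a rim with the other one as
  hub. Otherwise claws confine the inner neighbours of \<open>u\<close> and \<open>v\<close> to the
  two extreme inner vertices of \<open>p\<close>, and \<open>K_4\<close> prevents a common one. Then
  the inner part of \<open>p\<close> with \<open>u\<close> and \<open>v\<close> is a rim with hub
  \<open>a\<close>.\<close>

lemma diamond_free:
  assumes G: "pair_graph G" and k: "k_connected 3 G" and wf: "wheel_free G" and cf: "\<not> has_induced is_claw G"
  shows "\<not> has_induced is_diamond G"
proof
  let ?E = "parcs G" and ?V = "pverts G"
  note g = pair_graphD[OF G]
  assume "has_induced is_diamond G"
  then obtain a b u v where e: "{(u, v), (a, u), (a, v), (b, u), (b, v)} \<subseteq> ?E" "a \<noteq> b" "(a, b) \<notin> ?E"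
    unfolding has_diamond_iff[OF G] by blast
  have e': "{(v, u), (u, a), (v, a), (u, b), (v, b)} \<subseteq> ?E" "(b, a) \<notin> ?E" using e g(4) by (auto dest: symD)
  have ir: "(x, x) \<notin> ?E" for x using g(5) by (simp add: irrefl_def)
  have ne: "distinct [a, b, u, v]" using e ir by auto
  have V: "{a, b, u, v} \<subseteq> ?V" using e(1) g(3) by blast
  have L: "linked (?V - {u, v}) ?E" using V ne by (intro k_connected_linkedD[OF G k]) auto
  obtain p where p: "ipath ?E p" "set p \<subseteq> ?V - {u, v}" "hd p = a" "last p = b"
    using ex_ipath[OF L g(4,5), of a b] V ne by auto
  have pne: "p \<noteq> []" using p by (auto simp: ipath_def)
  define n where "n = length p"
  have p0: "p ! 0 = a" and pn: "p ! (n - 1) = b"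
    using p pne by (simp_all add: hd_conv_nth last_conv_nth n_def)
  have "n \<noteq> 0" "n \<noteq> 1" "n \<noteq> 2" using pne p0 pn ne e(3) ipathD[OF p(1), of 0 1] by (auto simp: n_def)
  then have n: "3 \<le> n" by linarith
  have adj: "(p ! i, p ! j) \<in> ?E \<longleftrightarrow> j = Suc i \<or> i = Suc j" if "i < n" "j < n" for i j
    using ipathD[OF p(1)] that by (simp add: n_def)
  have inj: "p ! i = p ! j \<longleftrightarrow> i = j" if "i < n" "j < n" for i j
    using p(1) that by (simp add: n_def ipath_def nth_eq_iff_index_eq)
  have inner: "\<exists>i. 0 < i \<and> i < n - 1 \<and> (w, p ! i) \<in> ?E"
    if w: "{w, w'} = {u, v}" for w w'
  proof (rule ccontr)
    assume neg: "\<not> ?thesis"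
    have w1: "(w, a) \<in> ?E" "(w, b) \<in> ?E" "(w', a) \<in> ?E" "(w', b) \<in> ?E" "(w', w) \<in> ?E" "w \<noteq> w'"
      using w e e' ne by (auto simp: doubleton_eq_iff)
    have ww: "w \<in> ?V" "w' \<in> ?V" "w \<notin> set p" "w' \<notin> set p" using w V p(2) by (auto simp: doubleton_eq_iff)
    have c: "(p ! i, [w] ! j) \<in> ?E \<longleftrightarrow> i = 0 \<and> j = 0 \<or> Suc i = length p \<and> Suc j = length [w]"
      if "i < length p" "j < length [w]" for i j
    proof -
      have "(p ! i, w) \<in> ?E \<longleftrightarrow> (w, p ! i) \<in> ?E" using g(4) by (auto dest: symD)
      moreover have "\<not> (0 < i \<and> i < n - 1 \<and> (w, p ! i) \<in> ?E)" using neg by blast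
      moreover have "i = 0 \<or> 0 < i \<and> i < n - 1 \<or> i = n - 1" using that(1) n_def by linarith
      moreover have "Suc i = length p \<longleftrightarrow> i = n - 1" "j = 0" using that n n_def by auto
      ultimately show ?thesis using p0 pn w1 by auto
    qed
    have "a \<in> set p" "b \<in> set p" using p(3,4) pne by auto
    then show False
      by (intro two_ipaths_wheel[OF G wf p(1) _ ipath_single[of _ w] _ _ _ c, of w' a w b])
        (use w1 ww g(5) ne p(2) n V in \<open>auto simp: n_def\<close>)
  qed
  \<comment> \<open>Any other inner vertex would form, with \<open>a\<close> and \<open>b\<close>,
    the leaves of a claw at \<open>w\<close>.\<close>
  have ends: "i = 1 \<or> i = n - 2"
    if "w = u \<or> w = v" "0 < i" "i < n - 1" "(w, p ! i) \<in> ?E" for w i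
  proof (rule ccontr)
    assume neg: "\<not> ?thesis"
    have "(a, p ! i) \<notin> ?E" "(b, p ! i) \<notin> ?E" "a \<noteq> p ! i" "b \<noteq> p ! i"
      using adj[of 0 i] adj[of "n - 1" i] inj[of 0 i] inj[of "n - 1" i] that n neg p0 pn by auto
    then show False
      using cf that e e' ne unfolding has_claw_iff[OF G] by (auto simp: insert_subset)
  qed
  have final: False if w: "{w, w'} = {u, v}" and x: "(w, p ! 1) \<in> ?E" "(w', p ! (n - 2)) \<in> ?E" for w w'
  proof -
    have w1: "(w, a) \<in> ?E" "(w, b) \<in> ?E" "(w', a) \<in> ?E" "(w', b) \<in> ?E" "(w, w') \<in> ?E" "w \<noteq> w'"
      "(a, w) \<in> ?E" "(a, w') \<in> ?E" "(b, w) \<in> ?E" "(b, w') \<in> ?E"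
      using w e e' ne by (auto simp: doubleton_eq_iff)
    have ww: "w \<in> ?V" "w' \<in> ?V" "w \<notin> set p" "w' \<notin> set p" "w = u \<or> w = v" "w' = u \<or> w' = v"
      using w V p(2) by (auto simp: doubleton_eq_iff)
    have a1: "(a, p ! 1) \<in> ?E" and b1: "(b, p ! (n - 2)) \<in> ?E"
      using adj[of 0 1] adj[of "n - 1" "n - 2"] p0 pn n by auto
    have nw: "(w', p ! 1) \<notin> ?E" using wheel_free_K4_free[OF G wf, of w w' a "p ! 1"] w1 x a1 by auto
    have nw': "(w, p ! (n - 2)) \<notin> ?E" using wheel_free_K4_free[OF G wf, of w w' b "p ! (n - 2)"] w1 x b1 by auto
    \<comment> \<open>Both ends of \<open>p\<close> are dropped: \<open>a\<close> becomes the hub,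
      and \<open>b\<close> would be adjacent to \<open>w\<close> and \<open>w'\<close>.\<close>
    define q where "q = drop 1 (take (n - 1) p)"
    have lq: "length q = n - 2" using n by (simp add: q_def n_def)
    have q: "q ! i = p ! Suc i" if "i < n - 2" for i using that n by (simp add: q_def n_def)
    \<comment> \<open>For \<open>n = 3\<close> the vertices \<open>p ! 1\<close> and
      \<open>p ! (n - 2)\<close> coincide, against \<open>nw\<close>.\<close>
    have n4: "4 \<le> n" using nw x n by (cases "n = 3") auto
    have iq: "ipath ?E q" unfolding q_def using p(1) n
      by (intro ipath_drop ipath_take) (auto simp: n_def)
    have sq: "set q \<subseteq> set p" unfolding q_def by (meson set_drop_subset set_take_subset subset_trans)
    have c: "(q ! i, [w, w'] ! j) \<in> ?E \<longleftrightarrow> i = 0 \<and> j = 0 \<or> Suc i = length q \<and> Suc j = length [w, w']"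
      if "i < length q" "j < length [w, w']" for i j
    proof -
      have i: "Suc i < n - 1" "i < n - 2" using that lq by auto
      have s: "(p ! Suc i, z) \<in> ?E \<longleftrightarrow> (z, p ! Suc i) \<in> ?E" for z using g(4) by (auto dest: symD)
      have "(w, p ! Suc i) \<in> ?E \<longleftrightarrow> i = 0" using ends[of w "Suc i"] ww i x nw' n4 by auto
      moreover have "(w', p ! Suc i) \<in> ?E \<longleftrightarrow> Suc i = n - 2" using ends[of w' "Suc i"] ww i x nw n4 by auto
      moreover have "j = 0 \<or> j = 1" "Suc i = length q \<longleftrightarrow> Suc i = n - 2" using that(2) lq by auto
      ultimately show ?thesis using q[OF i(2)] s[of w] s[of w'] by (elim disjE) simp_all
    qed
    have "a \<notin> set q"
    proof
      assume "a \<in> set q"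
      then obtain i where "i < n - 2" "q ! i = a" by (auto simp: in_set_conv_nth lq)
      moreover from this have "Suc i < n" "0 < n" by linarith+
      ultimately show False using q[of i] inj[of 0 "Suc i"] p0 by simp
    qed
    have "q ! 0 \<in> set q" using lq n4 by simp
    then have "p ! 1 \<in> set q" using q[of 0] n4 by simp
    then show False
      by (intro two_ipaths_wheel[OF G wf iq _ ipath_pair[OF w1(5) g(4,5)] _ _ _ c, of a "p ! 1" w w'])
        (use w1 ww sq p(2) a1 n4 lq V \<open>a \<notin> set q\<close> ir in auto)
  qed
  obtain i where i: "0 < i" "i < n - 1" "(u, p ! i) \<in> ?E" using inner[of u v] by blast
  obtain j where j: "0 < j" "j < n - 1" "(v, p ! j) \<in> ?E" using inner[of v u] by blast
  have "i = 1 \<or> i = n - 2" "j = 1 \<or> j = n - 2" using ends i j by blast+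
  moreover have "i \<noteq> j \<or> n = 3"
  proof (rule ccontr)
    assume "\<not> ?thesis"
    then have eq: "(v, p ! i) \<in> ?E" using j by auto
    have "i = 1 \<or> i = n - 2" using ends i by blast
    then have "(a, p ! i) \<in> ?E \<or> (b, p ! i) \<in> ?E"
      using adj[of 0 1] adj[of "n - 1" "n - 2"] p0 pn n by auto
    then show False
      using wheel_free_K4_free[OF G wf, of u v a "p ! i"] wheel_free_K4_free[OF G wf, of u v b "p ! i"] eq i e e' by auto
  qed
  ultimately consider "i = 1" "j = n - 2" | "j = 1" "i = n - 2" | "i = 1" "j = 1" "n = 3" by fastforce
  then show False
    by cases (use final[of u v] final[of v u] i j in auto)
qed

text \<open>Two different apexes over one edge give a \<open>K_4\<close> if they are adjacent and a
  diamond if they are not.\<close>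

lemma edge_in_one_triangle:
  assumes G: "pair_graph G" and "\<not> has_induced is_K4 G" "\<not> has_induced is_diamond G"
    and "(u, v) \<in> parcs G" "(u, x) \<in> parcs G" "(v, x) \<in> parcs G" "(u, y) \<in> parcs G" "(v, y) \<in> parcs G"
  shows "x = y"
proof (rule ccontr)
  assume ne: "x \<noteq> y"
  have s: "(q, r) \<in> parcs G" if "(r, q) \<in> parcs G" for q r using pair_graphD(4)[OF G] that by (auto dest: symD)
  have "\<exists>a b u v. {(u, v), (a, u), (a, v), (b, u), (b, v)} \<subseteq> parcs G \<and> a \<noteq> b \<and> (a, b) \<notin> parcs G" if "(x, y) \<notin> parcs G"
    using assms(4-8) s ne that by (intro exI[of _ x] exI[of _ y] exI[of _ u] exI[of _ v]) auto
  then have xy: "(x, y) \<in> parcs G" using assms(3) unfolding has_diamond_iff[OF G] by blast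
  have "\<exists>a b c d. {(a, b), (a, c), (a, d), (b, c), (b, d), (c, d)} \<subseteq> parcs G"
    using assms(4-8) xy by (intro exI[of _ u] exI[of _ v] exI[of _ x] exI[of _ y]) simp
  then show False using assms(2) unfolding has_K4_iff[OF G] by contradiction
qed

lemma claw_freeD:
  assumes "pair_graph G" "\<not> has_induced is_claw G"
    and "(u, x) \<in> parcs G" "(u, y) \<in> parcs G" "(u, z) \<in> parcs G" "x \<noteq> y" "x \<noteq> z" "y \<noteq> z"
  shows "(x, y) \<in> parcs G \<or> (x, z) \<in> parcs G \<or> (y, z) \<in> parcs G"
  using assms unfolding has_claw_iff[OF assms(1)] by auto

section \<open>Excluding the butterfly\<close>

text \<open>An induced path from \<open>a\<close> to \<open>d\<close> in \<open>A\<close> and one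
  from \<open>b\<close> to \<open>e\<close> in \<open>B\<close> form the rim, with hub
  \<open>c\<close>. For any edge between them, claw-freeness at its two ends gives a triangle with
  apex in \<open>insert c A\<close> and one with apex in \<open>insert c B\<close>. An edge lies in
  one triangle only, so the apex is \<open>c\<close>, and the edge joins \<open>a\<close> and
  \<open>b\<close> or \<open>d\<close> and \<open>e\<close>.\<close>

lemma butterfly_free_core:
  assumes G: "pair_graph G" and wf: "wheel_free G" and cf: "\<not> has_induced is_claw G"
    and K4f: "\<not> has_induced is_K4 G" and df: "\<not> has_induced is_diamond G"
    and N: "\<And>x. (c, x) \<in> parcs G \<longleftrightarrow> x \<in> {a, b, d, e}" and ab: "(a, b) \<in> parcs G" and de: "(d, e) \<in> parcs G"
    and ne: "a \<noteq> d" "b \<noteq> e"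
    and na: "(a, d) \<notin> parcs G" "(a, e) \<notin> parcs G" "(b, d) \<notin> parcs G" "(b, e) \<notin> parcs G"
    and A: "A \<subseteq> pverts G - {c}" "linked A (parcs G)" "a \<in> A" "d \<in> A"
    and B: "B \<subseteq> pverts G - {c}" "linked B (parcs G)" "b \<in> B" "e \<in> B"
    and AB: "A \<inter> B = {}"
  shows False
proof -
  let ?E = "parcs G"
  note g = pair_graphD[OF G]
  have sy: "(x, y) \<in> ?E \<longleftrightarrow> (y, x) \<in> ?E" for x y using g(4) by (auto dest: symD)
  \<comment> \<open>The vertex \<open>c\<close> closes the path to a chordless cycle of length at
    least four, on which every vertex has two nonadjacent neighbours; at the ends of the path one of
    them is \<open>c\<close>.\<close>
  have own: "\<exists>s1 s2. {s1, s2} \<subseteq> insert c C \<and> s1 \<noteq> s2 \<and> (p ! i, s1) \<in> ?E \<and> (p ! i, s2) \<in> ?E \<and> (s1, s2) \<notin> ?E"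
    and long: "3 \<le> length p"
    if p: "ipath ?E p" "set p \<subseteq> C" "hd p = x" "last p = y" and xy: "x \<noteq> y" "(x, y) \<notin> ?E"
      and C: "c \<notin> C" "\<And>z. z \<in> C \<Longrightarrow> (c, z) \<in> ?E \<longleftrightarrow> z = x \<or> z = y" and i: "i < length p"
    for p C x y i
  proof -
    have pne: "p \<noteq> []" using p(1) by (simp add: ipath_def)
    have p0: "p ! 0 = x" and pn: "p ! (length p - 1) = y"
      using p pne by (simp_all add: hd_conv_nth last_conv_nth)
    have adj: "(p ! i, p ! j) \<in> ?E \<longleftrightarrow> j = Suc i \<or> i = Suc j" if "i < length p" "j < length p" for i j
      using ipathD[OF p(1)] that by simp
    have inj: "p ! i = p ! j \<longleftrightarrow> i = j" if "i < length p" "j < length p" for i j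
      using p(1) that by (simp add: ipath_def nth_eq_iff_index_eq)
    have "length p \<noteq> 0" "length p \<noteq> 1" "length p \<noteq> 2" using pne p0 pn xy adj[of 0 1] by auto
    then show n: "3 \<le> length p" by linarith
    have mem: "p ! j \<in> C" if "j < length p" for j using that p(2) by auto
    have ends: "(c, p ! j) \<in> ?E \<longleftrightarrow> j = 0 \<or> j = length p - 1" if "j < length p" for j
      using C(2)[OF mem[OF that]] p0 pn inj[of j 0] inj[of j "length p - 1"] that n
      by (metis diff_less less_one list.size(3) not_numeral_le_zero length_greater_0_conv)
    consider "i = 0" | "i = length p - 1" | "0 < i" "i < length p - 1" using i by linarith
    then show "\<exists>s1 s2. {s1, s2} \<subseteq> insert c C \<and> s1 \<noteq> s2 \<and> (p ! i, s1) \<in> ?E \<and> (p ! i, s2) \<in> ?E \<and> (s1, s2) \<notin> ?E"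
    proof cases
      case 1
      have "p ! 1 \<in> C" "c \<noteq> p ! 1" using n mem[of 1] C(1) by auto
      moreover have "(p ! i, p ! 1) \<in> ?E" "(c, p ! 1) \<notin> ?E" "(c, p ! i) \<in> ?E"
        using n ends[of 0] ends[of 1] adj[of 0 1] 1 pne by auto
      moreover from this have "(p ! i, c) \<in> ?E" using sy by blast
      ultimately show ?thesis by (intro exI[of _ c] exI[of _ "p ! 1"]) simp
    next
      case 2
      define j where "j = length p - 2"
      have j: "j < length p" "0 < j" "i = Suc j" "j \<noteq> length p - 1" using n 2 by (auto simp: j_def)
      have "p ! j \<in> C" "c \<noteq> p ! j" using mem[OF j(1)] C(1) by auto
      moreover have "(p ! i, p ! j) \<in> ?E" "(c, p ! j) \<notin> ?E" "(c, p ! i) \<in> ?E"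
        using j i 2 ends[of i] ends[of j] adj[of i j] by auto
      moreover from this have "(p ! i, c) \<in> ?E" using sy by blast
      ultimately show ?thesis by (intro exI[of _ c] exI[of _ "p ! j"]) simp
    next
      case 3
      then obtain j where j: "i = Suc j" by (cases i) auto
      have l: "j < length p" "Suc i < length p" using 3 j by auto
      have "p ! j \<in> C" "p ! Suc i \<in> C" using mem l by auto
      moreover have "(p ! i, p ! j) \<in> ?E" "(p ! i, p ! Suc i) \<in> ?E" "(p ! j, p ! Suc i) \<notin> ?E" "p ! j \<noteq> p ! Suc i"
        using adj[OF i l(1)] adj[OF i l(2)] adj[OF l] inj[OF l] j by auto
      ultimately show ?thesis by (intro exI[of _ "p ! j"] exI[of _ "p ! Suc i"]) simp
    qed
  qed
  obtain p where p: "ipath ?E p" "set p \<subseteq> A" "hd p = a" "last p = d"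
    using ex_ipath[OF A(2) g(4,5) A(3,4)] by blast
  obtain q where q: "ipath ?E q" "set q \<subseteq> B" "hd q = b" "last q = e"
    using ex_ipath[OF B(2) g(4,5) B(3,4)] by blast
  have cA: "c \<notin> A" "\<And>z. z \<in> A \<Longrightarrow> (c, z) \<in> ?E \<longleftrightarrow> z = a \<or> z = d" using N A B AB by auto
  have cB: "c \<notin> B" "\<And>z. z \<in> B \<Longrightarrow> (c, z) \<in> ?E \<longleftrightarrow> z = b \<or> z = e" using N A B AB by auto
  have pne: "p \<noteq> []" "q \<noteq> []" using p(1) q(1) by (auto simp: ipath_def)
  have p0: "p ! 0 = a" "p ! (length p - 1) = d" "q ! 0 = b" "q ! (length q - 1) = e"
    using p q pne by (simp_all add: hd_conv_nth last_conv_nth)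
  have pl: "3 \<le> length p" using long[OF p ne(1) na(1) cA, of 0] pne by auto
  have ql: "3 \<le> length q" using long[OF q ne(2) na(4) cB, of 0] pne by auto
  have cross: "(p ! i, q ! j) \<in> ?E \<longleftrightarrow> i = 0 \<and> j = 0 \<or> Suc i = length p \<and> Suc j = length q" (is "?L \<longleftrightarrow> ?R")
    if ij: "i < length p" "j < length q" for i j
  proof
    assume xy: ?L
    then have yx: "(q ! j, p ! i) \<in> ?E" using sy by blast
    have xA: "p ! i \<in> A" "q ! j \<in> B" using ij p(2) q(2) by auto
    obtain s1 s2 where s: "{s1, s2} \<subseteq> insert c A" "s1 \<noteq> s2" "(p ! i, s1) \<in> ?E" "(p ! i, s2) \<in> ?E" "(s1, s2) \<notin> ?E"
      using own[OF p ne(1) na(1) cA ij(1)] by blast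
    obtain t1 t2 where t: "{t1, t2} \<subseteq> insert c B" "t1 \<noteq> t2" "(q ! j, t1) \<in> ?E" "(q ! j, t2) \<in> ?E" "(t1, t2) \<notin> ?E"
      using own[OF q ne(2) na(4) cB ij(2)] by blast
    have ns: "q ! j \<noteq> s1" "q ! j \<noteq> s2" "p ! i \<noteq> t1" "p ! i \<noteq> t2" using xA s t AB cA cB by auto
    from claw_freeD[OF G cf s(3,4) xy] s ns obtain s where s': "s \<in> insert c A" "(p ! i, s) \<in> ?E" "(q ! j, s) \<in> ?E"
      using sy by auto
    from claw_freeD[OF G cf t(3,4) yx] t ns obtain t where t': "t \<in> insert c B" "(q ! j, t) \<in> ?E" "(p ! i, t) \<in> ?E"
      using sy by auto
    have "s = t" using edge_in_one_triangle[OF G K4f df xy s'(2,3) t'(3,2)] .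
    then have "s = c" using s'(1) t'(1) AB by blast
    then have "(c, p ! i) \<in> ?E" "(c, q ! j) \<in> ?E" using s' sy by auto
    then have "p ! i = a \<or> p ! i = d" "q ! j = b \<or> q ! j = e" using xA cA cB by auto
    then have "p ! i = a \<and> q ! j = b \<or> p ! i = d \<and> q ! j = e" using xy na sy by metis
    moreover have "p ! i = p ! 0 \<longleftrightarrow> i = 0" "p ! i = p ! (length p - 1) \<longleftrightarrow> i = length p - 1"
      "q ! j = q ! 0 \<longleftrightarrow> j = 0" "q ! j = q ! (length q - 1) \<longleftrightarrow> j = length q - 1"
      using p(1) q(1) ij pl ql by (auto simp: ipath_def nth_eq_iff_index_eq)
    ultimately show ?R using p0 pl ql by auto
  next
    assume ?R
    moreover have "i = length p - 1 \<and> j = length q - 1" if "Suc i = length p \<and> Suc j = length q" using that by auto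
    ultimately show ?L using p0 ab de by auto
  qed
  have "(c, a) \<in> ?E" by (simp add: N)
  then have "c \<in> pverts G" using g(3) by blast
  moreover have "{a, b, d} \<subseteq> set p \<union> set q" using p q pne by (metis Un_iff hd_in_set insert_subset last_in_set empty_subsetI)
  moreover have "a \<noteq> b" "b \<noteq> d" using A B AB by auto
  moreover have "set p \<subseteq> pverts G" "set q \<subseteq> pverts G" "set p \<inter> set q = {}" "c \<notin> set p \<union> set q"
    using p(2) q(2) A(1) B(1) AB by blast+
  ultimately show False
    using two_ipaths_wheel[OF G wf p(1) _ q(1) _ _ _ cross, of c a b d] pl N ne(1) by simp
qed

text \<open>It remains to find the disjoint sets for \<open>butterfly_free_core\<close>. Suppose
  that no fan in \<open>?V - {c}\<close> leads from \<open>a\<close> and \<open>b\<close> to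
  \<open>d\<close> or \<open>e\<close>. Then the vertices other than \<open>a\<close> and
  \<open>b\<close> that fans do reach are closed in \<open>?V - {a, b}\<close>: an edge to
  \<open>c\<close> could start only at \<open>d\<close> or \<open>e\<close>. Since \<open>c\<close>
  is not among them, this contradicts the connectivity of \<open>?V - {a, b}\<close>.\<close>

lemma butterfly_free:
  assumes G: "pair_graph G" and k: "k_connected 3 G" and wf: "wheel_free G" and cf: "\<not> has_induced is_claw G"
    and K4f: "\<not> has_induced is_K4 G" and df: "\<not> has_induced is_diamond G"
  shows "\<not> has_induced is_butterfly G"
proof
  let ?E = "parcs G" and ?V = "pverts G"
  note g = pair_graphD[OF G]
  assume "has_induced is_butterfly G"
  then obtain c a b d e where e: "{(c, a), (c, b), (c, d), (c, e), (a, b), (d, e)} \<subseteq> parcs G"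
    and na: "(a, d) \<notin> parcs G" "(a, e) \<notin> parcs G" "(b, d) \<notin> parcs G" "(b, e) \<notin> parcs G"
    unfolding has_butterfly_iff[OF G] by auto
  have e': "{(a, c), (b, c), (d, c), (e, c), (b, a), (e, d)} \<subseteq> ?E"
      "(d, a) \<notin> ?E" "(e, a) \<notin> ?E" "(d, b) \<notin> ?E" "(e, b) \<notin> ?E"
    using e na g(4) by (auto dest: symD)
  have ir: "(x, x) \<notin> ?E" for x using g(5) by (simp add: irrefl_def)
  have ne: "distinct [c, a, b, d, e]" using e e' na ir by auto
  have V: "{c, a, b, d, e} \<subseteq> ?V" using e(1) g(3) by blast
  \<comment> \<open>A further neighbour of \<open>c\<close> would, by claw-freeness with
    \<open>a\<close> and \<open>d\<close>, lie in a second triangle on \<open>(c, a)\<close> or on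
    \<open>(c, d)\<close>.\<close>
  have N: "(c, x) \<in> ?E \<longleftrightarrow> x \<in> {a, b, d, e}" for x
  proof
    assume x: "(c, x) \<in> ?E"
    have "x = a \<or> x = d \<or> (a, x) \<in> ?E \<or> (d, x) \<in> ?E"
      using claw_freeD[OF G cf, of c a d x] x e na ne by (auto dest: symD[OF g(4)])
    moreover have "x = b" if "(a, x) \<in> ?E"
      using edge_in_one_triangle[OF G K4f df, of c a x b] e x that by auto
    moreover have "x = e" if "(d, x) \<in> ?E"
      using edge_in_one_triangle[OF G K4f df, of c d x e] e x that by auto
    ultimately show "x \<in> {a, b, d, e}" by blast
  qed (use e in auto)
  have L: "linked (?V - {c} - {w}) ?E" if "w \<in> ?V" for w
  proof -
    have "card {c, w} < 3" by (simp add: card_insert_if)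
    then have "linked (?V - {c, w}) ?E" using that V by (intro k_connected_linkedD[OF G k]) auto
    moreover have "?V - {c, w} = ?V - {c} - {w}" by auto
    ultimately show ?thesis by simp
  qed
  have Lab: "linked (?V - {a, b}) ?E"
    using V ne by (intro k_connected_linkedD[OF G k]) auto
  have "\<exists>w w'. {w, w'} = {d, e} \<and> fan (?V - {c}) ?E a b w"
  proof (rule ccontr)
    assume neg: "\<not> ?thesis"
    define F where "F = {w \<in> ?V - {a, b, c}. fan (?V - {c}) ?E a b w}"
    have nF: "d \<notin> F" "e \<notin> F" using neg unfolding F_def by blast+
    obtain w where w: "(a, w) \<in> ?E" "w \<notin> {b, c}"
      using k_connected_neighbour[OF G k, of a "{b, c}"] V ne by auto
    then have wV: "w \<in> ?V" "w \<noteq> a" using g(3) ir by auto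
    have "fan (?V - {c}) ?E a b w"
      by (rule fan_start[OF L[of a] g(4,5)]) (use w wV V ne in auto)
    then have wF: "w \<in> F" using w wV by (simp add: F_def)
    have "F = ?V - {a, b}"
    proof (rule linkedD[OF Lab _ wF])
      fix x y assume x: "x \<in> F" and y: "y \<in> ?V - {a, b}" and xy: "(x, y) \<in> ?E"
      have "x \<noteq> d" "x \<noteq> e" "x \<noteq> a" "x \<noteq> b" "x \<noteq> c" "x \<in> ?V" using x nF by (auto simp: F_def)
      moreover from this have "y \<noteq> c" using N[of x] xy symD[OF g(4) xy] by auto
      moreover have "x \<noteq> y" using xy ir by auto
      ultimately have "fan (?V - {c}) ?E a b y"
        using x y by (intro fan_step[OF _ L[of x] g(4) _ _ _ xy]) (auto simp: F_def)
      then show "y \<in> F" using y \<open>y \<noteq> c\<close> by (simp add: F_def)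
    qed (auto simp: F_def)
    moreover have "c \<in> ?V - {a, b}" using V ne by auto
    ultimately show False by (auto simp: F_def)
  qed
  then obtain w w' where w: "{w, w'} = {d, e}" and f: "fan (?V - {c}) ?E a b w" by blast
  have ww: "(w, w') \<in> ?E" "w \<in> ?V" "w' \<in> ?V" "w \<noteq> w'" "w \<noteq> c" "w' \<noteq> c" "{a, b, d, e} = {a, b, w, w'}"
    "(a, w) \<notin> ?E" "(b, w) \<notin> ?E" "(a, w') \<notin> ?E" "(b, w') \<notin> ?E" "a \<noteq> w" "b \<noteq> w" "a \<noteq> w'" "b \<noteq> w'"
    using w e e' V ne na by (auto simp: doubleton_eq_iff)
  obtain A B where AB: "A \<subseteq> ?V - {c} - {w}" "B \<subseteq> ?V - {c} - {w}" "A \<inter> B = {}" "a \<in> A" "b \<in> B"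
    "linked A ?E" "linked B ?E" "\<exists>x \<in> A. (x, w) \<in> ?E" "\<exists>y \<in> B. (y, w) \<in> ?E"
    using f unfolding fan_def by blast
  have w'V: "w' \<in> ?V - {c}" using ww by blast
  \<comment> \<open>Either set may have absorbed \<open>w'\<close>; the other one receives
    \<open>w\<close>. This decides which of \<open>d\<close> and \<open>e\<close> is connected with
    \<open>a\<close>.\<close>
  obtain A' B' where d: "A' \<subseteq> ?V - {c} - {w}" "B' \<subseteq> ?V - {c} - {w}" "A' \<inter> B' = {}" "a \<in> A'" "b \<in> B'"
    "linked A' ?E" "linked B' ?E" "A \<subseteq> A'" "B \<subseteq> B'" "w' \<in> A' \<union> B'"
    by (rule fan_detour[OF L[OF ww(2)] g(4) AB(1,4,6) AB(2,5,7) AB(3) w'V ww(4)[symmetric]])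
  have lA: "linked (insert w A') ?E" "linked (insert w B') ?E"
    using AB(8,9) d(8,9) linked_insert[OF d(6) _ _ g(4)] linked_insert[OF d(7) _ _ g(4)] by blast+
  from d(10) show False
  proof
    assume wA: "w' \<in> A'"
    show False
      by (rule butterfly_free_core[OF G wf cf K4f df, of c a b w' w A' "insert w B'"])
        (use N ww(7) in \<open>simp add: insert_commute\<close>, use e symD[OF g(4) ww(1)] ww(8-15) in simp,
          use e symD[OF g(4) ww(1)] in simp, use ww in simp, use ww in simp, use ww in simp, use ww in simp,
          use ww in simp, use ww in simp, use d(1) in blast, use d in simp, use d in simp, use wA in simp,
          use d(2) ww in blast, use lA in simp, use d in simp, simp, use d(1,3) in blast)
  next
    assume wB: "w' \<in> B'"
    show False
      by (rule butterfly_free_core[OF G wf cf K4f df, of c a b w w' "insert w A'" B'])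
        (use N ww(7) in simp, use e in simp,
          use ww(1) in simp, use ww in simp, use ww in simp, use ww in simp, use ww in simp,
          use ww in simp, use ww in simp, use d(1) ww in blast, use lA in simp, use d in simp, simp,
          use d(2) in blast, use d in simp, use d in simp, use wB in simp, use d(2,3) in blast)
  qed
qed

lemma wheel_free_line_graph_forbidden:
  assumes G: "pair_graph G" and k: "k_connected 3 G" and wf: "wheel_free G" and lg: "is_line_graph G"
  shows "\<not> has_induced is_K4 G" "\<not> has_induced is_claw G" "\<not> has_induced is_diamond G" "\<not> has_induced is_butterfly G"
proof -
  show K4: "\<not> has_induced is_K4 G"
    using wheel_free_K4_free[OF G wf] unfolding has_K4_iff[OF G] by blast
  show cf: "\<not> has_induced is_claw G" by (rule line_graph_claw_free[OF G lg])
  show df: "\<not> has_induced is_diamond G" by (rule diamond_free[OF G k wf cf])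
  show "\<not> has_induced is_butterfly G" by (rule butterfly_free[OF G k wf cf K4 df])
qed

section \<open>Replacing vertices by triangles\<close>

text \<open>
  The graph is obtained by replacing the vertices of a cubic graph, named by \<open>f\<close>, by triangles;
  \<open>m\<close> exchanges the two ends of every original edge.
\<close>

definition truncation :: "'a pair_pre_digraph \<Rightarrow> ('a \<Rightarrow> nat) \<Rightarrow> ('a \<Rightarrow> 'a) \<Rightarrow> bool" where
  "truncation G f m \<longleftrightarrow>
     (\<forall>x \<in> pverts G. m x \<in> pverts G \<and> m (m x) = x \<and> f (m x) \<noteq> f x \<and>
        card {y \<in> pverts G. f y = f x} = 3) \<and>
     (\<forall>x y. (x, y) \<in> parcs G \<longleftrightarrow>
        x \<in> pverts G \<and> y \<in> pverts G \<and> x \<noteq> y \<and> (f x = f y \<or> y = m x))"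

lemma truncationD:
  assumes "truncation G f m" "x \<in> pverts G"
  shows "m x \<in> pverts G" "m (m x) = x" "f (m x) \<noteq> f x" "m x \<noteq> x" "card {y \<in> pverts G. f y = f x} = 3"
  using assms by (auto simp: truncation_def)

lemma truncation_arcs:
  assumes "truncation G f m"
  shows "(x, y) \<in> parcs G \<longleftrightarrow> x \<in> pverts G \<and> y \<in> pverts G \<and> x \<noteq> y \<and> (f x = f y \<or> y = m x)"
  using assms by (simp add: truncation_def)

lemma truncation_class:
  assumes "truncation G f m" "x \<in> pverts G"
  obtains y z where "{w \<in> pverts G. f w = f x} = {x, y, z}" "x \<noteq> y" "x \<noteq> z" "y \<noteq> z"
    "y \<in> pverts G" "z \<in> pverts G" "f y = f x" "f z = f x"
proof -
  let ?C = "{w \<in> pverts G. f w = f x}"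
  have c3: "card ?C = 3" using truncationD[OF assms] by simp
  moreover from this have "finite ?C" using card_ge_0_finite[of ?C] by linarith
  moreover have "x \<in> ?C" using assms by simp
  ultimately have "card (?C - {x}) = 2" by simp
  then obtain y z where yz: "?C - {x} = {y, z}" "y \<noteq> z" by (meson card_2_iff)
  then have C: "?C = {x, y, z}" using \<open>x \<in> ?C\<close> by blast
  have "y \<in> ?C - {x}" "z \<in> ?C - {x}" using yz by auto
  then have n: "x \<noteq> y" "x \<noteq> z" "y \<in> pverts G" "z \<in> pverts G" "f y = f x" "f z = f x" by auto
  show thesis by (rule that[OF C n(1,2) yz(2) n(3-6)])
qed

lemma Suc_mod_cases: "i < n \<Longrightarrow> Suc i mod n = (if Suc i = n then 0 else Suc i)"
  by auto

lemma hole_neighbours: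
  assumes h: "is_hole E n c" and i: "i < n"
  obtains j k where "j < n" "k < n" "j \<noteq> k" "j \<noteq> i" "k \<noteq> i" "(c i, c j) \<in> E" "(c i, c k) \<in> E"
    "(c j, c k) \<in> E \<Longrightarrow> n = 3"
proof -
  have n: "3 \<le> n" and adj: "\<And>i j. i < n \<Longrightarrow> j < n \<Longrightarrow> (c i, c j) \<in> E \<longleftrightarrow> j = Suc i mod n \<or> i = Suc j mod n"
    using h by (auto simp: is_hole_def)
  define j where "j = (if Suc i = n then 0 else Suc i)"
  define k where "k = (if i = 0 then n - 1 else i - 1)"
  have jk: "j < n" "k < n" "j \<noteq> k" "j \<noteq> i" "k \<noteq> i" using i n by (auto simp: j_def k_def split: if_splits)
  have "(c i, c j) \<in> E" "(c i, c k) \<in> E"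
    unfolding adj[OF i jk(1)] adj[OF i jk(2)] Suc_mod_cases[OF i] Suc_mod_cases[OF jk(2)]
    using n i by (auto simp: j_def k_def)
  moreover have "n = 3" if "(c j, c k) \<in> E"
    using that n i unfolding adj[OF jk(1,2)] Suc_mod_cases[OF jk(1)] Suc_mod_cases[OF jk(2)]
    by (auto simp: j_def k_def split: if_splits)
  ultimately show thesis using that jk by blast
qed

text \<open>For a hub \<open>u\<close>, the partner \<open>m u\<close> is on the rim. Its two rim
  neighbours differ from \<open>u\<close>, so they complete its triangle, and this triangle is the
  whole rim. But the rim also contains \<open>y\<close>, which has the label of
  \<open>u\<close>.\<close>

lemma truncation_wheel_free:
  assumes G: "pair_graph G" and t: "truncation G f m"
  shows "wheel_free G"
  unfolding wheel_free_iff[OF G]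
proof (intro notI, elim exE conjE)
  fix n c u
  assume h: "is_hole (parcs G) n c" and u: "u \<in> pverts G" "u \<notin> c ` {..<n}" and sub: "c ` {..<n} \<subseteq> pverts G"
    and three: "3 \<le> card {w \<in> c ` {..<n}. (u, w) \<in> parcs G}"
  obtain y z where yz: "{w \<in> pverts G. f w = f u} = {u, y, z}" "u \<noteq> y" "u \<noteq> z" "y \<noteq> z"
    "y \<in> pverts G" "z \<in> pverts G" "f y = f u" "f z = f u"
    by (rule truncation_class[OF t u(1)])
  have "{w \<in> c ` {..<n}. (u, w) \<in> parcs G} \<subseteq> {y, z, m u}"
    using yz(1) by (auto simp: truncation_arcs[OF t])
  moreover have "card {y, z, m u} \<le> 3" by (simp add: card_insert_if)
  ultimately have "{w \<in> c ` {..<n}. (u, w) \<in> parcs G} = {y, z, m u}"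
    using three by (intro card_subset_eq) (auto intro: le_antisym card_mono order_trans[OF card_mono])
  then have on: "y \<in> c ` {..<n}" "m u \<in> c ` {..<n}" by blast+
  then obtain i where i: "i < n" "c i = m u" by auto
  obtain j k where jk: "j < n" "k < n" "j \<noteq> k" "j \<noteq> i" "k \<noteq> i" "(c i, c j) \<in> parcs G" "(c i, c k) \<in> parcs G"
    "(c j, c k) \<in> parcs G \<Longrightarrow> n = 3"
    using hole_neighbours[OF h i(1)] by blast
  note mu = truncationD[OF t u(1)]
  have ne: "c j \<noteq> u" "c k \<noteq> u" using u(2) jk by auto
  have f: "f (c j) = f (m u)" "f (c k) = f (m u)"
    using jk(6,7) ne mu by (auto simp: truncation_arcs[OF t] i(2))
  have inj: "inj_on c {..<n}" using h by (simp add: is_hole_def)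
  have "c j \<noteq> c k" using inj jk(1-3) by (auto dest: inj_onD)
  then have "(c j, c k) \<in> parcs G" using f sub jk(1,2) by (auto simp: truncation_arcs[OF t])
  then have n: "n = 3" using jk(8) by blast
  have "{i, j, k} = {..<n}"
    using i jk n by (intro card_subset_eq) auto
  then have "c ` {..<n} = {c i, c j, c k}" by (metis image_empty image_insert)
  then have "f y = f (m u)" using on(1) f i by auto
  then show False using yz(7) mu(3) by simp
qed

lemma forbidden_truncation:
  assumes G: "pair_graph G" and k: "k_connected 3 G"
    and K4: "\<not> has_induced is_K4 G" and cf: "\<not> has_induced is_claw G"
    and df: "\<not> has_induced is_diamond G" and bf: "\<not> has_induced is_butterfly G"
  shows "\<exists>f m. truncation G f m"
proof -
  let ?E = "parcs G" and ?V = "pverts G"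
  note g = pair_graphD[OF G]
  have sy: "(y, x) \<in> ?E" if "(x, y) \<in> ?E" for x y using g(4) that by (auto dest: symD)
  have ir: "(x, x) \<notin> ?E" for x using g(5) by (simp add: irrefl_def)
  note tri = edge_in_one_triangle[OF G K4 df]
  \<comment> \<open>Claw-freeness provides an edge among three neighbours. A further neighbour sees
    neither \<open>a\<close> nor \<open>b\<close>, as an edge lies in one triangle only. Two further
    neighbours would be adjacent by claw-freeness and form a butterfly with \<open>a\<close> and
    \<open>b\<close>.\<close>
  have local: "\<exists>a b w. a \<noteq> b \<and> w \<noteq> a \<and> w \<noteq> b \<and> (a, b) \<in> ?E \<and> (a, w) \<notin> ?E \<and> (b, w) \<notin> ?E \<and>
    (\<forall>y. (x, y) \<in> ?E \<longleftrightarrow> y \<in> {a, b, w})" if x: "x \<in> ?V" for x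
  proof -
    obtain y1 where y1: "(x, y1) \<in> ?E" using k_connected_neighbour[OF G k x, of "{}"] by auto
    obtain y2 where y2: "(x, y2) \<in> ?E" "y2 \<noteq> y1" using k_connected_neighbour[OF G k x, of "{y1}"] by auto
    have "card {y1, y2} < 3" by (simp add: card_insert_if)
    then obtain y3 where y3: "(x, y3) \<in> ?E" "y3 \<noteq> y1" "y3 \<noteq> y2"
      using k_connected_neighbour[OF G k x, of "{y1, y2}"] by auto
    obtain a b where ab: "(x, a) \<in> ?E" "(x, b) \<in> ?E" "(a, b) \<in> ?E"
      using claw_freeD[OF G cf y1 y2(1) y3(1)] y1 y2 y3 by metis
    have nab: "a \<noteq> b" using ab ir by auto
    have third: "y = b" if "(x, y) \<in> ?E" "(a, y) \<in> ?E" for y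
      using tri[of x a y b] ab that by blast
    have third': "y = a" if "(x, y) \<in> ?E" "(b, y) \<in> ?E" for y
      using tri[of x b y a] ab that sy by blast
    have "card {a, b} < 3" by (simp add: card_insert_if)
    then obtain w where w: "(x, w) \<in> ?E" "w \<noteq> a" "w \<noteq> b"
      using k_connected_neighbour[OF G k x, of "{a, b}"] by auto
    have aw: "(a, w) \<notin> ?E" "(b, w) \<notin> ?E" using third third' w by blast+
    have "y \<in> {a, b, w}" if y: "(x, y) \<in> ?E" for y
    proof (rule ccontr)
      assume ny: "y \<notin> {a, b, w}"
      have ay: "(a, y) \<notin> ?E" "(b, y) \<notin> ?E" using third third' y ny by blast+
      have "(w, y) \<in> ?E" using claw_freeD[OF G cf ab(1) w(1) y] w aw ay ny by auto
      then have "{(x, a), (x, b), (x, w), (x, y), (a, b), (w, y)} \<subseteq> ?E \<and>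
        (a, w) \<notin> ?E \<and> (a, y) \<notin> ?E \<and> (b, w) \<notin> ?E \<and> (b, y) \<notin> ?E" using ab w y aw ay by simp
      then have "has_induced is_butterfly G" unfolding has_butterfly_iff[OF G] by (intro exI)
      then show False using bf by simp
    qed
    then show ?thesis using nab w ab aw by (intro exI[of _ a] exI[of _ b] exI[of _ w]) auto
  qed
  \<comment> \<open>The isolated vertex of the neighbourhood: the only neighbour of \<open>x\<close>
    that has no common neighbour with \<open>x\<close>.\<close>
  define m where "m x = (THE w. (x, w) \<in> ?E \<and> (\<forall>y. (x, y) \<in> ?E \<longrightarrow> (y, w) \<notin> ?E))" for x
  define T where "T x = insert x {y. (x, y) \<in> ?E} - {m x}" for x
  \<comment> \<open>An elimination rule that restates \<open>local\<close> in terms of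
    \<open>m x\<close> and the triangle \<open>T x\<close>.\<close>
  have m: thesis if x: "x \<in> ?V" and that: "\<And>a b. a \<noteq> b \<Longrightarrow> m x \<noteq> a \<Longrightarrow> m x \<noteq> b \<Longrightarrow> (a, b) \<in> ?E \<Longrightarrow>
    (a, m x) \<notin> ?E \<Longrightarrow> (b, m x) \<notin> ?E \<Longrightarrow> T x = {x, a, b} \<Longrightarrow> \<forall>y. (x, y) \<in> ?E \<longleftrightarrow> y \<in> {a, b, m x} \<Longrightarrow> thesis"
    for x thesis
  proof -
    obtain a b w where abw: "a \<noteq> b" "w \<noteq> a" "w \<noteq> b" "(a, b) \<in> ?E" "(a, w) \<notin> ?E" "(b, w) \<notin> ?E"
      and N: "\<And>y. (x, y) \<in> ?E \<longleftrightarrow> y \<in> {a, b, w}" using local[OF x] by blast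
    have w: "m x = w"
      unfolding m_def using abw ir sy by (intro the_equality) (auto simp: N)
    have "T x = {x, a, b}" unfolding T_def w using abw N[of x] ir by (auto simp: N)
    moreover have "\<forall>y. (x, y) \<in> ?E \<longleftrightarrow> y \<in> {a, b, w}" using N by blast
    ultimately show thesis using abw by (intro that[of a b]) (simp_all only: w not_False_eq_True simp_thms)
  qed
  have mV: "m x \<in> ?V" and mE: "(x, m x) \<in> ?E" and mx: "m x \<noteq> x" if x: "x \<in> ?V" for x
  proof -
    show "(x, m x) \<in> ?E" by (rule m[OF x]) simp
    then show "m x \<in> ?V" "m x \<noteq> x" using g(3) ir by auto
  qed
  have iso: "(y, m x) \<notin> ?E" if "(x, y) \<in> ?E" "x \<in> ?V" for x y
    by (rule m[OF that(2)]) (use that(1) ir in auto)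
  \<comment> \<open>Otherwise \<open>x\<close> would belong to the triangle of \<open>m x\<close>,
    whose third vertex is then a common neighbour of \<open>x\<close> and
    \<open>m x\<close>.\<close>
  have mm: "m (m x) = x" if x: "x \<in> ?V" for x
  proof (rule ccontr)
    assume ne: "m (m x) \<noteq> x"
    obtain a b where ab: "a \<noteq> b" "(a, b) \<in> ?E" "\<forall>y. (m x, y) \<in> ?E \<longleftrightarrow> y \<in> {a, b, m (m x)}"
      by (rule m[OF mV[OF x]], rule that)
    have "x = a \<or> x = b" using ab(3)[rule_format, of x] sy[OF mE[OF x]] ne by (auto simp: ab(3))
    then obtain y where "(x, y) \<in> ?E" "(m x, y) \<in> ?E" using ab sy by blast
    then show False using iso[of x y] x sy by blast
  qed
  \<comment> \<open>So the triangles form a partition, and numbering them by \<open>h\<close> yields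
    the labels \<open>f\<close>.\<close>
  have TT: "T y = T x" if y: "y \<in> T x" and x: "x \<in> ?V" for x y
  proof -
    obtain a b where ab: "a \<noteq> b" "m x \<noteq> a" "m x \<noteq> b" "(a, b) \<in> ?E" "(a, m x) \<notin> ?E" "(b, m x) \<notin> ?E"
      "T x = {x, a, b}" and N: "\<forall>y. (x, y) \<in> ?E \<longleftrightarrow> y \<in> {a, b, m x}" by (rule m[OF x], rule that)
    have eq: "T y = {x, y, z}" if yz: "{y, z} = {a, b}" for y z
    proof -
      have e: "(x, y) \<in> ?E" "(x, z) \<in> ?E" "(y, z) \<in> ?E" "y \<noteq> z"
        using yz N ab(1,4) sy by (auto simp: doubleton_eq_iff)
      then have yV: "y \<in> ?V" using g(3) by blast
      obtain a' b' where ab': "m y \<noteq> a'" "m y \<noteq> b'" "T y = {y, a', b'}"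
        "\<forall>w. (y, w) \<in> ?E \<longleftrightarrow> w \<in> {a', b', m y}" by (rule m[OF yV], rule that)
      have "x \<noteq> m y" "z \<noteq> m y" using iso[of y x] iso[of y z] yV e sy by blast+
      moreover have "x \<in> {a', b', m y}" "z \<in> {a', b', m y}" "x \<noteq> z" using e sy ab'(4) ir by blast+
      ultimately have "{a', b'} = {x, z}" by auto
      then show ?thesis using ab'(3) by auto
    qed
    show ?thesis using y ab(7) eq[of a b] eq[of b a] by auto
  qed
  have TV: "T x \<subseteq> ?V" "x \<in> T x" if "x \<in> ?V" for x using that g(3) mx[OF that] by (auto simp: T_def)
  have T3: "card (T x) = 3" if x: "x \<in> ?V" for x
  proof -
    obtain a b where ab: "a \<noteq> b" "T x = {x, a, b}" "\<forall>y. (x, y) \<in> ?E \<longleftrightarrow> y \<in> {a, b, m x}" by (rule m[OF x], rule that)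
    moreover have "x \<noteq> a" "x \<noteq> b" using ab(3)[rule_format, of x] ir by auto
    ultimately show ?thesis by simp
  qed
  have "finite (T ` ?V)" using g(1) by simp
  then obtain n and h :: "'a set \<Rightarrow> nat" where h: "inj_on h (T ` ?V)" by (metis finite_imp_inj_to_nat_seg)
  define f where "f x = h (T x)" for x
  have fT: "f x = f y \<longleftrightarrow> x \<in> T y" if "x \<in> ?V" "y \<in> ?V" for x y
    using that h TT TV by (metis f_def imageI inj_onD)
  have "truncation G f m"
    unfolding truncation_def
  proof (intro conjI ballI allI)
    fix x assume x: "x \<in> ?V"
    show "m x \<in> ?V" "m (m x) = x" using mV mm x by auto
    show "f (m x) \<noteq> f x" using fT[OF mV[OF x] x] by (simp add: T_def)
    have "{y \<in> ?V. f y = f x} = T x" using fT[OF _ x] TV[OF x] by auto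
    then show "card {y \<in> ?V. f y = f x} = 3" using T3[OF x] by simp
  next
    fix x y
    show "(x, y) \<in> ?E \<longleftrightarrow> x \<in> ?V \<and> y \<in> ?V \<and> x \<noteq> y \<and> (f x = f y \<or> y = m x)"
    proof
      assume e: "(x, y) \<in> ?E"
      then have V: "x \<in> ?V" "y \<in> ?V" "x \<noteq> y" using g(3) ir by auto
      moreover have "y \<in> T x \<or> y = m x" using e by (auto simp: T_def)
      ultimately show "x \<in> ?V \<and> y \<in> ?V \<and> x \<noteq> y \<and> (f x = f y \<or> y = m x)"
        using fT[of y x] by auto
    next
      assume a: "x \<in> ?V \<and> y \<in> ?V \<and> x \<noteq> y \<and> (f x = f y \<or> y = m x)"
      then have "y \<in> T x \<or> y = m x" using fT[of y x] by auto
      then show "(x, y) \<in> ?E" using a mE[of x] by (auto simp: T_def)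
    qed
  qed
  then show ?thesis by blast
qed

section \<open>The quotient of a truncation\<close>

definition quotient_graph :: "'a pair_pre_digraph \<Rightarrow> ('a \<Rightarrow> nat) \<Rightarrow> ('a \<Rightarrow> 'a) \<Rightarrow> nat pair_pre_digraph" where
  "quotient_graph G f m = \<lparr>pverts = f ` pverts G, parcs = (\<lambda>x. (f x, f (m x))) ` pverts G\<rparr>"

text \<open>Fails exactly if two triangles are joined by more than one edge.\<close>

abbreviation simple_quotient :: "'a pair_pre_digraph \<Rightarrow> ('a \<Rightarrow> nat) \<Rightarrow> ('a \<Rightarrow> 'a) \<Rightarrow> bool" where
  "simple_quotient G f m \<equiv> inj_on (\<lambda>x. (f x, f (m x))) (pverts G)"

lemma quotient_graph_simps [simp]:
  "pverts (quotient_graph G f m) = f ` pverts G"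
  "parcs (quotient_graph G f m) = (\<lambda>x. (f x, f (m x))) ` pverts G"
  by (simp_all add: quotient_graph_def)

lemma pair_graph_quotient:
  assumes G: "pair_graph G" and t: "truncation G f m"
  shows "pair_graph (quotient_graph G f m)"
proof (rule pair_graphI)
  show "finite (pverts (quotient_graph G f m))" using pair_graphD(1)[OF G] by simp
  show "parcs (quotient_graph G f m) \<subseteq> pverts (quotient_graph G f m) \<times> pverts (quotient_graph G f m)"
    using truncationD(1)[OF t] by auto
  show "sym (parcs (quotient_graph G f m))"
  proof (rule symI)
    fix v w assume "(v, w) \<in> parcs (quotient_graph G f m)"
    then obtain x where "x \<in> pverts G" "v = f x" "w = f (m x)" by auto
    then show "(w, v) \<in> parcs (quotient_graph G f m)"
      using truncationD(1,2)[OF t] by (force intro!: image_eqI[where x = "m x"])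
  qed
  show "irrefl (parcs (quotient_graph G f m))"
    by (auto simp: irrefl_def) (metis truncationD(3)[OF t])
qed

lemma uedges_quotient: "uedges (quotient_graph G f m) = (\<lambda>x. {f x, f (m x)}) ` pverts G"
  unfolding uedges_def by (auto simp: image_iff)

lemma cubic_quotient:
  assumes t: "truncation G f m" and inj: "simple_quotient G f m"
  shows "cubic (quotient_graph G f m)"
  unfolding cubic_def
proof
  fix v assume "v \<in> pverts (quotient_graph G f m)"
  then obtain x where x: "x \<in> pverts G" "v = f x" by auto
  let ?C = "{y \<in> pverts G. f y = f x}"
  have "{w. (v, w) \<in> parcs (quotient_graph G f m)} = (\<lambda>y. f (m y)) ` ?C"
  proof (intro set_eqI iffI)
    fix w assume "w \<in> (\<lambda>y. f (m y)) ` ?C"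
    then obtain y where "y \<in> pverts G" "(v, w) = (f y, f (m y))" using x by auto
    then show "w \<in> {w. (v, w) \<in> parcs (quotient_graph G f m)}" by simp
  qed (use x in auto)
  moreover have "inj_on (\<lambda>y. f (m y)) ?C" using inj by (auto simp: inj_on_def)
  ultimately show "out_degree (with_proj (quotient_graph G f m)) v = 3"
    unfolding out_degree_eq_card using truncationD(5)[OF t x(1)] by (simp add: card_image)
qed

lemma simple_quotientD:
  "simple_quotient G f m \<Longrightarrow> x \<in> pverts G \<Longrightarrow> y \<in> pverts G \<Longrightarrow> f x = f y \<Longrightarrow> f (m x) = f (m y) \<Longrightarrow> x = y"
  by (auto dest: inj_onD)

lemma simple_quotient_edge_eq:
  assumes t: "truncation G f m" and inj: "simple_quotient G f m" and xy: "x \<in> pverts G" "y \<in> pverts G"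
  shows "{f x, f (m x)} = {f y, f (m y)} \<longleftrightarrow> y = x \<or> y = m x"
proof
  note td = truncationD[OF t]
  assume "{f x, f (m x)} = {f y, f (m y)}"
  then consider "f x = f y" "f (m x) = f (m y)" | "f (m x) = f y" "f x = f (m y)"
    by (auto simp: doubleton_eq_iff)
  then show "y = x \<or> y = m x"
  proof cases
    case 1
    then show ?thesis using simple_quotientD[OF inj xy] by simp
  next
    case 2
    then show ?thesis using simple_quotientD[OF inj td(1)[OF xy(1)] xy(2)] td(2)[OF xy(1)] by simp
  qed
next
  assume "y = x \<or> y = m x"
  then show "{f x, f (m x)} = {f y, f (m y)}" using truncationD(2)[OF t xy(1)] by auto
qed

text \<open>
  A separation \<open>A\<close>, \<open>B\<close> of the quotient by \<open>X\<close> is lifted by deleting, in each triangle of \<open>X\<close>,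
  at most one vertex, so that its other vertices do not lead to both sides.
\<close>

lemma k_connected_quotient:
  assumes G: "pair_graph G" and k: "k_connected 3 G" and t: "truncation G f m" and inj: "simple_quotient G f m"
  shows "k_connected 3 (quotient_graph G f m)"
  unfolding k_connected_iff_linked[OF pair_graph_quotient[OF G t]] quotient_graph_simps
proof (intro conjI allI impI)
  let ?V = "pverts G"
  have fin: "finite ?V" using pair_graphD(1)[OF G] .
  have "0 < card ?V" using k by (simp add: k_connected_def)
  then obtain x where x: "x \<in> ?V" by fastforce
  obtain y z where yz: "{w \<in> ?V. f w = f x} = {x, y, z}" "x \<noteq> y" "x \<noteq> z" "y \<noteq> z" "y \<in> ?V" "z \<in> ?V" "f y = f x" "f z = f x"
    by (rule truncation_class[OF t x])
  \<comment> \<open>A triangle has three different neighbouring triangles, as there are no parallel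
    edges; this makes four labels.\<close>
  have "f (m x) \<noteq> f (m y)" "f (m x) \<noteq> f (m z)" "f (m y) \<noteq> f (m z)"
    using simple_quotientD[OF inj x yz(5)] simple_quotientD[OF inj x yz(6)] simple_quotientD[OF inj yz(5,6)] yz by auto
  then have "card {f x, f (m x), f (m y), f (m z)} = 4"
    using truncationD(3)[OF t x] truncationD(3)[OF t yz(5)] truncationD(3)[OF t yz(6)] yz(7,8) by auto
  moreover have "{f x, f (m x), f (m y), f (m z)} \<subseteq> f ` ?V" using x yz truncationD(1)[OF t] by auto
  then have "card {f x, f (m x), f (m y), f (m z)} \<le> card (f ` ?V)" using fin by (intro card_mono) auto
  ultimately show "3 < card (f ` ?V)" by linarith
next
  let ?V = "pverts G" and ?R = "(\<lambda>x. (f x, f (m x))) ` pverts G"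
  have fin: "finite ?V" using pair_graphD(1)[OF G] .
  fix X assume X: "X \<subseteq> f ` ?V" "card X < 3"
  show "linked (f ` ?V - X) ?R"
    unfolding linked_def
  proof (intro allI impI)
    fix A assume A: "A \<subseteq> f ` ?V - X" "A \<noteq> {}" and cl: "\<forall>x\<in>A. \<forall>y\<in>f ` ?V - X. (x, y) \<in> ?R \<longrightarrow> y \<in> A"
    show "A = f ` ?V - X"
    proof (rule ccontr)
      assume ne: "A \<noteq> f ` ?V - X"
      define B where "B = f ` ?V - X - A"
      define into where "into v = {x \<in> ?V. f x = v \<and> f (m x) \<in> B}" for v
      define S where "S = {x \<in> ?V. f x \<in> X \<and> (if card (into (f x)) \<le> 1 then f (m x) \<in> B else f (m x) \<notin> B)}"
      \<comment> \<open>If at most one vertex of a triangle leads to \<open>B\<close>, it is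
        deleted. Otherwise at most one of the three does not lead to \<open>B\<close>, and that one
        is deleted.\<close>
      have "inj_on f S"
      proof (rule inj_onI, rule ccontr)
        fix x y assume xy: "x \<in> S" "y \<in> S" "f x = f y" "x \<noteq> y"
        show False
        proof (cases "card (into (f x)) \<le> 1")
          case True
          then have "{x, y} \<subseteq> into (f x)" using xy by (auto simp: S_def into_def)
          then have "card {x, y} \<le> card (into (f x))" using fin by (intro card_mono) (auto simp: into_def)
          then show False using xy(4) True by simp
        next
          case False
          have xV: "x \<in> ?V" using xy(1) by (simp add: S_def)
          have "into (f x) \<subseteq> {w \<in> ?V. f w = f x} - {x, y}" using xy False by (auto simp: S_def into_def)
          then have "card (into (f x)) \<le> card ({w \<in> ?V. f w = f x} - {x, y})" using fin by (intro card_mono) auto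
          also have "\<dots> = 1" using truncationD(5)[OF t xV] xy fin by (subst card_Diff_subset) (auto simp: S_def)
          finally show False using False by simp
        qed
      qed
      then have "card S = card (f ` S)" by (simp add: card_image)
      also have "\<dots> \<le> card X" using X fin by (intro card_mono) (auto simp: S_def intro: finite_subset)
      finally have L: "linked (?V - S) (parcs G)"
        using X(2) by (intro k_connected_linkedD[OF G k]) (auto simp: S_def)
      \<comment> \<open>A triangle of \<open>X\<close> is assigned to the side of \<open>A\<close>
        if its only possible link to \<open>B\<close> was deleted.\<close>
      define A' where "A' = {x \<in> ?V - S. f x \<in> A \<or> f x \<in> X \<and> card (into (f x)) \<le> 1}"
      obtain x where x: "x \<in> ?V" "f x \<in> A" using A by blast
      then have "x \<in> A'" using A(1) by (auto simp: A'_def S_def)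
      have "A' = ?V - S"
      proof (rule linkedD[OF L _ \<open>x \<in> A'\<close>])
        show "A' \<subseteq> ?V - S" by (auto simp: A'_def)
        fix x y assume x: "x \<in> A'" and y: "y \<in> ?V - S" and xy: "(x, y) \<in> parcs G"
        have xV: "x \<in> ?V" "x \<notin> S" using x by (auto simp: A'_def)
        from xy have "f x = f y \<or> y = m x" by (simp add: truncation_arcs[OF t])
        then show "y \<in> A'"
        proof
          assume "f x = f y"
          then show ?thesis using x y by (auto simp: A'_def)
        next
          assume ym: "y = m x"
          have my: "m y = x" using truncationD(2)[OF t xV(1)] ym by simp
          have fy: "f y \<in> f ` ?V" using y by blast
          have arc: "(f x, f y) \<in> ?R" using xV ym by blast
          have xB: "f x \<notin> B" using x A(1) by (auto simp: A'_def B_def)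
          have "f y \<notin> B"
          proof
            assume yB: "f y \<in> B"
            show False
            proof (cases "f x \<in> A")
              case True
              then have "f y \<in> A" using cl arc yB unfolding B_def by blast
              then show False using yB by (simp add: B_def)
            next
              case False
              then have "f x \<in> X" "card (into (f x)) \<le> 1" using x by (auto simp: A'_def)
              then have "x \<in> S" using xV yB ym by (simp add: S_def)
              then show False using xV by simp
            qed
          qed
          moreover have "card (into (f y)) \<le> 1" if "f y \<in> X"
          proof (rule ccontr)
            assume "\<not> ?thesis"
            then have "y \<in> S" using that y xB my by (simp add: S_def)
            then show False using y by simp
          qed
          ultimately show ?thesis using y fy by (auto simp: A'_def B_def)
        qed
      qed
      moreover obtain w where "w \<in> B" using ne A(1) unfolding B_def by blast
      then obtain z where "z \<in> ?V" "f z \<in> B" unfolding B_def by blast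
      moreover from this have "z \<in> ?V - S" "z \<notin> A'" by (auto simp: A'_def S_def B_def)
      ultimately show False by simp
    qed
  qed
qed

section \<open>Connectivity of the truncation\<close>

text \<open>For a symmetric relation the complement of a closed set is closed too, and the two
  cannot both contain \<open>r\<close>.\<close>

lemma linked_symI:
  assumes E: "sym E" and x: "\<And>A. A \<subseteq> W \<Longrightarrow> A \<noteq> {} \<Longrightarrow> (\<And>x y. x \<in> A \<Longrightarrow> y \<in> W \<Longrightarrow> (x, y) \<in> E \<Longrightarrow> y \<in> A) \<Longrightarrow> r \<in> A"
  shows "linked W E"
  unfolding linked_def
proof (intro allI impI)
  fix A assume A: "A \<subseteq> W" "A \<noteq> {}" "\<forall>x\<in>A. \<forall>y\<in>W. (x, y) \<in> E \<longrightarrow> y \<in> A"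
  have "r \<in> A" using A by (intro x) auto
  moreover have "r \<in> W - A" if "W - A \<noteq> {}"
    using that A(3) E by (intro x) (auto dest: symD)
  ultimately show "A = W" using A(1) by blast
qed

lemma truncation_card:
  assumes G: "pair_graph G" and t: "truncation G f m" and ne: "pverts G \<noteq> {}"
  shows "3 < card (pverts G)"
proof -
  obtain x where x: "x \<in> pverts G" using ne by blast
  have "card (insert (m x) {w \<in> pverts G. f w = f x}) = 4"
    using truncationD[OF t x] pair_graphD(1)[OF G] by simp
  moreover have "card (insert (m x) {w \<in> pverts G. f w = f x}) \<le> card (pverts G)"
    using truncationD[OF t x] pair_graphD(1)[OF G] by (intro card_mono) auto
  ultimately show ?thesis by simp
qed

text \<open>Once a closed set contains a vertex whose triangle avoids \<open>S\<close>, the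
  connectivity of the quotient without \<open>X\<close> carries it to \<open>x0\<close>. A vertex
  \<open>a\<close> with both \<open>f a\<close> and \<open>f (m a)\<close> in \<open>X\<close> is no
  obstacle: \<open>S\<close> then has exactly one vertex in each of these two triangles, so another
  vertex of the triangle of \<open>a\<close> survives, and without parallel edges its partner lies
  outside \<open>X\<close>.\<close>

lemma k_connected_of_quotient:
  assumes G: "pair_graph G" and t: "truncation G f m" and inj: "simple_quotient G f m"
    and k: "k_connected 3 (quotient_graph G f m)"
  shows "k_connected 3 G"
  unfolding k_connected_iff_linked[OF G]
proof (intro conjI allI impI)
  let ?V = "pverts G" and ?R = "(\<lambda>x. (f x, f (m x))) ` pverts G"
  have c3: "3 < card (f ` ?V)" using k by (simp add: k_connected_def)
  then have "?V \<noteq> {}" by auto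
  then show "3 < card ?V" by (rule truncation_card[OF G t])
  fix S assume S: "S \<subseteq> ?V" "card S < 3"
  have fin: "finite S" using S(1) pair_graphD(1)[OF G] by (rule finite_subset)
  define X where "X = f ` S"
  have X: "X \<subseteq> f ` ?V" "card X < 3" using S card_image_le[OF fin, of f] by (auto simp: X_def)
  have L: "linked (f ` ?V - X) ?R"
    using k_connected_linkedD[OF pair_graph_quotient[OF G t] k, of X] X by simp
  have "\<not> f ` ?V \<subseteq> X" using X c3 fin card_mono[of X "f ` ?V"] by (auto simp: X_def)
  then obtain x0 where x0: "x0 \<in> ?V" "f x0 \<notin> X" by blast
  show "linked (?V - S) (parcs G)"
  proof (rule linked_symI[OF pair_graphD(4)[OF G], where r = x0])
    fix A assume A: "A \<subseteq> ?V - S" "A \<noteq> {}" and cl: "\<And>x y. x \<in> A \<Longrightarrow> y \<in> ?V - S \<Longrightarrow> (x, y) \<in> parcs G \<Longrightarrow> y \<in> A"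
    have same: "y \<in> A" if "x \<in> A" "y \<in> ?V - S" "f x = f y" for x y
      using that A(1) cl[of x y] by (cases "x = y") (auto simp: truncation_arcs[OF t])
    have partner: "m x \<in> A" if "x \<in> A" "m x \<notin> S" for x
    proof -
      have "x \<in> ?V" using that A by blast
      then show ?thesis using that cl[of x "m x"] truncationD[OF t, of x] by (auto simp: truncation_arcs[OF t])
    qed
    have notS: "y \<notin> S" if "f y \<notin> X" for y using that by (auto simp: X_def)
    obtain a where a: "a \<in> A" using A by blast
    have "\<exists>b \<in> A. f b \<notin> X"
    proof (cases "f a \<in> X \<and> f (m a) \<in> X")
      case False
      then show ?thesis using a partner[of a] notS[of "m a"] by blast
    next
      case True
      have aV: "a \<in> ?V" "a \<notin> S" using a A by auto
      have "{f a, f (m a)} \<subseteq> X" "card {f a, f (m a)} = 2" using True truncationD(3)[OF t aV(1)] by auto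
      moreover have "finite X" using fin by (simp add: X_def)
      ultimately have Xeq: "{f a, f (m a)} = X"
        using X(2) card_mono[of X "{f a, f (m a)}"] by (intro card_subset_eq) linarith+
      have "card (f ` S) = card S"
        using S(2) \<open>card {f a, f (m a)} = 2\<close> card_image_le[OF fin, of f] unfolding Xeq X_def by linarith
      then have injS: "inj_on f S" by (rule eq_card_imp_inj_on[OF fin])
      obtain y z where yz: "{w \<in> ?V. f w = f a} = {a, y, z}" "a \<noteq> y" "a \<noteq> z" "y \<noteq> z"
        "y \<in> ?V" "z \<in> ?V" "f y = f a" "f z = f a"
        by (rule truncation_class[OF t aV(1)])
      have "y \<notin> S \<or> z \<notin> S" using inj_onD[OF injS, of y z] yz(4,7,8) by auto
      then obtain b where b: "b \<in> ?V" "b \<notin> S" "b \<noteq> a" "f b = f a" using yz by metis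
      then have "b \<in> A" using same[OF a] by auto
      have "f (m b) \<noteq> f (m a)" using simple_quotientD[OF inj b(1) aV(1) b(4)] b(3) by blast
      then have "f (m b) \<notin> X" using truncationD(3)[OF t b(1)] b(4) Xeq by auto
      then show ?thesis using partner[OF \<open>b \<in> A\<close>] notS by blast
    qed
    then obtain b where b: "b \<in> A" "f b \<notin> X" by blast
    have "{v \<in> f ` ?V - X. \<exists>x \<in> A. f x = v} = f ` ?V - X"
    proof (rule linkedD[OF L, where x = "f b"])
      show "f b \<in> {v \<in> f ` ?V - X. \<exists>x \<in> A. f x = v}" using b A by auto
      fix v w assume v: "v \<in> {v \<in> f ` ?V - X. \<exists>x \<in> A. f x = v}" and w: "w \<in> f ` ?V - X" and vw: "(v, w) \<in> ?R"
      obtain x where x: "x \<in> ?V" "v = f x" "w = f (m x)" using vw by auto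
      obtain y where y: "y \<in> A" "f y = v" using v by blast
      have "x \<in> A" using same[OF y(1), of x] x y notS[of x] v by auto
      moreover have "f (m x) \<notin> X" using w x(3) by simp
      ultimately have "m x \<in> A" using partner[of x] notS[of "m x"] by blast
      then show "w \<in> {v \<in> f ` ?V - X. \<exists>x \<in> A. f x = v}" using w unfolding x(3) by blast
    qed auto
    then obtain x where "x \<in> A" "f x = f x0" using x0 by blast
    then show "x0 \<in> A" using same[of x x0] x0 notS[of x0] by auto
  qed
qed

text \<open>The graph is the prism. Fewer than three deleted vertices spare one of its three
  disjoint rungs, and every remaining vertex shares a triangle with an end of this rung.\<close>

lemma k_connected_two_classes:
  assumes G: "pair_graph G" and t: "truncation G f m" and two: "card (f ` pverts G) = 2"
  shows "k_connected 3 G"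
  unfolding k_connected_iff_linked[OF G]
proof (intro conjI allI impI)
  let ?V = "pverts G"
  have ne: "?V \<noteq> {}" using two by auto
  then show "3 < card ?V" by (rule truncation_card[OF G t])
  fix S assume S: "S \<subseteq> ?V" "card S < 3"
  have fin: "finite S" using S(1) pair_graphD(1)[OF G] by (rule finite_subset)
  obtain x where x: "x \<in> ?V" using ne by blast
  obtain y z where yz: "{w \<in> ?V. f w = f x} = {x, y, z}" "x \<noteq> y" "x \<noteq> z" "y \<noteq> z" "y \<in> ?V" "z \<in> ?V" "f y = f x" "f z = f x"
    by (rule truncation_class[OF t x])
  note tx = truncationD[OF t x] and ty = truncationD[OF t yz(5)] and tz = truncationD[OF t yz(6)]
  have "\<exists>x0 \<in> {x, y, z}. x0 \<notin> S \<and> m x0 \<notin> S"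
  proof (rule ccontr)
    assume "\<not> ?thesis"
    then have "x \<in> S \<or> m x \<in> S" "y \<in> S \<or> m y \<in> S" "z \<in> S \<or> m z \<in> S" by simp_all
    then obtain a b c where abc: "a \<in> S" "a \<in> {x, m x}" "b \<in> S" "b \<in> {y, m y}" "c \<in> S" "c \<in> {z, m z}"
      by (metis insertI1 insertI2)
    have "f (m x) \<noteq> f x" "f (m y) \<noteq> f x" "f (m z) \<noteq> f x" "m x \<noteq> m y" "m x \<noteq> m z" "m y \<noteq> m z"
      using tx(2,3) ty(2,3) tz(2,3) yz(2-4,7,8) by metis+
    then have "a \<noteq> b" "a \<noteq> c" "b \<noteq> c" using abc(2,4,6) yz(2-4,7,8) by auto
    then have "card {a, b, c} = 3" by simp
    moreover have "card {a, b, c} \<le> card S" using abc fin by (intro card_mono) auto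
    ultimately show False using S by simp
  qed
  then obtain x0 where x0: "x0 \<in> ?V" "x0 \<notin> S" "m x0 \<notin> S" using x yz by blast
  note t0 = truncationD[OF t x0(1)]
  have "{f x0, f (m x0)} = f ` ?V"
    using two t0 x0 pair_graphD(1)[OF G] by (intro card_subset_eq) auto
  then have cls: "f a = f x0 \<or> f a = f (m x0)" if "a \<in> ?V" for a using that by blast
  show "linked (?V - S) (parcs G)"
  proof (rule linked_symI[OF pair_graphD(4)[OF G], where r = x0])
    fix A assume A: "A \<subseteq> ?V - S" "A \<noteq> {}" and cl: "\<And>x y. x \<in> A \<Longrightarrow> y \<in> ?V - S \<Longrightarrow> (x, y) \<in> parcs G \<Longrightarrow> y \<in> A"
    have same: "y \<in> A" if "x \<in> A" "y \<in> ?V - S" "f x = f y" for x y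
      using that A(1) cl[of x y] by (cases "x = y") (auto simp: truncation_arcs[OF t])
    obtain a where a: "a \<in> A" "a \<in> ?V" using A by blast
    show "x0 \<in> A"
    proof (cases "f a = f x0")
      case True
      then show ?thesis using same a x0 by blast
    next
      case False
      then have "m x0 \<in> A" using same[OF a(1), of "m x0"] cls[OF a(2)] t0 x0 by auto
      then show ?thesis using cl[of "m x0" x0] t0 x0 by (auto simp: truncation_arcs[OF t])
    qed
  qed
qed

text \<open>If two edges join the same two triangles, the third vertices \<open>z\<close> and
  \<open>z'\<close> of these triangles separate the four ends from all other vertices. By
  3-connectedness there are no others.\<close>

lemma not_simple_quotient_two_classes:
  assumes G: "pair_graph G" and k: "k_connected 3 G" and t: "truncation G f m" and inj: "\<not> simple_quotient G f m"
  shows "card (f ` pverts G) = 2"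
proof -
  let ?V = "pverts G"
  obtain x y where xy: "x \<in> ?V" "y \<in> ?V" "x \<noteq> y" "f x = f y" "f (m x) = f (m y)"
    using inj unfolding inj_on_def by auto
  note tx = truncationD[OF t xy(1)] and ty = truncationD[OF t xy(2)]
  have third: "\<exists>z. {w \<in> ?V. f w = f a} = {a, b, z} \<and> a \<noteq> z \<and> b \<noteq> z" if a: "a \<in> ?V" and b: "b \<in> ?V" "a \<noteq> b" "f a = f b" for a b
  proof -
    obtain u v where uv: "{w \<in> ?V. f w = f a} = {a, u, v}" "a \<noteq> u" "a \<noteq> v" "u \<noteq> v"
      by (rule truncation_class[OF t a])
    have "b \<in> {w \<in> ?V. f w = f a}" using b by simp
    then have "b = u \<or> b = v" using b(2) unfolding uv(1) by blast
    then show ?thesis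
    proof
      assume "b = u"
      then show ?thesis using uv by (intro exI[of _ v]) simp
    next
      assume "b = v"
      then show ?thesis using uv by (intro exI[of _ u]) (simp add: insert_commute)
    qed
  qed
  obtain z where z: "{w \<in> ?V. f w = f x} = {x, y, z}" "x \<noteq> z" "y \<noteq> z" using third[OF xy(1-4)] by blast
  have "m x \<noteq> m y" using tx ty xy(3) by metis
  then obtain z' where z': "{w \<in> ?V. f w = f (m x)} = {m x, m y, z'}" "m x \<noteq> z'" "m y \<noteq> z'"
    using third[OF tx(1) ty(1) _ xy(5)] by blast
  have zz: "z \<in> ?V" "f z = f x" "z' \<in> ?V" "f z' = f (m x)" using z(1) z'(1) by blast+
  have L: "linked (?V - {z, z'}) (parcs G)"
    by (rule k_connected_linkedD[OF G k]) (use zz in \<open>auto simp: card_insert_if\<close>)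
  have "{x, y, m x, m y} = ?V - {z, z'}"
  proof (rule linkedD[OF L, where x = x])
    have "m x \<noteq> z" "m y \<noteq> z" "x \<noteq> z'" "y \<noteq> z'" using tx(3) ty(3) zz xy(4,5) by metis+
    then show "{x, y, m x, m y} \<subseteq> ?V - {z, z'}" using xy(1,2) tx(1) ty(1) z(2,3) z'(2,3) by simp
    fix a b assume a: "a \<in> {x, y, m x, m y}" and b: "b \<in> ?V - {z, z'}" and ab: "(a, b) \<in> parcs G"
    have "f a = f b \<or> b = m a" using ab by (simp add: truncation_arcs[OF t])
    moreover have "b \<in> {x, y, z} \<union> {m x, m y, z'}" if "f a = f b"
      unfolding z(1)[symmetric] z'(1)[symmetric] using that a b xy by auto
    ultimately show "b \<in> {x, y, m x, m y}" using a b tx(2) ty(2) by auto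
  qed auto
  then have V: "?V = {x, y, m x, m y, z, z'}" using zz by blast
  have "f ` ?V = {f x, f (m x)}" unfolding V using zz xy by auto
  then show ?thesis using tx(3) by simp
qed

text \<open>\<open>\<rho>\<close> names the rung through \<open>x\<close> by its end with label
  \<open>u\<close>. The rungs become the vertices of degree two of \<open>K_{2,3}\<close> and, in
  the drawing, the three edges of the theta multigraph.\<close>

lemma two_classes_representatives:
  assumes G: "pair_graph G" and t: "truncation G f m" and two: "card (f ` pverts G) = 2"
  obtains u v \<rho> where "f ` pverts G = {u, v}" "u \<noteq> v" "card {y \<in> pverts G. f y = u} = 3"
    "\<And>x. x \<in> pverts G \<Longrightarrow> \<rho> x \<in> pverts G \<and> f (\<rho> x) = u \<and> \<rho> x = (if f x = u then x else m x)"
    "\<And>x. x \<in> pverts G \<Longrightarrow> f x = u \<or> f x = v"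
    "\<And>x y. x \<in> pverts G \<Longrightarrow> y \<in> pverts G \<Longrightarrow> \<rho> x = \<rho> y \<longleftrightarrow> y = x \<or> y = m x"
proof -
  let ?V = "pverts G"
  note td = truncationD[OF t]
  obtain u v where uv: "f ` ?V = {u, v}" "u \<noteq> v" using two by (meson card_2_iff)
  obtain x where "x \<in> ?V" "f x = u" using uv by blast
  then have c3: "card {y \<in> ?V. f y = u} = 3" using td(5) by blast
  have cls: "f x = u \<or> f x = v" if "x \<in> ?V" for x using uv(1) that by blast
  define \<rho> where "\<rho> x = (if f x = u then x else m x)" for x
  have rep: "\<rho> x \<in> ?V \<and> f (\<rho> x) = u \<and> \<rho> x = (if f x = u then x else m x)" if "x \<in> ?V" for x
    using cls[OF that] cls[OF td(1)[OF that]] td(1,3)[OF that] that by (auto simp: \<rho>_def)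
  have "\<rho> x = \<rho> y \<longleftrightarrow> y = x \<or> y = m x" if xy: "x \<in> ?V" "y \<in> ?V" for x y
  proof -
    have mm: "m (m x) = x" "m (m y) = y" and w: "f x \<noteq> u \<Longrightarrow> f (m x) = u" "f y \<noteq> u \<Longrightarrow> f (m y) = u"
      and ne: "f (m x) \<noteq> f x" "f (m y) \<noteq> f y"
      using td(2,3)[OF xy(1)] td(2,3)[OF xy(2)] rep[OF xy(1)] rep[OF xy(2)] by auto
    show ?thesis
      unfolding \<rho>_def using mm w ne by (cases "f x = u"; cases "f y = u"; simp; metis)
  qed
  then show thesis using that[of u v \<rho>] uv c3 rep cls by blast
qed

section \<open>Line graphs of subdivisions\<close>

text \<open>\<open>D\<close> is the edge set of a bipartite graph, each edge given by its ends on
  the two sides, and \<open>h\<close> is an isomorphism to its line graph. The two sides need not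
  lie in one vertex type, so \<open>K_{2,3}\<close> and subdivisions share this form.\<close>

definition incidence_iso :: "'a pair_pre_digraph \<Rightarrow> ('a \<Rightarrow> 'l \<times> 'e) \<Rightarrow> ('l \<times> 'e) set \<Rightarrow> bool" where
  "incidence_iso G h D \<longleftrightarrow> bij_betw h (pverts G) D \<and> (\<forall>x \<in> pverts G. \<forall>y \<in> pverts G.
     (x, y) \<in> parcs G \<longleftrightarrow> x \<noteq> y \<and> (fst (h x) = fst (h y) \<or> snd (h x) = snd (h y)))"

text \<open>\<open>i\<close> and \<open>j\<close> embed the two sides disjointly into
  \<open>H\<close>. Hence an edge of \<open>H\<close> determines its pair in \<open>D\<close>, and
  two edges meet iff their pairs agree in a component.\<close>

lemma line_graph_incidence_iff:
  fixes H :: "'b pair_pre_digraph" and i :: "'l \<Rightarrow> 'b" and j :: "'e \<Rightarrow> 'b"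
  assumes G: "pair_graph G" and i: "inj_on i (fst ` D)" and j: "inj_on j (snd ` D)"
    and ij: "i ` fst ` D \<inter> j ` snd ` D = {}" and H: "uedges H = (\<lambda>d. {i (fst d), j (snd d)}) ` D"
  shows "digraph_iso (with_proj G) (with_proj (line_graph H)) \<longleftrightarrow> (\<exists>h. incidence_iso G h D)"
proof -
  let ?K = "\<lambda>d. {i (fst d), j (snd d)}" and ?V = "pverts G" and ?E = "parcs G"
  have meet: "?K d \<inter> ?K d' \<noteq> {} \<longleftrightarrow> fst d = fst d' \<or> snd d = snd d'" if "d \<in> D" "d' \<in> D" for d d'
    using that ij inj_on_eq_iff[OF i, of "fst d" "fst d'"] inj_on_eq_iff[OF j, of "snd d" "snd d'"] by auto
  have inj: "inj_on ?K D"
  proof (rule inj_onI)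
    fix d d' assume d: "d \<in> D" "d' \<in> D" "?K d = ?K d'"
    have "i (fst d) \<noteq> j (snd d')" "i (fst d') \<noteq> j (snd d)" using d(1,2) ij by blast+
    then have "i (fst d) = i (fst d')" "j (snd d) = j (snd d')" using d(3) by (auto simp: doubleton_eq_iff)
    then show "d = d'" using d(1,2) i j by (auto dest!: inj_onD intro: prod_eqI)
  qed
  have K: "bij_betw ?K D (uedges H)" using inj H by (simp add: bij_betw_def)
  have ln: "digraph_iso (with_proj G) (with_proj (line_graph H)) \<longleftrightarrow>
      (\<exists>g. bij_betw g ?V (uedges H) \<and> (\<forall>x \<in> ?V. \<forall>y \<in> ?V. (x, y) \<in> ?E \<longleftrightarrow> g x \<noteq> g y \<and> g x \<inter> g y \<noteq> {}))"
  proof -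
    have "parcs (line_graph H) \<subseteq> pverts (line_graph H) \<times> pverts (line_graph H)" by (auto simp: line_graph_def)
    then have "digraph_iso (with_proj G) (with_proj (line_graph H)) \<longleftrightarrow>
      (\<exists>g. is_pair_iso g ?V ?E (uedges H) (parcs (line_graph H)))"
      using digraph_iso_iff[OF pair_graphD(3)[OF G], of "line_graph H"] by (simp add: line_graph_def)
    also have "\<dots> \<longleftrightarrow> (\<exists>g. bij_betw g ?V (uedges H) \<and> (\<forall>x \<in> ?V. \<forall>y \<in> ?V. (x, y) \<in> ?E \<longleftrightarrow> g x \<noteq> g y \<and> g x \<inter> g y \<noteq> {}))"
      unfolding is_pair_iso_def by (intro ex_cong1 conj_cong refl ball_cong) (auto simp: line_graph_def bij_betw_def)
    finally show ?thesis .
  qed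
  show ?thesis
    unfolding ln
  proof
    assume "\<exists>g. bij_betw g ?V (uedges H) \<and> (\<forall>x \<in> ?V. \<forall>y \<in> ?V. (x, y) \<in> ?E \<longleftrightarrow> g x \<noteq> g y \<and> g x \<inter> g y \<noteq> {})"
    then obtain g where g: "bij_betw g ?V (uedges H)"
      "\<And>x y. x \<in> ?V \<Longrightarrow> y \<in> ?V \<Longrightarrow> (x, y) \<in> ?E \<longleftrightarrow> g x \<noteq> g y \<and> g x \<inter> g y \<noteq> {}" by blast
    define h where "h x = inv_into D ?K (g x)" for x
    have "bij_betw (inv_into D ?K \<circ> g) ?V D"
      by (rule bij_betw_trans[OF g(1) bij_betw_inv_into[OF K]])
    then have h: "bij_betw h ?V D" by (simp add: h_def[abs_def] comp_def)
    have Kh: "?K (h x) = g x" and hD: "h x \<in> D" if "x \<in> ?V" for x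
    proof -
      have "g x \<in> g ` ?V" using that by blast
      then have "g x \<in> ?K ` D" using g(1) H by (simp add: bij_betw_def)
      then show "?K (h x) = g x" "h x \<in> D"
        unfolding h_def using f_inv_into_f[of "g x" ?K D] inv_into_into[of "g x" ?K D] by simp_all
    qed
    have "incidence_iso G h D"
      unfolding incidence_iso_def
    proof (intro conjI ballI)
      fix x y assume xy: "x \<in> ?V" "y \<in> ?V"
      have "g x \<noteq> g y \<longleftrightarrow> x \<noteq> y" using g(1) xy by (auto simp: bij_betw_def inj_on_eq_iff)
      then show "(x, y) \<in> ?E \<longleftrightarrow> x \<noteq> y \<and> (fst (h x) = fst (h y) \<or> snd (h x) = snd (h y))"
        using g(2)[OF xy] meet[OF hD[OF xy(1)] hD[OF xy(2)]] unfolding Kh[OF xy(1)] Kh[OF xy(2)] by blast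
    qed (rule h)
    then show "\<exists>h. incidence_iso G h D" by blast
  next
    assume "\<exists>h. incidence_iso G h D"
    then obtain h where h: "bij_betw h ?V D"
      "\<And>x y. x \<in> ?V \<Longrightarrow> y \<in> ?V \<Longrightarrow> (x, y) \<in> ?E \<longleftrightarrow> x \<noteq> y \<and> (fst (h x) = fst (h y) \<or> snd (h x) = snd (h y))"
      unfolding incidence_iso_def by blast
    define g where "g x = ?K (h x)" for x
    have "bij_betw (?K \<circ> h) ?V (uedges H)" by (rule bij_betw_trans[OF h(1) K])
    then have g: "bij_betw g ?V (uedges H)" by (simp add: g_def[abs_def] comp_def)
    have "(x, y) \<in> ?E \<longleftrightarrow> g x \<noteq> g y \<and> g x \<inter> g y \<noteq> {}" if xy: "x \<in> ?V" "y \<in> ?V" for x y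
    proof -
      have hD: "h x \<in> D" "h y \<in> D" using h(1) xy by (auto simp: bij_betw_def)
      have "g x \<noteq> g y \<longleftrightarrow> x \<noteq> y" using g(1) xy by (auto simp: bij_betw_def inj_on_eq_iff)
      then show ?thesis using h(2)[OF xy] meet[OF hD] unfolding g_def by blast
    qed
    then show "\<exists>g. bij_betw g ?V (uedges H) \<and> (\<forall>x \<in> ?V. \<forall>y \<in> ?V. (x, y) \<in> ?E \<longleftrightarrow> g x \<noteq> g y \<and> g x \<inter> g y \<noteq> {})"
      using g by blast
  qed
qed

text \<open>The three pairs with a given first component form a triangle, and the two pairs with a
  given second component are exchanged by \<open>m\<close>.\<close>

lemma truncation_of_incidence:
  fixes h :: "'a \<Rightarrow> nat \<times> 'e"
  assumes h: "incidence_iso G h D" and G: "pair_graph G"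
    and row: "\<And>d. d \<in> D \<Longrightarrow> card {e. (fst d, e) \<in> D} = 3" and col: "\<And>d. d \<in> D \<Longrightarrow> card {v. (v, snd d) \<in> D} = 2"
  obtains m where "truncation G (\<lambda>x. fst (h x)) m" "\<And>x. x \<in> pverts G \<Longrightarrow> snd (h (m x)) = snd (h x)"
proof -
  let ?V = "pverts G" and ?E = "parcs G"
  have bij: "bij_betw h ?V D"
    and adj: "\<And>x y. x \<in> ?V \<Longrightarrow> y \<in> ?V \<Longrightarrow> (x, y) \<in> ?E \<longleftrightarrow> x \<noteq> y \<and> (fst (h x) = fst (h y) \<or> snd (h x) = snd (h y))"
    using h by (auto simp: incidence_iso_def)
  have inj: "h x = h y \<longleftrightarrow> x = y" if "x \<in> ?V" "y \<in> ?V" for x y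
    using bij that by (auto simp: bij_betw_def inj_on_eq_iff)
  have hD: "h x \<in> D" if "x \<in> ?V" for x using bij that by (auto simp: bij_betw_def)
  have pre: "\<exists>x \<in> ?V. h x = d" if "d \<in> D" for d using bij that by (auto simp: bij_betw_def)
  have "\<exists>y. y \<in> ?V \<and> y \<noteq> x \<and> snd (h y) = snd (h x) \<and>
      (\<forall>z \<in> ?V. snd (h z) = snd (h x) \<longrightarrow> z = x \<or> z = y)" if x: "x \<in> ?V" for x
  proof -
    obtain v w where vw: "{v. (v, snd (h x)) \<in> D} = {v, w}" "v \<noteq> w"
      using col[OF hD[OF x]] by (meson card_2_iff)
    have "fst (h x) \<in> {v. (v, snd (h x)) \<in> D}" using hD[OF x] by simp
    then obtain u where u: "{v. (v, snd (h x)) \<in> D} = {fst (h x), u}" "u \<noteq> fst (h x)"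
      using vw by (metis insert_commute insertE singletonD)
    then have "(u, snd (h x)) \<in> D" by blast
    then obtain y where y: "y \<in> ?V" "h y = (u, snd (h x))" using pre by blast
    have "z = x \<or> z = y" if z: "z \<in> ?V" "snd (h z) = snd (h x)" for z
    proof -
      have "fst (h z) \<in> {v. (v, snd (h x)) \<in> D}" using hD[OF z(1)] z(2) by (metis mem_Collect_eq prod.collapse)
      then have "h z = h x \<or> h z = h y" using z(2) y unfolding u(1) by (auto simp: prod_eq_iff)
      then show ?thesis using inj z y x by blast
    qed
    moreover have "y \<noteq> x"
    proof
      assume "y = x"
      then have "fst (h x) = u" using y(2) by (metis fst_conv)
      then show False using u(2) by simp
    qed
    ultimately show ?thesis using y by (intro exI[of _ y]) simp
  qed
  then obtain m where m: "\<And>x. x \<in> ?V \<Longrightarrow> m x \<in> ?V \<and> m x \<noteq> x \<and> snd (h (m x)) = snd (h x) \<and>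
      (\<forall>z \<in> ?V. snd (h z) = snd (h x) \<longrightarrow> z = x \<or> z = m x)" by metis
  have "truncation G (\<lambda>x. fst (h x)) m"
    unfolding truncation_def
  proof (intro conjI ballI allI)
    fix x assume x: "x \<in> ?V"
    note mx = m[OF x]
    show "m x \<in> ?V" using mx by blast
    show "m (m x) = x" using m[of "m x"] mx x by metis
    show "fst (h (m x)) \<noteq> fst (h x)" using mx inj[of "m x" x] x by (auto simp: prod_eq_iff)
    have "bij_betw (\<lambda>y. snd (h y)) {y \<in> ?V. fst (h y) = fst (h x)} {e. (fst (h x), e) \<in> D}"
      unfolding bij_betw_def
    proof (intro conjI set_eqI iffI)
      show "inj_on (\<lambda>y. snd (h y)) {y \<in> ?V. fst (h y) = fst (h x)}"
      proof (rule inj_onI)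
        fix y z assume yz: "y \<in> {y \<in> ?V. fst (h y) = fst (h x)}" "z \<in> {y \<in> ?V. fst (h y) = fst (h x)}"
          "snd (h y) = snd (h z)"
        then have "h y = h z" by (simp add: prod_eq_iff)
        then show "y = z" using inj yz by blast
      qed
    next
      fix e assume "e \<in> {e. (fst (h x), e) \<in> D}"
      then obtain y where "y \<in> ?V" "h y = (fst (h x), e)" using pre by blast
      then show "e \<in> (\<lambda>y. snd (h y)) ` {y \<in> ?V. fst (h y) = fst (h x)}" by (intro image_eqI[of _ _ y]) auto
    next
      fix e assume "e \<in> (\<lambda>y. snd (h y)) ` {y \<in> ?V. fst (h y) = fst (h x)}"
      then obtain y where y: "y \<in> ?V" "fst (h y) = fst (h x)" "e = snd (h y)" by blast
      then show "e \<in> {e. (fst (h x), e) \<in> D}" using hD[OF y(1)] by (metis mem_Collect_eq prod.collapse)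
    qed
    then show "card {y \<in> ?V. fst (h y) = fst (h x)} = 3" using row[OF hD[OF x]] by (simp add: bij_betw_same_card)
  next
    fix x y
    show "(x, y) \<in> ?E \<longleftrightarrow> x \<in> ?V \<and> y \<in> ?V \<and> x \<noteq> y \<and> (fst (h x) = fst (h y) \<or> y = m x)"
    proof (cases "x \<in> ?V \<and> y \<in> ?V")
      case True
      then have mx: "m x \<noteq> x" "snd (h (m x)) = snd (h x)" "\<And>z. z \<in> ?V \<Longrightarrow> snd (h z) = snd (h x) \<Longrightarrow> z = x \<or> z = m x"
        using m[of x] by blast+
      have "x \<noteq> y \<and> snd (h x) = snd (h y) \<longleftrightarrow> x \<noteq> y \<and> y = m x" using mx(3)[of y] mx(2) True by auto
      then show ?thesis using adj[of x y] True by blast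
    qed (use pair_graphD(3)[OF G] in blast)
  qed
  then show thesis using that m by blast
qed

text \<open>Here \<open>e\<close> may be any naming of the edges between \<open>x\<close> and
  \<open>m x\<close>.\<close>

lemma incidence_of_truncation:
  assumes t: "truncation G f m" and D: "bij_betw (\<lambda>x. (f x, e x)) (pverts G) D"
    and e: "\<And>x y. x \<in> pverts G \<Longrightarrow> y \<in> pverts G \<Longrightarrow> e x = e y \<longleftrightarrow> y = x \<or> y = m x"
  shows "incidence_iso G (\<lambda>x. (f x, e x)) D"
  unfolding incidence_iso_def using D e by (auto simp: truncation_arcs[OF t])

lemma uedges_iso:
  assumes \<psi>: "is_pair_iso \<psi> (pverts K) (parcs K) (pverts H) (parcs H)"
    and K: "parcs K \<subseteq> pverts K \<times> pverts K" and H: "parcs H \<subseteq> pverts H \<times> pverts H"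
  shows "uedges H = (\<lambda>e. \<psi> ` e) ` uedges K"
proof (intro set_eqI iffI)
  have bij: "\<psi> ` pverts K = pverts H"
    and arc: "\<And>x y. x \<in> pverts K \<Longrightarrow> y \<in> pverts K \<Longrightarrow> (x, y) \<in> parcs K \<longleftrightarrow> (\<psi> x, \<psi> y) \<in> parcs H"
    using \<psi> by (auto simp: is_pair_iso_def bij_betw_def)
  {
    fix e assume "e \<in> uedges H"
    then obtain a b where ab: "(a, b) \<in> parcs H" "e = {a, b}" by (auto simp: uedges_def)
    then obtain x y where "x \<in> pverts K" "y \<in> pverts K" "a = \<psi> x" "b = \<psi> y" using H bij by blast
    then have "(x, y) \<in> parcs K" "e = \<psi> ` {x, y}" using arc ab by auto
    then show "e \<in> (\<lambda>e. \<psi> ` e) ` uedges K" unfolding uedges_def by blast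
  next
    fix e assume "e \<in> (\<lambda>e. \<psi> ` e) ` uedges K"
    then obtain x y where xy: "(x, y) \<in> parcs K" "e = {\<psi> x, \<psi> y}" by (auto simp: uedges_def)
    then have "(\<psi> x, \<psi> y) \<in> parcs H" using arc K by blast
    then show "e \<in> uedges H" using xy(2) unfolding uedges_def by blast
  }
qed

text \<open>\<open>basic\<close> asks for \<open>H\<close> on the natural numbers, whereas a
  subdivision lives on a sum type.\<close>

lemma nat_copy:
  fixes K :: "'b pair_pre_digraph"
  assumes K: "pair_graph K"
  obtains \<phi> :: "'b \<Rightarrow> nat" and H :: "nat pair_pre_digraph" where "inj_on \<phi> (pverts K)" "pair_graph H"
    "digraph_iso (with_proj H) (with_proj K)" "uedges H = (\<lambda>e. \<phi> ` e) ` uedges K"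
proof -
  note k = pair_graphD[OF K]
  obtain n and \<phi> :: "'b \<Rightarrow> nat" where \<phi>: "inj_on \<phi> (pverts K)" using finite_imp_inj_to_nat_seg[OF k(1)] by blast
  define H where "H = \<lparr>pverts = \<phi> ` pverts K, parcs = map_prod \<phi> \<phi> ` parcs K\<rparr>"
  have sub: "parcs H \<subseteq> pverts H \<times> pverts H" using k(3) by (auto simp: H_def)
  have arc: "(\<phi> x, \<phi> y) \<in> parcs H \<longleftrightarrow> (x, y) \<in> parcs K" if "x \<in> pverts K" "y \<in> pverts K" for x y
  proof
    assume "(\<phi> x, \<phi> y) \<in> parcs H"
    then obtain a b where "(a, b) \<in> parcs K" "\<phi> a = \<phi> x" "\<phi> b = \<phi> y" by (auto simp: H_def)
    moreover from this have "a \<in> pverts K" "b \<in> pverts K" using k(3) by auto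
    ultimately show "(x, y) \<in> parcs K" using that \<phi> by (metis inj_onD)
  qed (force simp: H_def)
  have "pair_graph H"
  proof (rule pair_graphI[OF _ sub])
    show "finite (pverts H)" using k(1) by (simp add: H_def)
    show "sym (parcs H)" using k(4) by (force simp: H_def sym_def)
    show "irrefl (parcs H)"
    proof (rule irreflI, rule notI)
      fix z assume z: "(z, z) \<in> parcs H"
      then obtain x where "x \<in> pverts K" "z = \<phi> x" using sub by (auto simp: H_def)
      then show False using arc[of x x] z k(5) by (auto simp: irrefl_def)
    qed
  qed
  moreover have iso: "is_pair_iso \<phi> (pverts K) (parcs K) (pverts H) (parcs H)"
    using \<phi> arc by (simp add: is_pair_iso_def H_def inj_on_imp_bij_betw)
  then have "digraph_iso (with_proj H) (with_proj K)"
    unfolding digraph_iso_iff[OF sub k(3)] by (blast intro: is_pair_iso_inv_into)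
  moreover have "uedges H = (\<lambda>e. \<phi> ` e) ` uedges K" by (rule uedges_iso[OF iso k(3) sub])
  ultimately show thesis using that \<phi> by blast
qed

section \<open>Subdivisions and their incidences\<close>

lemma uedgesD:
  assumes "pair_graph J" "e \<in> uedges J"
  shows "card e = 2" "e \<subseteq> pverts J"
proof -
  obtain u v where "e = {u, v}" "(u, v) \<in> parcs J" using assms(2) by (auto simp: uedges_def)
  moreover from this have "u \<noteq> v" using pair_graphD(5)[OF assms(1)] by (auto simp: irrefl_def)
  ultimately show "card e = 2" "e \<subseteq> pverts J" using pair_graphD(3)[OF assms(1)] by auto
qed

lemma pair_graph_subdivide_all:
  assumes J: "pair_graph J"
  shows "pair_graph (subdivide_all J)"
proof (rule pair_graphI)
  note k = pair_graphD[OF J]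
  have "uedges J \<subseteq> Pow (pverts J)" using uedgesD(2)[OF J] by blast
  then have "finite (uedges J)" using k(1) by (meson finite_Pow_iff finite_subset)
  then show "finite (pverts (subdivide_all J))" using k(1) by (simp add: subdivide_all_def Let_def)
  show "parcs (subdivide_all J) \<subseteq> pverts (subdivide_all J) \<times> pverts (subdivide_all J)"
    using uedgesD(2)[OF J] by (auto simp: subdivide_all_def Let_def)
  show "sym (parcs (subdivide_all J))" by (auto simp: subdivide_all_def Let_def sym_def)
  show "irrefl (parcs (subdivide_all J))" by (auto simp: subdivide_all_def Let_def irrefl_def)
qed

text \<open>The incidences of \<open>J\<close>, which are the edges of its subdivision.\<close>

definition flags :: "'a pair_pre_digraph \<Rightarrow> ('a \<times> 'a set) set" where
  "flags J = {(v, e). e \<in> uedges J \<and> v \<in> e}"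

lemma uedges_subdivide_all:
  "uedges (subdivide_all J) = (\<lambda>d. {Inl (fst d), Inr (snd d)}) ` flags J"
proof (intro set_eqI iffI)
  fix x assume "x \<in> uedges (subdivide_all J)"
  then obtain v e where "x = {Inl v, Inr e}" "e \<in> uedges J" "v \<in> e"
    by (auto simp: uedges_def subdivide_all_def Let_def insert_commute)
  then show "x \<in> (\<lambda>d. {Inl (fst d), Inr (snd d)}) ` flags J"
    by (intro image_eqI[of _ _ "(v, e)"]) (auto simp: flags_def)
next
  fix x assume "x \<in> (\<lambda>d. {Inl (fst d), Inr (snd d)}) ` flags J"
  then obtain v e where "x = {Inl v, Inr e}" "e \<in> uedges J" "v \<in> e" by (auto simp: flags_def)
  then show "x \<in> uedges (subdivide_all J)"
    unfolding uedges_def[of "subdivide_all J"] by (auto simp: subdivide_all_def Let_def)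
qed

text \<open>The two alternatives are \<open>K\<^sub>2\<^sub>,\<^sub>3\<close> and the subdivision of the quotient.\<close>

definition truncation_basic :: "'a pair_pre_digraph \<Rightarrow> ('a \<Rightarrow> nat) \<Rightarrow> ('a \<Rightarrow> 'a) \<Rightarrow> bool" where
  "truncation_basic G f m \<longleftrightarrow> truncation G f m \<and>
    (card (f ` pverts G) = 2 \<or>
     simple_quotient G f m \<and> k_connected 3 (quotient_graph G f m) \<and> planar (quotient_graph G f m))"

lemma uedges_bipartite:
  assumes "parcs H = U \<times> W \<union> W \<times> U"
  shows "uedges H = (\<lambda>d. {fst d, snd d}) ` (U \<times> W)"
proof (intro set_eqI iffI)
  fix e assume "e \<in> uedges H"
  then obtain a b where ab: "e = {a, b}" "(a, b) \<in> U \<times> W \<union> W \<times> U" unfolding uedges_def assms by blast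
  then have "a \<in> U \<and> b \<in> W \<or> b \<in> U \<and> a \<in> W" by blast
  then obtain u w where "u \<in> U" "w \<in> W" "e = {u, w}" using ab(1) by (metis insert_commute)
  then show "e \<in> (\<lambda>d. {fst d, snd d}) ` (U \<times> W)" by (intro image_eqI[of _ _ "(u, w)"]) auto
next
  fix e assume "e \<in> (\<lambda>d. {fst d, snd d}) ` (U \<times> W)"
  then obtain d where "(fst d, snd d) \<in> parcs H" "e = {fst d, snd d}" using assms by auto
  then show "e \<in> uedges H" unfolding uedges_def by blast
qed

text \<open>Serves both directions: \<open>\<psi>\<close> is the inverse of a given isomorphism from
  \<open>H\<close>, or the renaming by which \<open>H\<close> is constructed.\<close>

lemma subdivision_line_graph_iff:
  assumes G: "pair_graph G" and J: "pair_graph J" and \<psi>: "inj_on \<psi> (pverts (subdivide_all J))"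
    and H: "uedges H = (\<lambda>e. \<psi> ` e) ` uedges (subdivide_all J)"
  shows "digraph_iso (with_proj G) (with_proj (line_graph H)) \<longleftrightarrow> (\<exists>h. incidence_iso G h (flags J))"
proof (rule line_graph_incidence_iff[OF G, of "\<lambda>v. \<psi> (Inl v)" _ "\<lambda>e. \<psi> (Inr e)"])
  let ?K = "subdivide_all J" and ?D = "flags J"
  have sub: "Inl v \<in> pverts ?K" if "v \<in> fst ` ?D" for v
  proof -
    obtain e where "e \<in> uedges J" "v \<in> e" using \<open>v \<in> fst ` ?D\<close> by (auto simp: flags_def)
    then have "v \<in> pverts J" using uedgesD(2)[OF J] by blast
    then show ?thesis by (simp add: subdivide_all_def Let_def)
  qed
  have sub': "Inr e \<in> pverts ?K" if "e \<in> snd ` ?D" for e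
    using that by (auto simp: flags_def subdivide_all_def Let_def)
  show "inj_on (\<lambda>v. \<psi> (Inl v)) (fst ` ?D)"
    using inj_onD[OF \<psi> _ sub sub] by (intro inj_onI) blast
  show "inj_on (\<lambda>e. \<psi> (Inr e)) (snd ` ?D)"
    using inj_onD[OF \<psi> _ sub' sub'] by (intro inj_onI) blast
  have "\<psi> (Inl v) \<noteq> \<psi> (Inr e)" if "v \<in> fst ` ?D" "e \<in> snd ` ?D" for v e
    using inj_onD[OF \<psi> _ sub[OF that(1)] sub'[OF that(2)]] by blast
  then show "(\<lambda>v. \<psi> (Inl v)) ` fst ` ?D \<inter> (\<lambda>e. \<psi> (Inr e)) ` snd ` ?D = {}" by blast
  show "uedges H = (\<lambda>d. {\<psi> (Inl (fst d)), \<psi> (Inr (snd d))}) ` ?D"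
    unfolding H uedges_subdivide_all by (simp add: image_image)
qed

text \<open>In the second alternative the quotient is \<open>J\<close> itself and not merely a copy,
  since the label of a vertex of \<open>G\<close> is the end \<open>v\<close> in its incidence
  \<open>(v, e)\<close>. The properties of \<open>J\<close> thus need no transport.\<close>

lemma basic_imp_truncation:
  assumes G: "pair_graph G" and b: "basic G"
  shows "\<exists>f m. truncation_basic G f m"
proof -
  obtain H :: "nat pair_pre_digraph" where H: "pair_graph H"
    and alt: "complete_bipartite_digraph 2 3 (with_proj H) \<or>
      (\<exists>J :: nat pair_pre_digraph. pair_graph J \<and> k_connected 3 J \<and> cubic J \<and> planar J \<and>
         digraph_iso (with_proj H) (with_proj (subdivide_all J)))"
    and iso: "digraph_iso (with_proj G) (with_proj (line_graph H))"
    using b unfolding basic_def by blast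
  from alt show ?thesis
  proof
    assume "complete_bipartite_digraph 2 3 (with_proj H)"
    then obtain U W where UW: "U \<inter> W = {}" "card U = 2" "card W = 3" "parcs H = U \<times> W \<union> W \<times> U"
      unfolding complete_bipartite_digraph_pair_def by blast
    have ne: "U \<noteq> {}" "W \<noteq> {}" using UW by auto
    obtain h where h: "incidence_iso G h (U \<times> W)"
      using line_graph_incidence_iff[OF G, of "\<lambda>x. x" "U \<times> W" "\<lambda>x. x" H] iso UW(1) ne uedges_bipartite[OF UW(4)]
      by auto
    obtain m where t: "truncation G (\<lambda>x. fst (h x)) m"
      by (rule truncation_of_incidence[OF h G]) (use UW in auto)
    have "h ` pverts G = U \<times> W" using h by (simp add: incidence_iso_def bij_betw_def)
    then have "(\<lambda>x. fst (h x)) ` pverts G = U" using ne(2) by (metis fst_image_times image_image)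
    then show ?thesis using t UW(2) unfolding truncation_basic_def by metis
  next
    assume "\<exists>J :: nat pair_pre_digraph. pair_graph J \<and> k_connected 3 J \<and> cubic J \<and> planar J \<and>
         digraph_iso (with_proj H) (with_proj (subdivide_all J))"
    then obtain J :: "nat pair_pre_digraph" where J: "pair_graph J" "k_connected 3 J" "cubic J" "planar J"
      "digraph_iso (with_proj H) (with_proj (subdivide_all J))" by blast
    let ?K = "subdivide_all J"
    note k = pair_graphD[OF pair_graph_subdivide_all[OF J(1)]] and hh = pair_graphD[OF H] and jj = pair_graphD[OF J(1)]
    obtain \<xi> where \<xi>: "is_pair_iso \<xi> (pverts H) (parcs H) (pverts ?K) (parcs ?K)"
      using J(5) digraph_iso_iff[OF hh(3) k(3)] by blast
    define \<psi> where "\<psi> = inv_into (pverts H) \<xi>"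
    have \<psi>: "is_pair_iso \<psi> (pverts ?K) (parcs ?K) (pverts H) (parcs H)"
      unfolding \<psi>_def by (rule is_pair_iso_inv_into[OF \<xi>])
    have inj: "inj_on \<psi> (pverts ?K)" using \<psi> by (simp add: is_pair_iso_def bij_betw_def)
    let ?D = "flags J"
    obtain h where h: "incidence_iso G h ?D"
      using iso unfolding subdivision_line_graph_iff[OF G J(1) inj uedges_iso[OF \<psi> k(3) hh(3)]] by blast
    have row: "card {e. (v, e) \<in> ?D} = 3" if v: "v \<in> pverts J" for v
    proof -
      have "{e. (v, e) \<in> ?D} = (\<lambda>w. {v, w}) ` {w. (v, w) \<in> parcs J}"
      proof (intro set_eqI iffI)
        fix e assume "e \<in> {e. (v, e) \<in> ?D}"
        then obtain a b where "(a, b) \<in> parcs J" "e = {a, b}" "v \<in> {a, b}" by (auto simp: flags_def uedges_def)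
        then show "e \<in> (\<lambda>w. {v, w}) ` {w. (v, w) \<in> parcs J}"
          using jj(4) by (auto dest: symD simp: insert_commute)
      qed (auto simp: flags_def uedges_def)
      moreover have "inj_on (\<lambda>w. {v, w}) {w. (v, w) \<in> parcs J}" by (auto simp: inj_on_def doubleton_eq_iff)
      ultimately show ?thesis using J(3) v unfolding cubic_def out_degree_eq_card by (simp add: card_image)
    qed
    have Dv: "fst d \<in> pverts J" if "d \<in> ?D" for d
    proof -
      have "snd d \<in> uedges J" "fst d \<in> snd d" using that by (auto simp: flags_def)
      then show ?thesis using uedgesD(2)[OF J(1)] by blast
    qed
    have col: "card {v. (v, snd d) \<in> ?D} = 2" if "d \<in> ?D" for d
      using that uedgesD(1)[OF J(1), of "snd d"] by (auto simp: flags_def)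
    obtain m where t: "truncation G (\<lambda>x. fst (h x)) m" and mh: "\<And>x. x \<in> pverts G \<Longrightarrow> snd (h (m x)) = snd (h x)"
      by (rule truncation_of_incidence[OF h G row[OF Dv] col], assumption, assumption) (rule that)
    define f where "f x = fst (h x)" for x
    have t: "truncation G f m" using t by (simp add: f_def[abs_def])
    have him: "h ` pverts G = ?D" and hinj: "inj_on h (pverts G)"
      using h by (simp_all add: incidence_iso_def bij_betw_def)
    \<comment> \<open>The edge \<open>snd (h x)\<close> has two elements and contains the distinct
      labels of \<open>x\<close> and \<open>m x\<close>.\<close>
    have snd_h: "snd (h x) = {f x, f (m x)}" if x: "x \<in> pverts G" for x
    proof -
      note tx = truncationD[OF t x]
      have d: "h x \<in> ?D" "h (m x) \<in> ?D" using him x tx by blast+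
      then have "f x \<in> snd (h x)" "f (m x) \<in> snd (h x)" "card (snd (h x)) = 2"
        using mh[OF x] uedgesD(1)[OF J(1), of "snd (h x)"] by (auto simp: flags_def f_def case_prod_beta)
      then show ?thesis using tx(3) card_subset_eq[of "snd (h x)" "{f x, f (m x)}"] card_ge_0_finite[of "snd (h x)"] by simp
    qed
    have fV: "f ` pverts G = pverts J"
    proof
      show "f ` pverts G \<subseteq> pverts J"
      proof
        fix v assume "v \<in> f ` pverts G"
        then obtain x where "x \<in> pverts G" "v = fst (h x)" unfolding f_def by blast
        then show "v \<in> pverts J" using Dv[of "h x"] him by blast
      qed
      show "pverts J \<subseteq> f ` pverts G"
      proof
        fix v assume "v \<in> pverts J"
        then have "{e. (v, e) \<in> ?D} \<noteq> {}" using row by fastforce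
        then obtain e x where "(v, e) = h x" "x \<in> pverts G" using him by blast
        then show "v \<in> f ` pverts G" unfolding f_def by (metis fst_conv image_eqI)
      qed
    qed
    have "(v, w) \<in> (\<lambda>x. (f x, f (m x))) ` pverts G \<longleftrightarrow> (v, w) \<in> parcs J" for v w
    proof
      assume "(v, w) \<in> (\<lambda>x. (f x, f (m x))) ` pverts G"
      then obtain x where x: "x \<in> pverts G" "v = f x" "w = f (m x)" by blast
      have "h x \<in> ?D" using him x(1) by blast
      then have "snd (h x) \<in> uedges J" by (auto simp: flags_def)
      then obtain a b where "(a, b) \<in> parcs J" "{a, b} = {v, w}" unfolding snd_h[OF x(1)] x(2,3) uedges_def by auto
      then show "(v, w) \<in> parcs J" using jj(4) by (auto simp: doubleton_eq_iff dest: symD)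
    next
      assume vw: "(v, w) \<in> parcs J"
      then have "(v, {v, w}) \<in> ?D" by (auto simp: flags_def uedges_def)
      then obtain x where x: "x \<in> pverts G" "h x = (v, {v, w})" using him by (metis imageE)
      have "v \<noteq> w" using vw jj(5) by (auto simp: irrefl_def)
      then have "f x = v" "f (m x) = w" using x snd_h[OF x(1)] by (auto simp: f_def doubleton_eq_iff)
      then show "(v, w) \<in> (\<lambda>x. (f x, f (m x))) ` pverts G" using x by blast
    qed
    then have "quotient_graph G f m = J"
      using fV by (intro pair_pre_digraph.equality) (auto simp del: surj_pair)
    moreover have "simple_quotient G f m"
    proof (rule inj_onI)
      fix x y assume xy: "x \<in> pverts G" "y \<in> pverts G" "(f x, f (m x)) = (f y, f (m y))"
      then have "h x = h y" using snd_h by (simp add: prod_eq_iff f_def)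
      then show "x = y" using hinj xy by (auto dest: inj_onD)
    qed
    ultimately show ?thesis using t J unfolding truncation_basic_def by blast
  qed
qed

lemma truncation_imp_basic:
  assumes G: "pair_graph G" and b: "truncation_basic G f m"
  shows "basic G"
proof -
  let ?V = "pverts G"
  have t: "truncation G f m" using b by (simp add: truncation_basic_def)
  note td = truncationD[OF t]
  from b have "card (f ` ?V) = 2 \<or>
     simple_quotient G f m \<and> k_connected 3 (quotient_graph G f m) \<and> planar (quotient_graph G f m)"
    by (simp add: truncation_basic_def)
  then show ?thesis
  proof
    assume two: "card (f ` ?V) = 2"
    obtain u v \<rho> where uv: "f ` ?V = {u, v}" "u \<noteq> v" and c3: "card {y \<in> ?V. f y = u} = 3"
      and \<rho>: "\<And>x. x \<in> ?V \<Longrightarrow> \<rho> x \<in> ?V \<and> f (\<rho> x) = u \<and> \<rho> x = (if f x = u then x else m x)"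
      and cls: "\<And>x. x \<in> ?V \<Longrightarrow> f x = u \<or> f x = v"
      and \<rho>_eq: "\<And>x y. x \<in> ?V \<Longrightarrow> y \<in> ?V \<Longrightarrow> \<rho> x = \<rho> y \<longleftrightarrow> y = x \<or> y = m x"
      by (rule two_classes_representatives[OF G t two]) (rule that)
    let ?C = "{y \<in> ?V. f y = u}"
    have "finite ?C" using pair_graphD(1)[OF G] by simp
    \<comment> \<open>Three numbers larger than \<open>u\<close> and \<open>v\<close>, so that they
      can form the other side of \<open>K_{2,3}\<close>.\<close>
    then obtain g where g: "bij_betw g ?C {u + v + 1..<u + v + 4}"
      using finite_same_card_bij[of ?C "{u + v + 1..<u + v + 4}"] c3 by auto
    let ?U = "{u, v}" and ?W = "{u + v + 1..<u + v + 4}"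
    define e where "e x = g (\<rho> x)" for x
    have rep: "\<rho> x \<in> ?C" if "x \<in> ?V" for x using \<rho>[OF that] by blast
    have "inj_on g ?C" using g by (simp add: bij_betw_def)
    then have e_eq: "e x = e y \<longleftrightarrow> y = x \<or> y = m x" if xy: "x \<in> ?V" "y \<in> ?V" for x y
      unfolding e_def using inj_on_eq_iff[OF _ rep[OF xy(1)] rep[OF xy(2)]] \<rho>_eq[OF xy] by blast
    have "bij_betw (\<lambda>x. (f x, e x)) ?V (?U \<times> ?W)"
      unfolding bij_betw_def
    proof (intro conjI set_eqI iffI inj_onI)
      fix x y assume xy: "x \<in> ?V" "y \<in> ?V" "(f x, e x) = (f y, e y)"
      then show "x = y" using e_eq[OF xy(1,2)] td(3)[OF xy(1)] by auto
    next
      fix d assume "d \<in> (\<lambda>x. (f x, e x)) ` ?V"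
      then obtain x where x: "x \<in> ?V" "d = (f x, e x)" by blast
      have "e x \<in> ?W" unfolding e_def using g rep[OF x(1)] by (auto simp: bij_betw_def)
      then show "d \<in> ?U \<times> ?W" using x uv(1) by blast
    next
      fix d assume d: "d \<in> ?U \<times> ?W"
      then have "snd d \<in> g ` ?C" using g unfolding bij_betw_def by (simp add: mem_Times_iff)
      then obtain x where x: "x \<in> ?C" "g x = snd d" by force
      have xV: "x \<in> ?V" "f x = u" using x by simp_all
      have "f (m x) \<in> {u, v}" using td(1)[OF xV(1)] uv(1) by blast
      then have mx: "m x \<in> ?V" "f (m x) = v" "m (m x) = x" "f (m x) \<noteq> u"
        using td(1-3)[OF xV(1)] xV by auto
      have "\<rho> x = x" "\<rho> (m x) = x" using \<rho>[OF xV(1)] \<rho>[OF mx(1)] xV(2) mx(3,4) by simp_all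
      then have "d = (f x, e x) \<or> d = (f (m x), e (m x))"
        using d x(2) xV(2) mx(2) unfolding e_def by (cases d) auto
      then show "d \<in> (\<lambda>x. (f x, e x)) ` ?V" using x mx by blast
    qed
    then have inc: "incidence_iso G (\<lambda>x. (f x, e x)) (?U \<times> ?W)"
      by (rule incidence_of_truncation[OF t _ e_eq])
    define H where "H = \<lparr>pverts = ?U \<union> ?W, parcs = ?U \<times> ?W \<union> ?W \<times> ?U\<rparr>"
    have dj: "?U \<inter> ?W = {}" by auto
    have "complete_bipartite_digraph 2 3 (with_proj H)"
      unfolding complete_bipartite_digraph_pair_def H_def pair_pre_digraph.simps
    proof (intro conjI exI)
      show "card ?U = 2" "card ?W = 3" using uv(2) by simp_all
    qed (use dj in simp_all)
    moreover have "uedges H = (\<lambda>d. {fst d, snd d}) ` (?U \<times> ?W)"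
      by (rule uedges_bipartite) (simp add: H_def)
    then have "digraph_iso (with_proj G) (with_proj (line_graph H))"
      using line_graph_incidence_iff[OF G, of "\<lambda>x. x" "?U \<times> ?W" "\<lambda>x. x" H] inc dj by auto
    ultimately show ?thesis
      unfolding basic_def using pair_graphI_complete_bipartite by blast
  next
    let ?Q = "quotient_graph G f m"
    assume q: "simple_quotient G f m \<and> k_connected 3 ?Q \<and> planar ?Q"
    then have inj: "simple_quotient G f m" by blast
    have Q: "pair_graph ?Q" by (rule pair_graph_quotient[OF G t])
    let ?K = "subdivide_all ?Q" and ?D = "flags ?Q"
    obtain \<phi> :: "nat + nat set \<Rightarrow> nat" and H :: "nat pair_pre_digraph" where \<phi>: "inj_on \<phi> (pverts ?K)"
      and H: "pair_graph H" "digraph_iso (with_proj H) (with_proj ?K)" "uedges H = (\<lambda>e. \<phi> ` e) ` uedges ?K"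
      by (rule nat_copy[OF pair_graph_subdivide_all[OF Q]])
    have "\<exists>h. incidence_iso G h ?D"
    proof (intro exI, rule incidence_of_truncation[OF t, of "\<lambda>x. {f x, f (m x)}"])
      fix x y assume xy: "x \<in> ?V" "y \<in> ?V"
      show "{f x, f (m x)} = {f y, f (m y)} \<longleftrightarrow> y = x \<or> y = m x"
        by (rule simple_quotient_edge_eq[OF t inj xy])
    next
      show "bij_betw (\<lambda>x. (f x, {f x, f (m x)})) ?V ?D"
        unfolding bij_betw_def
      proof (intro conjI set_eqI iffI inj_onI)
        fix x y assume xy: "x \<in> ?V" "y \<in> ?V" "(f x, {f x, f (m x)}) = (f y, {f y, f (m y)})"
        then show "x = y" using simple_quotientD[OF inj xy(1,2)] by (auto simp: doubleton_eq_iff)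
      next
        fix d assume "d \<in> ?D"
        then obtain x where x: "x \<in> ?V" "snd d = {f x, f (m x)}" "fst d \<in> {f x, f (m x)}"
          by (auto simp: flags_def uedges_quotient)
        then have "d = (f x, {f x, f (m x)}) \<or> d = (f (m x), {f (m x), f (m (m x))})"
          using td(2)[OF x(1)] by (cases d) auto
        then show "d \<in> (\<lambda>x. (f x, {f x, f (m x)})) ` ?V" using x td(1) by blast
      qed (auto simp: flags_def uedges_quotient)
    qed
    then have "digraph_iso (with_proj G) (with_proj (line_graph H))"
      unfolding subdivision_line_graph_iff[OF G Q \<phi> H(3)] .
    then show ?thesis
      unfolding basic_def using H Q q cubic_quotient[OF t inj] by blast
  qed
qed

section \<open>Drawings\<close>

text \<open>A drawing depends only on the point sets of its arcs; with these, joining and reversing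
  leave no parametrisation to track.\<close>

definition arc_between :: "complex set \<Rightarrow> complex \<Rightarrow> complex \<Rightarrow> bool" where
  "arc_between X p q \<longleftrightarrow> (\<exists>\<gamma>. arc \<gamma> \<and> pathstart \<gamma> = p \<and> pathfinish \<gamma> = q \<and> path_image \<gamma> = X)"

lemma arc_between_sym: "arc_between X p q \<Longrightarrow> arc_between X q p"
  unfolding arc_between_def by (metis arc_reversepath pathfinish_reversepath pathstart_reversepath path_image_reversepath)

lemma arc_between_join:
  assumes "arc_between X p q" "arc_between Y q r" "X \<inter> Y \<subseteq> {q}"
  shows "arc_between (X \<union> Y) p r"
proof -
  obtain g h where "arc g" "pathstart g = p" "pathfinish g = q" "path_image g = X"
    "arc h" "pathstart h = q" "pathfinish h = r" "path_image h = Y"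
    using assms unfolding arc_between_def by blast
  then show ?thesis
    using assms(3) unfolding arc_between_def by (intro exI[of _ "g +++ h"]) (simp add: arc_join path_image_join)
qed

lemma arc_between_subpath:
  assumes "arc g" "0 \<le> s" "s < t" "t \<le> 1"
  shows "arc_between (g ` {s..t}) (g s) (g t)"
  unfolding arc_between_def using assms
  by (intro exI[of _ "subpath s t g"]) (simp add: arc_subpath_arc path_image_subpath)

text \<open>Parametrisations are chosen only here, so each edge may be drawn from either of its
  ends.\<close>

lemma planarI:
  fixes p :: "'a \<Rightarrow> complex"
  assumes p: "inj_on p (pverts G)"
    and I: "\<And>e. e \<in> uedges G \<Longrightarrow> \<exists>u w. e = {u, w} \<and> arc_between (I e) (p u) (p w)"
    and V: "\<And>e. e \<in> uedges G \<Longrightarrow> I e \<inter> p ` pverts G = p ` e"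
    and E: "\<And>e e'. e \<in> uedges G \<Longrightarrow> e' \<in> uedges G \<Longrightarrow> e \<noteq> e' \<Longrightarrow> I e \<inter> I e' = p ` (e \<inter> e')"
  shows "planar G"
proof -
  have "\<exists>\<gamma>. arc \<gamma> \<and> {pathstart \<gamma>, pathfinish \<gamma>} = p ` e \<and> path_image \<gamma> = I e" if "e \<in> uedges G" for e
    using I[OF that] unfolding arc_between_def by force
  then obtain \<gamma> where \<gamma>: "\<And>e. e \<in> uedges G \<Longrightarrow> arc (\<gamma> e) \<and> {pathstart (\<gamma> e), pathfinish (\<gamma> e)} = p ` e \<and> path_image (\<gamma> e) = I e"
    by metis
  then have "plane_drawing G p \<gamma>" unfolding plane_drawing_def using p V E by simp
  then show ?thesis unfolding planar_def by blast
qed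

section \<open>Joining two arcs near their common start\<close>

text \<open>\<open>w\<close> is the first time in \<open>B\<close> and \<open>u\<close> the last
  time in \<open>A\<close> before \<open>w\<close>. Both exist by compactness, and
  \<open>u \<noteq> w\<close> because the arc avoids \<open>A \<inter> B\<close>.\<close>

lemma arc_trim:
  fixes g :: "real \<Rightarrow> complex"
  assumes g: "arc g" and A: "closed A" "pathstart g \<in> A" and B: "closed B" "pathfinish g \<in> B"
    and AB: "A \<inter> B \<inter> path_image g = {}"
  obtains u w where "0 \<le> u" "u < w" "w \<le> 1" "g u \<in> A" "g w \<in> B" "g ` {u..w} \<inter> A = {g u}" "g ` {u..w} \<inter> B = {g w}"
proof -
  have c: "continuous_on {0..1} g" using g by (simp add: arc_def path_def)
  have "closed ({0..1} \<inter> g -` B)" using c B(1) by (intro continuous_closed_preimage) auto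
  moreover have "bounded ({0..1} \<inter> g -` B)" by (rule bounded_subset[OF bounded_closed_interval]) auto
  ultimately have "compact ({0..1} \<inter> g -` B)" by (simp add: compact_eq_bounded_closed)
  moreover have "1 \<in> {0..1} \<inter> g -` B" using B(2) by (simp add: pathfinish_def)
  ultimately obtain w where w: "w \<in> {0..1} \<inter> g -` B" "\<And>t. t \<in> {0..1} \<inter> g -` B \<Longrightarrow> w \<le> t"
    using compact_attains_inf[of "{0..1} \<inter> g -` B"] by blast
  have c': "continuous_on {0..w} g" using c w by (auto intro: continuous_on_subset)
  have "closed ({0..w} \<inter> g -` A)" using c' A(1) by (intro continuous_closed_preimage) auto
  moreover have "bounded ({0..w} \<inter> g -` A)" by (rule bounded_subset[OF bounded_closed_interval]) auto
  ultimately have "compact ({0..w} \<inter> g -` A)" by (simp add: compact_eq_bounded_closed)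
  moreover have "0 \<in> {0..w} \<inter> g -` A" using A(2) w by (simp add: pathstart_def)
  ultimately obtain u where u: "u \<in> {0..w} \<inter> g -` A" "\<And>t. t \<in> {0..w} \<inter> g -` A \<Longrightarrow> t \<le> u"
    using compact_attains_sup[of "{0..w} \<inter> g -` A"] by blast
  have uw: "0 \<le> u" "u \<le> w" "w \<le> 1" "g u \<in> A" "g w \<in> B" using u w by auto
  have "g u \<in> path_image g" using uw by (auto simp: path_image_def)
  then have "u \<noteq> w" using AB uw by auto
  then have "u < w" using uw by simp
  have "g ` {u..w} \<inter> A = {g u}"
  proof -
    have "t = u" if "t \<in> {u..w}" "g t \<in> A" for t using u(2)[of t] that uw by force
    then have "g ` {u..w} \<inter> A \<subseteq> {g u}" by blast
    moreover have "g u \<in> g ` {u..w}" using \<open>u < w\<close> by auto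
    ultimately show ?thesis using uw(4) by blast
  qed
  moreover have "g ` {u..w} \<inter> B = {g w}"
  proof -
    have "t = w" if "t \<in> {u..w}" "g t \<in> B" for t using w(2)[of t] that uw by force
    then have "g ` {u..w} \<inter> B \<subseteq> {g w}" by blast
    moreover have "g w \<in> g ` {u..w}" using \<open>u < w\<close> by auto
    ultimately show ?thesis using uw(5) by blast
  qed
  ultimately show thesis by (rule that[OF uw(1) \<open>u < w\<close> uw(3-5)])
qed

lemma path_near_start:
  fixes g :: "real \<Rightarrow> complex"
  assumes g: "path g" and r: "0 < r"
  obtains t where "0 < t" "t < 1" "g ` {0..t} \<subseteq> ball (pathstart g) r"
proof -
  have "continuous_on {0..1} g" using g by (simp add: path_def)
  then obtain d where d: "d > 0" "\<And>t. t \<in> {0..1} \<Longrightarrow> dist t 0 < d \<Longrightarrow> dist (g t) (g 0) < r"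
    using r by (metis atLeastAtMost_iff continuous_on_iff order_refl zero_le_one)
  define t where "t = min (d / 2) (1 / 2)"
  have "0 < t" "t < 1" "t < d" using d by (auto simp: t_def)
  moreover have "g ` {0..t} \<subseteq> ball (pathstart g) r"
    using d(2) \<open>t < 1\<close> \<open>t < d\<close> by (auto simp: pathstart_def dist_commute)
  ultimately show thesis using that by blast
qed

text \<open>
  By Janiszewski's theorem the arc \<open>b\<close> does not separate \<open>a\<close> from \<open>c\<close> near the common start of the
  three arcs: an initial piece of \<open>b\<close> meets the rest of the drawing, the rest of \<open>b\<close> and the outside
  of the disc in one point only.
\<close>

lemma corner_arc:
  fixes a b c :: "real \<Rightarrow> complex"
  assumes arcs: "arc a" "arc b" "arc c" and start: "pathstart a = v" "pathstart b = v" "pathstart c = v"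
    and ab: "path_image a \<inter> path_image b = {v}" and ac: "path_image a \<inter> path_image c = {v}"
    and bc: "path_image b \<inter> path_image c = {v}"
    and K: "closed K" "v \<notin> K" "pathfinish a \<in> K" "pathfinish c \<in> K" "path_image b \<inter> K \<subseteq> {pathfinish b}"
    and r: "0 < r"
  obtains X s t where "0 < s" "s < 1" "0 < t" "t < 1" "arc_between X (a s) (c t)" "X \<subseteq> ball v r - K - path_image b"
    "X \<inter> path_image a = {a s}" "X \<inter> path_image c = {c t}"
proof -
  have paths: "path a" "path b" "path c" using arcs by (auto intro: arc_imp_path)
  have inj: "inj_on a {0..1}" "inj_on b {0..1}" "inj_on c {0..1}" using arcs by (auto simp: arc_def)
  obtain \<tau> where \<tau>: "0 < \<tau>" "\<tau> < 1" "b ` {0..\<tau>} \<subseteq> ball v r"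
    using path_near_start[OF paths(2) r] start by metis
  \<comment> \<open>\<open>S\<close> stays in the disc and meets \<open>K\<close> nowhere, since
    \<open>b\<close> could do so only at its end. So it meets \<open>T\<close> only at the cut
    \<open>b \<tau>\<close>.\<close>
  define S where "S = b ` {0..\<tau>}"
  define T where "T = K \<union> - ball v r \<union> b ` {\<tau>..1}"
  have arcS: "arc (subpath 0 \<tau> b)" and Sim: "path_image (subpath 0 \<tau> b) = S"
    using arcs(2) \<tau> by (simp_all add: arc_subpath_arc path_image_subpath S_def)
  have "compact S" using arcS Sim compact_arc_image by blast
  have conS: "topological_space_class.connected (- S)"
    using path_connected_arc_complement[OF arcS] Sim by (simp add: path_connected_imp_connected)
  have bsub: "b ` {\<tau>..1} = path_image (subpath \<tau> 1 b)" using \<tau> by (simp add: path_image_subpath)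
  have "arc (subpath \<tau> 1 b)" using arcs(2) \<tau> by (simp add: arc_subpath_arc)
  then have "closed (b ` {\<tau>..1})" unfolding bsub by (rule closed_arc_image)
  then have clT: "closed T" using K(1) unfolding T_def by (intro closed_Un closed_Compl open_ball)
  have bI: "b s = b t \<longleftrightarrow> s = t" if "s \<in> {0..1}" "t \<in> {0..1}" for s t using inj(2) that by (auto dest: inj_onD)
  have "S \<inter> T = {b \<tau>}"
  proof
    show "S \<inter> T \<subseteq> {b \<tau>}"
    proof
      fix z assume z: "z \<in> S \<inter> T"
      then obtain s where s: "s \<in> {0..\<tau>}" "z = b s" by (auto simp: S_def)
      have "z \<notin> K"
      proof
        assume "z \<in> K"
        moreover have "z \<in> path_image b" using s \<tau> by (auto simp: path_image_def)
        ultimately have "b s = b 1" using K(5) s by (auto simp: pathfinish_def)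
        then show False using bI[of s 1] s \<tau> by auto
      qed
      moreover have "z \<in> ball v r" using s \<tau>(3) by blast
      ultimately have "z \<in> b ` {\<tau>..1}" using z unfolding T_def by blast
      then obtain t where t: "t \<in> {\<tau>..1}" "z = b t" by blast
      have "s \<in> {0..1}" "t \<in> {0..1}" "b s = b t" using s t \<tau> by simp_all
      then have "s = t" using bI by blast
      then have "s = \<tau>" using s(1) t(1) by simp
      then show "z \<in> {b \<tau>}" using s(2) by simp
    qed
    have "b \<tau> \<in> b ` {0..\<tau>}" "b \<tau> \<in> b ` {\<tau>..1}" using \<tau> by auto
    then show "{b \<tau>} \<subseteq> S \<inter> T" unfolding S_def T_def by blast
  qed
  then have conST: "topological_space_class.connected (S \<inter> T)" by simp
  have v0: "v = a 0" "v = b 0" "v = c 0" using start by (simp_all add: pathstart_def)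
  have "b 0 \<notin> b ` {\<tau>..1}"
  proof
    assume "b 0 \<in> b ` {\<tau>..1}"
    then obtain t where "t \<in> {\<tau>..1}" "b 0 = b t" by blast
    then show False using bI[of 0 t] \<tau> by auto
  qed
  then have "v \<notin> T" using K(2) r v0(2) unfolding T_def by simp
  \<comment> \<open>A small disc around \<open>v\<close> misses \<open>T\<close> and contains points
    \<open>x\<close> of \<open>a\<close> and \<open>y\<close> of \<open>c\<close>, which are
    therefore connected outside \<open>T\<close>.\<close>
  then obtain \<delta> where \<delta>: "0 < \<delta>" "ball v \<delta> \<subseteq> - T"
    using open_contains_ball[of "- T"] clT by (auto simp: open_Compl)
  obtain s0 where s0: "0 < s0" "s0 < 1" "a ` {0..s0} \<subseteq> ball v \<delta>"
    using path_near_start[OF paths(1) \<delta>(1)] start by metis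
  obtain t0 where t0: "0 < t0" "t0 < 1" "c ` {0..t0} \<subseteq> ball v \<delta>"
    using path_near_start[OF paths(3) \<delta>(1)] start by metis
  define x where "x = a s0"
  define y where "y = c t0"
  have "x \<in> a ` {0..s0}" "y \<in> c ` {0..t0}" using s0 t0 by (simp_all add: x_def y_def)
  then have xy: "x \<in> ball v \<delta>" "y \<in> ball v \<delta>" using s0(3) t0(3) by blast+
  have xy': "x \<in> path_image a" "y \<in> path_image c"
    using s0 t0 by (auto simp: x_def y_def path_image_def)
  note xy = xy xy'
  have "x \<noteq> v" using inj_onD[OF inj(1), of s0 0] s0 unfolding x_def v0(1) by auto
  have "y \<noteq> v" using inj_onD[OF inj(3), of t0 0] t0 unfolding y_def v0(3) by auto
  have Sb: "S \<subseteq> path_image b" using \<tau> by (auto simp: S_def path_image_def)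
  have "x \<notin> S" "y \<notin> S" using Sb ab bc xy \<open>x \<noteq> v\<close> \<open>y \<noteq> v\<close> by blast+
  have "x \<noteq> y" using ac xy \<open>x \<noteq> v\<close> by blast
  have "connected_component (- S) x y"
    using conS \<open>x \<notin> S\<close> \<open>y \<notin> S\<close> unfolding connected_component_def by (intro exI[of _ "- S"]) auto
  moreover have "connected_component (- T) x y"
    using \<delta>(2) xy unfolding connected_component_def by (intro exI[of _ "ball v \<delta>"]) auto
  ultimately have "connected_component (- (S \<union> T)) x y"
    using Janiszewski[OF \<open>compact S\<close> clT conST] by blast
  moreover have "open (- (S \<union> T))" using compact_imp_closed[OF \<open>compact S\<close>] clT by (intro open_Compl closed_Un)
  ultimately have "path_component (- (S \<union> T)) x y" by (simp add: open_path_connected_component)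
  then obtain g0 where g0: "path g0" "path_image g0 \<subseteq> - (S \<union> T)" "pathstart g0 = x" "pathfinish g0 = y"
    by (auto simp: path_component_def)
  obtain g where g: "arc g" "path_image g \<subseteq> path_image g0" "pathstart g = x" "pathfinish g = y"
    using path_contains_arc[OF g0(1,3,4) \<open>x \<noteq> y\<close>] by blast
  have ST: "S \<union> T = K \<union> - ball v r \<union> path_image b"
  proof -
    have "{0..1} = {0..\<tau>} \<union> {\<tau>..1}" using \<tau> by auto
    then have "path_image b = b ` {0..\<tau>} \<union> b ` {\<tau>..1}" unfolding path_image_def by (simp add: image_Un)
    then show ?thesis unfolding S_def T_def by blast
  qed
  have gsub: "path_image g \<subseteq> ball v r - K - path_image b" using g(2) g0(2) unfolding ST by blast
  have "v \<in> path_image b" using start(2) by (metis pathstart_in_path_image)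
  then have "v \<notin> path_image g" using gsub by blast
  then have "path_image a \<inter> path_image c \<inter> path_image g = {}" unfolding ac by simp
  \<comment> \<open>The trimmed arc meets \<open>a\<close> and \<open>c\<close> in its ends only.
    Trimming is possible because the arc misses \<open>v\<close>, which lies on
    \<open>b\<close>.\<close>
  then obtain u w where uw: "0 \<le> u" "u < w" "w \<le> 1" "g u \<in> path_image a" "g w \<in> path_image c"
      "g ` {u..w} \<inter> path_image a = {g u}" "g ` {u..w} \<inter> path_image c = {g w}"
    using arc_trim[OF g(1) closed_arc_image[OF arcs(1)] xy(3)[folded g(3)] closed_arc_image[OF arcs(3)] xy(4)[folded g(4)]]
    by metis
  obtain s where s: "s \<in> {0..1}" "g u = a s" using uw(4) by (auto simp: path_image_def)
  obtain t where t: "t \<in> {0..1}" "g w = c t" using uw(5) by (auto simp: path_image_def)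
  have im: "g ` {u..w} \<subseteq> path_image g" using uw(1,3) by (auto simp: path_image_def)
  have "g u \<in> path_image g" "g w \<in> path_image g" using uw(1-3) by (auto simp: path_image_def)
  then have n: "g u \<noteq> v" "g w \<noteq> v" "g u \<notin> K" "g w \<notin> K" using gsub \<open>v \<in> path_image b\<close> by auto
  \<comment> \<open>Parameter 0 would give the point \<open>v\<close>, and parameter 1 a point of
    \<open>K\<close>.\<close>
  have "s \<noteq> 0" "t \<noteq> 0" using n(1,2) s t v0 by auto
  moreover have "s \<noteq> 1" "t \<noteq> 1" using n(3,4) s t K(3,4) by (auto simp: pathfinish_def)
  ultimately have "0 < s" "s < 1" "0 < t" "t < 1" using s t by auto
  moreover have "arc_between (g ` {u..w}) (a s) (c t)"
    using arc_between_subpath[OF g(1) uw(1-3)] s t by simp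
  moreover have "g ` {u..w} \<subseteq> ball v r - K - path_image b" using im gsub by (rule subset_trans)
  ultimately show thesis using uw(6,7) unfolding s(2) t(2) by (intro that[of s t "g ` {u..w}"])
qed

section \<open>Drawing a truncation from half edges\<close>

text \<open>
  The half \<open>h x\<close> of an edge runs from the point of the label \<open>f x\<close> to the middle of the edge,
  which it shares with \<open>h (m x)\<close>.
\<close>

definition half_arcs ::
    "'a pair_pre_digraph \<Rightarrow> ('a \<Rightarrow> nat) \<Rightarrow> ('a \<Rightarrow> 'a) \<Rightarrow> ('a \<Rightarrow> real \<Rightarrow> complex) \<Rightarrow> bool" where
  "half_arcs G f m h \<longleftrightarrow> (\<forall>x \<in> pverts G. arc (h x)) \<and>
     (\<forall>x \<in> pverts G. \<forall>y \<in> pverts G. \<forall>s \<in> {0..1}. \<forall>t \<in> {0..1}. h x s = h y t \<longleftrightarrow>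
        x = y \<and> s = t \<or> s = 0 \<and> t = 0 \<and> f x = f y \<or> s = 1 \<and> t = 1 \<and> y = m x)"

lemma finite_separation:
  fixes P :: "'b \<Rightarrow> complex"
  assumes "finite L" "inj_on P L"
  obtains r where "0 < r" "\<And>v w. v \<in> L \<Longrightarrow> w \<in> L \<Longrightarrow> v \<noteq> w \<Longrightarrow> ball (P v) r \<inter> ball (P w) r = {}"
proof -
  \<comment> \<open>The element 1 keeps \<open>D\<close> nonempty, so that its minimum is meaningful
    even for a single point.\<close>
  define D where "D = insert 1 ((\<lambda>(v, w). dist (P v) (P w)) ` {(v, w) \<in> L \<times> L. v \<noteq> w})"
  have "finite {(v, w) \<in> L \<times> L. v \<noteq> w}" using assms(1) by (auto intro: finite_subset[of _ "L \<times> L"])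
  then have fin: "finite D" by (simp add: D_def)
  have "\<forall>d \<in> D. 0 < d" using assms(2) by (auto simp: D_def dest: inj_onD)
  then have pos: "0 < Min D" using fin by (subst Min_gr_iff) (auto simp: D_def)
  have "ball (P v) (Min D / 2) \<inter> ball (P w) (Min D / 2) = {}" if "v \<in> L" "w \<in> L" "v \<noteq> w" for v w
  proof -
    have "dist (P v) (P w) \<in> D" using that by (force simp: D_def)
    then have "Min D \<le> dist (P v) (P w)" using fin by simp
    then show ?thesis by (intro disjoint_ballI) simp
  qed
  then show thesis using that[of "Min D / 2"] pos by simp
qed

text \<open>The corner of \<open>x\<close> is placed at parameter \<open>\<tau> x\<close> of its
  half, and \<open>g v\<close> is the side between the corners on the halves of \<open>a v\<close>
  and \<open>c v\<close>. The corner of \<open>b v\<close> is the common start of the three halves,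
  hence \<open>\<tau> (b v) = 0\<close>. Sides of different triangles stay apart because they lie in
  disjoint discs.\<close>

lemma truncation_corners:
  assumes G: "pair_graph G" and t: "truncation G f m" and ha: "half_arcs G f m h"
  obtains a b c :: "nat \<Rightarrow> 'a" and \<tau> :: "'a \<Rightarrow> real" and g :: "nat \<Rightarrow> complex set" where
    "\<And>v. v \<in> f ` pverts G \<Longrightarrow> {x \<in> pverts G. f x = v} = {a v, b v, c v} \<and> a v \<noteq> b v \<and> a v \<noteq> c v \<and> b v \<noteq> c v"
    "\<And>v. v \<in> f ` pverts G \<Longrightarrow> \<tau> (b v) = 0 \<and> 0 < \<tau> (a v) \<and> 0 < \<tau> (c v)"
    "\<And>x. x \<in> pverts G \<Longrightarrow> 0 \<le> \<tau> x \<and> \<tau> x < 1"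
    "\<And>v. v \<in> f ` pverts G \<Longrightarrow> arc_between (g v) (h (a v) (\<tau> (a v))) (h (c v) (\<tau> (c v)))"
    "\<And>v x s. v \<in> f ` pverts G \<Longrightarrow> x \<in> pverts G \<Longrightarrow> s \<in> {0..1} \<Longrightarrow> h x s \<in> g v \<Longrightarrow>
      (x = a v \<or> x = c v) \<and> s = \<tau> x"
    "\<And>v w. v \<in> f ` pverts G \<Longrightarrow> w \<in> f ` pverts G \<Longrightarrow> v \<noteq> w \<Longrightarrow> g v \<inter> g w = {}"
proof -
  let ?V = "pverts G"
  let ?L = "f ` ?V"
  have fin: "finite ?V" using pair_graphD(1)[OF G] .
  have arc: "arc (h x)" if "x \<in> ?V" for x using ha that by (simp add: half_arcs_def)
  have meet: "h x s = h y t \<longleftrightarrow> x = y \<and> s = t \<or> s = 0 \<and> t = 0 \<and> f x = f y \<or> s = 1 \<and> t = 1 \<and> y = m x"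
    if "x \<in> ?V" "y \<in> ?V" "s \<in> {0..1}" "t \<in> {0..1}" for x y s t
    using ha that unfolding half_arcs_def by blast
  have img: "path_image (h x) \<inter> path_image (h y) = {h x 0}" if xy: "x \<in> ?V" "y \<in> ?V" "x \<noteq> y" "f x = f y" for x y
  proof -
    have "y \<noteq> m x" using truncationD(3)[OF t xy(1)] xy(4) by auto
    then have "h x s = h y r \<Longrightarrow> s = 0" if "s \<in> {0..1}" "r \<in> {0..1}" for s r using meet[OF xy(1,2) that] xy(3) by blast
    then have sub: "path_image (h x) \<inter> path_image (h y) \<subseteq> {h x 0}" unfolding path_image_def by blast
    have "h x 0 = h y 0" using meet[OF xy(1,2), of 0 0] xy(4) by simp
    moreover have "h x 0 \<in> h x ` {0..1}" "h y 0 \<in> h y ` {0..1}" by simp_all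
    ultimately have "h x 0 \<in> path_image (h x) \<inter> path_image (h y)" unfolding path_image_def by simp
    with sub show ?thesis by blast
  qed
  define P where "P v = h (inv_into ?V f v) 0" for v
  have P: "h x 0 = P (f x)" if "x \<in> ?V" for x
  proof -
    have "f x \<in> ?L" using that by blast
    then have "inv_into ?V f (f x) \<in> ?V" "f (inv_into ?V f (f x)) = f x"
      by (simp_all add: inv_into_into f_inv_into_f)
    then show ?thesis using meet[OF that, of "inv_into ?V f (f x)" 0 0] unfolding P_def by simp
  qed
  have "inj_on P ?L"
  proof (rule inj_onI)
    fix v w assume "v \<in> ?L" "w \<in> ?L" "P v = P w"
    then obtain x y where "x \<in> ?V" "y \<in> ?V" "v = f x" "w = f y" "h x 0 = h y 0" using P by force
    then show "v = w" using meet[of x y 0 0] by auto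
  qed
  then obtain r where r: "0 < r" "\<And>v w. v \<in> ?L \<Longrightarrow> w \<in> ?L \<Longrightarrow> v \<noteq> w \<Longrightarrow> ball (P v) r \<inter> ball (P w) r = {}"
    using finite_separation[of ?L P] fin by (metis finite_imageI)
  have "\<forall>v \<in> ?L. \<exists>abc. {x \<in> ?V. f x = v} = {fst abc, fst (snd abc), snd (snd abc)} \<and> fst abc \<noteq> fst (snd abc) \<and>
      fst abc \<noteq> snd (snd abc) \<and> fst (snd abc) \<noteq> snd (snd abc)"
  proof
    fix v assume "v \<in> ?L"
    then obtain x where x: "x \<in> ?V" "v = f x" by blast
    obtain y z where yz: "{w \<in> ?V. f w = f x} = {x, y, z}" "x \<noteq> y" "x \<noteq> z" "y \<noteq> z"
      by (rule truncation_class[OF t x(1)])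
    then show "\<exists>abc. {x \<in> ?V. f x = v} = {fst abc, fst (snd abc), snd (snd abc)} \<and> fst abc \<noteq> fst (snd abc) \<and>
      fst abc \<noteq> snd (snd abc) \<and> fst (snd abc) \<noteq> snd (snd abc)"
      unfolding x(2) by (intro exI[of _ "(x, y, z)"]) simp
  qed
  from bchoice[OF this] obtain abc where abc: "\<forall>v \<in> ?L. {x \<in> ?V. f x = v} = {fst (abc v), fst (snd (abc v)), snd (snd (abc v))} \<and>
      fst (abc v) \<noteq> fst (snd (abc v)) \<and> fst (abc v) \<noteq> snd (snd (abc v)) \<and> fst (snd (abc v)) \<noteq> snd (snd (abc v))"
    by (rule exE)
  define a where "a v = fst (abc v)" for v
  define b where "b v = fst (snd (abc v))" for v
  define c where "c v = snd (snd (abc v))" for v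
  have cls: "{x \<in> ?V. f x = v} = {a v, b v, c v}" "a v \<noteq> b v" "a v \<noteq> c v" "b v \<noteq> c v" if "v \<in> ?L" for v
    using bspec[OF abc that] by (simp_all add: a_def b_def c_def)
  have mem: "a v \<in> ?V" "b v \<in> ?V" "c v \<in> ?V" "f (a v) = v" "f (b v) = v" "f (c v) = v" if "v \<in> ?L" for v
    using cls(1)[OF that] by blast+
  have cls_cases: "x = a v \<or> x = b v \<or> x = c v" if "x \<in> ?V" "f x = v" for x v
    using cls(1)[of v] that by blast
  \<comment> \<open>The halves that start at other labels; the new side at \<open>v\<close> has to
    avoid them.\<close>
  define K where "K v = (\<Union>x \<in> {x \<in> ?V. f x \<noteq> v}. path_image (h x))" for v
  have K: "z \<in> K v \<longleftrightarrow> (\<exists>x \<in> ?V. f x \<noteq> v \<and> (\<exists>s \<in> {0..1}. z = h x s))" for z v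
    by (auto simp: K_def path_image_def)
  have "\<exists>X s t. 0 < s \<and> s < 1 \<and> 0 < t \<and> t < 1 \<and> arc_between X (h (a v) s) (h (c v) t) \<and>
      X \<subseteq> ball (P v) r - K v - path_image (h (b v)) \<and> X \<inter> path_image (h (a v)) = {h (a v) s} \<and>
      X \<inter> path_image (h (c v)) = {h (c v) t}" if v: "v \<in> ?L" for v
  proof -
    note cl = cls[OF v] and me = mem[OF v]
    have st: "h x 0 = P v" if "x \<in> {a v, b v, c v}" for x using P me that by auto
    \<comment> \<open>The middle of an edge also lies on the half of \<open>m x\<close>, which
      starts at another label.\<close>
    have fin1: "pathfinish (h x) \<in> K v" if "x \<in> {a v, c v}" for x
    proof -
      have x: "x \<in> ?V" "f x = v" using that me by auto
      then have "h x 1 = h (m x) 1" using meet[of x "m x" 1 1] truncationD(1)[OF t x(1)] by simp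
      then show ?thesis using truncationD(1,3)[OF t x(1)] x(2) unfolding K pathfinish_def by force
    qed
    have "closed (K v)" unfolding K_def using fin arc by (intro closed_UN) (auto intro: closed_arc_image)
    moreover have "P v \<notin> K v"
    proof
      assume "P v \<in> K v"
      then obtain x s where x: "x \<in> ?V" "f x \<noteq> v" "s \<in> {0..1}" "h (a v) 0 = h x s" using st[of "a v"] unfolding K by auto
      then show False using meet[OF me(1) x(1), of 0 s] me(4) by auto
    qed
    moreover have "path_image (h (b v)) \<inter> K v \<subseteq> {pathfinish (h (b v))}"
    proof
      fix z assume "z \<in> path_image (h (b v)) \<inter> K v"
      then have z: "z \<in> h (b v) ` {0..1}" "z \<in> K v" by (auto simp: path_image_def)
      then obtain u where u: "u \<in> {0..1}" "z = h (b v) u" by blast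
      from z(2) obtain x s where "x \<in> ?V" "f x \<noteq> v" "s \<in> {0..1}" "z = h x s" unfolding K by blast
      note x = u this
      then have "u = 1" using meet[OF me(2) x(3,1,5)] me(5) by auto
      then show "z \<in> {pathfinish (h (b v))}" using x(2) by (simp add: pathfinish_def)
    qed
    moreover have "pathfinish (h (a v)) \<in> K v" "pathfinish (h (c v)) \<in> K v" using fin1 by auto
    moreover have "path_image (h (a v)) \<inter> path_image (h (b v)) = {P v}" "path_image (h (a v)) \<inter> path_image (h (c v)) = {P v}"
      "path_image (h (b v)) \<inter> path_image (h (c v)) = {P v}"
      using img[of "a v" "b v"] img[of "a v" "c v"] img[of "b v" "c v"] me cl(2-4) st by auto
    moreover have "pathstart (h (a v)) = P v" "pathstart (h (b v)) = P v" "pathstart (h (c v)) = P v"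
      using st by (auto simp: pathstart_def)
    ultimately show ?thesis
      using corner_arc[OF arc[OF me(1)] arc[OF me(2)] arc[OF me(3)], of "P v" "K v" r] r(1) by metis
  qed
  then obtain X s1 t1 where X: "\<And>v. v \<in> ?L \<Longrightarrow> 0 < s1 v \<and> s1 v < 1 \<and> 0 < t1 v \<and> t1 v < 1 \<and>
      arc_between (X v) (h (a v) (s1 v)) (h (c v) (t1 v)) \<and>
      X v \<subseteq> ball (P v) r - K v - path_image (h (b v)) \<and> X v \<inter> path_image (h (a v)) = {h (a v) (s1 v)} \<and>
      X v \<inter> path_image (h (c v)) = {h (c v) (t1 v)}" by metis
  define \<tau> where "\<tau> x = (if x = a (f x) then s1 (f x) else if x = c (f x) then t1 (f x) else (0::real))" for x
  have \<tau>: "\<tau> (a v) = s1 v" "\<tau> (c v) = t1 v" "\<tau> (b v) = 0" if "v \<in> ?L" for v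
    using mem[OF that] cls[OF that] by (auto simp: \<tau>_def)
  show thesis
  proof (rule that[of a b c \<tau> X])
    fix v assume v: "v \<in> ?L"
    show "{x \<in> ?V. f x = v} = {a v, b v, c v} \<and> a v \<noteq> b v \<and> a v \<noteq> c v \<and> b v \<noteq> c v" using cls[OF v] by simp
    show "\<tau> (b v) = 0 \<and> 0 < \<tau> (a v) \<and> 0 < \<tau> (c v)" using \<tau>[OF v] X[OF v] by simp
    show "arc_between (X v) (h (a v) (\<tau> (a v))) (h (c v) (\<tau> (c v)))" using \<tau>[OF v] X[OF v] by simp
  next
    fix x assume x: "x \<in> ?V"
    then show "0 \<le> \<tau> x \<and> \<tau> x < 1" using X[of "f x"] by (simp add: \<tau>_def less_imp_le)
  next
    fix v x s assume v: "v \<in> ?L" and x: "x \<in> ?V" and s: "s \<in> {0..1}" and hx: "h x s \<in> X v"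
    note Xv = X[OF v]
    have "h x s \<notin> K v" "h x s \<notin> path_image (h (b v))" using hx Xv by blast+
    moreover have "h x s \<in> path_image (h x)" using s by (simp add: path_image_def)
    ultimately have "f x = v" "x \<noteq> b v" using x s K by blast+
    then have ac: "x = a v \<or> x = c v" using cls_cases[OF x] by blast
    then show "(x = a v \<or> x = c v) \<and> s = \<tau> x"
    proof
      assume xa: "x = a v"
      have "h x s \<in> path_image (h (a v))" using xa s by (auto simp: path_image_def)
      then have "h x s = h x (s1 v)" using hx Xv xa by blast
      then show ?thesis using meet[OF x x s, of "s1 v"] Xv truncationD(4)[OF t x] \<tau>[OF v] xa by auto
    next
      assume xc: "x = c v"
      have "h x s \<in> path_image (h (c v))" using xc s by (auto simp: path_image_def)
      then have "h x s = h x (t1 v)" using hx Xv xc by blast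
      then show ?thesis using meet[OF x x s, of "t1 v"] Xv truncationD(4)[OF t x] \<tau>[OF v] xc by auto
    qed
  next
    fix v w assume "v \<in> ?L" "w \<in> ?L" "v \<noteq> w"
    then show "X v \<inter> X w = {}" using r(2)[of v w] X[of v] X[of w] by blast
  qed
qed

lemma uedges_truncation:
  assumes t: "truncation G f m" and e: "e \<in> uedges G"
  obtains x y where "e = {x, y}" "x \<in> pverts G" "y \<in> pverts G" "x \<noteq> y" "f x = f y \<or> y = m x"
proof -
  obtain x y where "e = {x, y}" "(x, y) \<in> parcs G" using e by (auto simp: uedges_def)
  then show thesis using that truncation_arcs[OF t] by metis
qed

text \<open>\<open>M\<close> draws an edge between partners by the rests of its two halves beyond
  the corners, \<open>S\<close> draws a side at \<open>b v\<close> by an initial piece of a half,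
  and \<open>T\<close> draws the remaining side by \<open>g v\<close>.\<close>

lemma planar_of_half_arcs:
  assumes G: "pair_graph G" and t: "truncation G f m" and ha: "half_arcs G f m h"
  shows "planar G"
proof -
  let ?V = "pverts G" and ?L = "f ` pverts G"
  note td = truncationD[OF t]
  obtain a b c :: "nat \<Rightarrow> 'a" and \<tau> :: "'a \<Rightarrow> real" and g :: "nat \<Rightarrow> complex set" where
    cls: "\<And>v. v \<in> ?L \<Longrightarrow> {x \<in> ?V. f x = v} = {a v, b v, c v} \<and> a v \<noteq> b v \<and> a v \<noteq> c v \<and> b v \<noteq> c v"
    and \<tau>: "\<And>v. v \<in> ?L \<Longrightarrow> \<tau> (b v) = 0 \<and> 0 < \<tau> (a v) \<and> 0 < \<tau> (c v)"
    and \<tau>1: "\<And>x. x \<in> ?V \<Longrightarrow> 0 \<le> \<tau> x \<and> \<tau> x < 1"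
    and garc: "\<And>v. v \<in> ?L \<Longrightarrow> arc_between (g v) (h (a v) (\<tau> (a v))) (h (c v) (\<tau> (c v)))"
    and gmeet: "\<And>v x s. v \<in> ?L \<Longrightarrow> x \<in> ?V \<Longrightarrow> s \<in> {0..1} \<Longrightarrow> h x s \<in> g v \<Longrightarrow> (x = a v \<or> x = c v) \<and> s = \<tau> x"
    and gdisj: "\<And>v w. v \<in> ?L \<Longrightarrow> w \<in> ?L \<Longrightarrow> v \<noteq> w \<Longrightarrow> g v \<inter> g w = {}"
    by (rule truncation_corners[OF G t ha]) (rule that)
  have arc: "arc (h x)" if "x \<in> ?V" for x using ha that by (simp add: half_arcs_def)
  have meet: "h x s = h y t \<longleftrightarrow> x = y \<and> s = t \<or> s = 0 \<and> t = 0 \<and> f x = f y \<or> s = 1 \<and> t = 1 \<and> y = m x"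
    if "x \<in> ?V" "y \<in> ?V" "s \<in> {0..1}" "t \<in> {0..1}" for x y s t
    using ha that unfolding half_arcs_def by blast
  have mem: "a v \<in> ?V" "b v \<in> ?V" "c v \<in> ?V" "f (a v) = v" "f (b v) = v" "f (c v) = v" if "v \<in> ?L" for v
    using cls[OF that] by blast+
  have abc: "x = a (f x) \<or> x = b (f x) \<or> x = c (f x)" if "x \<in> ?V" for x
    using cls[of "f x"] that by blast
  \<comment> \<open>Each label has a single corner with parameter 0. This keeps the points
    \<open>p x\<close> distinct although the three halves start together.\<close>
  have \<tau>0: "\<tau> x = 0 \<longleftrightarrow> x = b (f x)" if "x \<in> ?V" for x
    using abc[OF that] \<tau>[of "f x"] that by (metis imageI less_irrefl)
  have \<tau>in: "\<tau> x \<in> {0..1}" if "x \<in> ?V" for x using \<tau>1[OF that] by simp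
  define p where "p x = h x (\<tau> x)" for x
  define M where "M e = (\<Union>x \<in> {x \<in> e. m x \<in> e}. h x ` {\<tau> x..1})" for e
  define S where "S e = (\<Union>x \<in> {x \<in> e. b (f x) \<in> e \<and> x \<noteq> b (f x)}. h x ` {0..\<tau> x})" for e
  define T where "T e = (\<Union>v \<in> {v \<in> ?L. e = {a v, c v}}. g v)" for e
  \<comment> \<open>For every edge just one of the three sets is nonempty, so the union stands for a
    case distinction.\<close>
  define I where "I e = M e \<union> S e \<union> T e" for e
  have eV: "e \<subseteq> ?V" if "e \<in> uedges G" for e using uedgesD(2)[OF G that] .
  have e2: "card e = 2" if "e \<in> uedges G" for e using uedgesD(1)[OF G that] .
  have pair: "e = {x, y}" if "e \<in> uedges G" "x \<in> e" "y \<in> e" "x \<noteq> y" for e x y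
  proof -
    have "0 < card e" using e2[OF that(1)] by simp
    then have "finite e" by (rule card_ge_0_finite)
    moreover have "card {x, y} = card e" using e2[OF that(1)] that(4) by simp
    ultimately show ?thesis using card_subset_eq[of e "{x, y}"] that(2,3) by simp
  qed
  have M: "z \<in> M e \<longleftrightarrow> (\<exists>x s. x \<in> e \<and> e = {x, m x} \<and> \<tau> x \<le> s \<and> s \<le> 1 \<and> z = h x s)" if e: "e \<in> uedges G" for e z
  proof -
    have "m x \<in> e \<longleftrightarrow> e = {x, m x}" if "x \<in> e" for x
    proof
      assume "m x \<in> e"
      moreover have "x \<noteq> m x" using td(4)[of x] eV[OF e] that by auto
      ultimately show "e = {x, m x}" by (rule pair[OF e that])
    qed blast
    then have "M e = (\<Union>x \<in> {x \<in> e. e = {x, m x}}. h x ` {\<tau> x..1})" unfolding M_def by blast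
    then have "z \<in> M e \<longleftrightarrow> (\<exists>x \<in> {x \<in> e. e = {x, m x}}. \<exists>s \<in> {\<tau> x..1}. z = h x s)"
      by (simp only: UN_iff image_iff)
    then show ?thesis unfolding Bex_def mem_Collect_eq atLeastAtMost_iff by (simp add: conj_assoc ex_simps[symmetric] del: ex_simps)
  qed
  have S: "z \<in> S e \<longleftrightarrow> (\<exists>x s. x \<in> e \<and> e = {x, b (f x)} \<and> x \<noteq> b (f x) \<and> 0 \<le> s \<and> s \<le> \<tau> x \<and> z = h x s)" if e: "e \<in> uedges G" for e z
  proof -
    have "b (f x) \<in> e \<longleftrightarrow> e = {x, b (f x)}" if "x \<in> e" "x \<noteq> b (f x)" for x
      using pair[OF e that(1), of "b (f x)"] that by blast
    then have "{x \<in> e. b (f x) \<in> e \<and> x \<noteq> b (f x)} = {x \<in> e. e = {x, b (f x)} \<and> x \<noteq> b (f x)}" by blast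
    then have "S e = (\<Union>x \<in> {x \<in> e. e = {x, b (f x)} \<and> x \<noteq> b (f x)}. h x ` {0..\<tau> x})" unfolding S_def by (rule arg_cong)
    then have "z \<in> S e \<longleftrightarrow> (\<exists>x \<in> {x \<in> e. e = {x, b (f x)} \<and> x \<noteq> b (f x)}. \<exists>s \<in> {0..\<tau> x}. z = h x s)"
      by (simp only: UN_iff image_iff)
    then show ?thesis unfolding Bex_def mem_Collect_eq atLeastAtMost_iff by (simp add: conj_assoc ex_simps[symmetric] del: ex_simps)
  qed
  have T: "z \<in> T e \<longleftrightarrow> (\<exists>v \<in> ?L. e = {a v, c v} \<and> z \<in> g v)" for e z by (auto simp: T_def)
  have kinds: "(\<exists>x \<in> ?V. e = {x, m x}) \<or> (\<exists>x \<in> ?V. e = {x, b (f x)} \<and> x \<noteq> b (f x)) \<or> (\<exists>v \<in> ?L. e = {a v, c v})"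
    if e: "e \<in> uedges G" for e
  proof -
    obtain x y where xy: "e = {x, y}" "x \<in> ?V" "y \<in> ?V" "x \<noteq> y" "f x = f y \<or> y = m x"
      by (rule uedges_truncation[OF t e])
    from xy(5) show ?thesis
    proof
      assume fxy: "f x = f y"
      consider "x = b (f x)" | "y = b (f x)" | "x \<noteq> b (f x)" "y \<noteq> b (f x)" by blast
      then show ?thesis
      proof cases
        case 1
        then have "e = {y, b (f y)} \<and> y \<noteq> b (f y)" using xy fxy by auto
        then show ?thesis using xy(3) by blast
      next
        case 2
        then have "e = {x, b (f x)} \<and> x \<noteq> b (f x)" using xy by auto
        then show ?thesis using xy(2) by blast
      next
        case 3
        then have "e = {a (f x), c (f x)}" using abc[OF xy(2)] abc[OF xy(3)] xy(1,4) fxy by auto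
        then show ?thesis using xy(2) by blast
      qed
    qed (use xy in blast)
  qed
  have pI: "p x \<in> I e" if e: "e \<in> uedges G" and x: "x \<in> e" for e x
  proof -
    have xV: "x \<in> ?V" using x eV[OF e] by blast
    note t1 = \<tau>1[OF xV]
    from kinds[OF e] show ?thesis
    proof (elim disjE bexE conjE)
      fix y assume y: "y \<in> ?V" "e = {y, m y}"
      have "e = {x, m x}" using x y td(2)[OF y(1)] by auto
      then have "p x \<in> M e" unfolding M[OF e] p_def using x t1 by (intro exI[of _ x] exI[of _ "\<tau> x"]) auto
      then show ?thesis by (simp add: I_def)
    next
      fix y assume y: "y \<in> ?V" "e = {y, b (f y)}" "y \<noteq> b (f y)"
      have fy: "f (b (f y)) = f y" using mem(5)[of "f y"] y(1) by blast
      have "p x \<in> S e"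
      proof (cases "x = y")
        case True
        then show ?thesis unfolding S[OF e] p_def using x y t1 by (intro exI[of _ x] exI[of _ "\<tau> x"]) simp
      next
        case False
        then have xb: "x = b (f y)" using x y by blast
        then have "\<tau> x = 0" using \<tau>0[OF xV] fy by simp
        then have "p x = h y 0" unfolding p_def using meet[OF xV y(1), of 0 0] xb fy by simp
        then show ?thesis unfolding S[OF e] using y \<tau>1[OF y(1)] by (intro exI[of _ y] exI[of _ 0]) simp
      qed
      then show ?thesis by (simp add: I_def)
    next
      fix v assume v: "v \<in> ?L" "e = {a v, c v}"
      have "p x \<in> g v"
        using garc[OF v(1)] x v(2) unfolding arc_between_def p_def
        by (metis insertE pathfinish_in_path_image pathstart_in_path_image singletonD)
      then have "p x \<in> T e" unfolding T using v by blast
      then show ?thesis by (simp add: I_def)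
    qed
  qed
  have p_inj: "inj_on p ?V"
  proof (rule inj_onI)
    fix x y assume xy: "x \<in> ?V" "y \<in> ?V" "p x = p y"
    then have "x = y \<or> \<tau> x = 0 \<and> \<tau> y = 0 \<and> f x = f y"
      using meet[OF xy(1,2) \<tau>in[OF xy(1)] \<tau>in[OF xy(2)]] \<tau>1[OF xy(1)] unfolding p_def by auto
    then show "x = y" using \<tau>0 xy(1,2) by metis
  qed
  have onV: "y \<in> e" if e: "e \<in> uedges G" and y: "y \<in> ?V" and yI: "p y \<in> I e" for e y
  proof -
    note ty = \<tau>1[OF y] and tin = \<tau>in[OF y]
    from yI consider "p y \<in> M e" | "p y \<in> S e" | "p y \<in> T e" unfolding I_def by blast
    then show ?thesis
    proof cases
      case 1
      then obtain x s where x: "x \<in> e" "\<tau> x \<le> s" "s \<le> 1" "h y (\<tau> y) = h x s" unfolding M[OF e] p_def by blast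
      have xV: "x \<in> ?V" using x(1) eV[OF e] by blast
      have "s \<in> {0..1}" using x \<tau>1[OF xV] by simp
      then have "y = x \<or> \<tau> y = 0 \<and> s = 0 \<and> f y = f x" using meet[OF y xV tin] x(4) ty by auto
      moreover have "x = y" if "\<tau> y = 0" "s = 0" "f y = f x"
      proof -
        have "\<tau> x = 0" using x(2) that(2) \<tau>1[OF xV] by simp
        then show ?thesis using \<tau>0[OF xV] \<tau>0[OF y] that by simp
      qed
      ultimately show ?thesis using x(1) by blast
    next
      case 2
      then obtain x s where x: "x \<in> e" "e = {x, b (f x)}" "0 \<le> s" "s \<le> \<tau> x" "h y (\<tau> y) = h x s"
        unfolding S[OF e] p_def by blast
      have xV: "x \<in> ?V" using x(1) eV[OF e] by blast
      have "s \<in> {0..1}" using x \<tau>1[OF xV] by simp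
      then have "y = x \<or> \<tau> y = 0 \<and> f y = f x" using meet[OF y xV tin] x(5) ty by auto
      then show ?thesis using x(1,2) \<tau>0[OF y] by auto
    next
      case 3
      then obtain v where "v \<in> ?L" "e = {a v, c v}" "h y (\<tau> y) \<in> g v" unfolding T p_def by blast
      then show ?thesis using gmeet[OF _ y tin] by blast
    qed
  qed
  show ?thesis
  proof (rule planarI[OF p_inj, of I])
    fix e assume e: "e \<in> uedges G"
    show "I e \<inter> p ` ?V = p ` e" using onV[OF e] pI[OF e] eV[OF e] by blast
    from kinds[OF e] show "\<exists>u w. e = {u, w} \<and> arc_between (I e) (p u) (p w)"
    proof (elim disjE bexE conjE)
      fix x assume x: "x \<in> ?V" "e = {x, m x}"
      note mx = td[OF x(1)]
      have M': "M e = h x ` {\<tau> x..1} \<union> h (m x) ` {\<tau> (m x)..1}"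
      proof -
        have "{y \<in> e. m y \<in> e} = {x, m x}" using x mx by auto
        then show ?thesis by (simp add: M_def)
      qed
      have emp: "{y \<in> e. b (f y) \<in> e \<and> y \<noteq> b (f y)} = {}"
      proof -
        have "f (b (f x)) = f x" "f (b (f (m x))) = f (m x)" using mem(5) x(1) mx(1) by blast+
        then show ?thesis using x(2) mx(3) by auto
      qed
      have S': "S e = {}" unfolding S_def emp by simp
      have "e \<noteq> {a v, c v}" if "v \<in> ?L" for v using mem(4,6)[OF that] mx(3) x(2) by (auto simp: doubleton_eq_iff)
      then have T': "T e = {}" by (auto simp: T_def)
      have end_eq: "h x 1 = h (m x) 1" using meet[OF x(1) mx(1), of 1 1] by simp
      have "arc_between (h x ` {\<tau> x..1}) (p x) (h x 1)"
        unfolding p_def using arc_between_subpath[OF arc[OF x(1)], of "\<tau> x" 1] \<tau>1[OF x(1)] by simp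
      moreover have "arc_between (h (m x) ` {\<tau> (m x)..1}) (h x 1) (p (m x))"
        unfolding p_def end_eq using arc_between_sym[OF arc_between_subpath[OF arc[OF mx(1)], of "\<tau> (m x)" 1]] \<tau>1[OF mx(1)] by simp
      moreover have "h x ` {\<tau> x..1} \<inter> h (m x) ` {\<tau> (m x)..1} \<subseteq> {h x 1}"
      proof
        fix z assume "z \<in> h x ` {\<tau> x..1} \<inter> h (m x) ` {\<tau> (m x)..1}"
        then obtain s r where sr: "s \<in> {\<tau> x..1}" "r \<in> {\<tau> (m x)..1}" "z = h x s" "h x s = h (m x) r" by auto
        have "s \<in> {0..1}" "r \<in> {0..1}" using sr(1,2) \<tau>1[OF x(1)] \<tau>1[OF mx(1)] by auto
        then have "s = 1" using meet[OF x(1) mx(1)] sr(4) mx(3,4) by metis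
        then show "z \<in> {h x 1}" using sr(3) by simp
      qed
      ultimately have "arc_between (I e) (p x) (p (m x))"
        unfolding I_def M' S' T' using arc_between_join by (metis sup_bot_right)
      then show ?thesis using x(2) by blast
    next
      fix x assume x: "x \<in> ?V" "e = {x, b (f x)}" "x \<noteq> b (f x)"
      have fL: "f x \<in> ?L" using x(1) by blast
      note bx = mem(2,5)[OF fL]
      have emp: "{y \<in> e. m y \<in> e} = {}" using x(2) td(3,4)[OF x(1)] td(3,4)[OF bx(1)] bx(2) by auto
      have M': "M e = {}" unfolding M_def emp by simp
      have "{y \<in> e. b (f y) \<in> e \<and> y \<noteq> b (f y)} = {x}" using x bx by auto
      then have S': "S e = h x ` {0..\<tau> x}" by (simp add: S_def)
      have "e \<noteq> {a v, c v}" if "v \<in> ?L" for v using mem(4,6)[OF that] cls[OF that] x(2,3) by (auto simp: doubleton_eq_iff)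
      then have T': "T e = {}" by (auto simp: T_def)
      have "\<tau> x \<noteq> 0" using \<tau>0[OF x(1)] x(3) by simp
      then have "arc_between (h x ` {0..\<tau> x}) (h x 0) (p x)"
        unfolding p_def using arc_between_subpath[OF arc[OF x(1)], of 0 "\<tau> x"] \<tau>1[OF x(1)] by simp
      moreover have "h x 0 = p (b (f x))"
        unfolding p_def using meet[OF x(1) bx(1), of 0 0] \<tau>[OF fL] bx(2) by simp
      ultimately have "arc_between (I e) (p x) (p (b (f x)))"
        unfolding I_def M' S' T' by (simp add: arc_between_sym)
      then show ?thesis using x(2) by blast
    next
      fix v assume v: "v \<in> ?L" "e = {a v, c v}"
      note mv = mem[OF v(1)]
      have emp: "{y \<in> e. m y \<in> e} = {}" using v(2) td(3,4)[OF mv(1)] td(3,4)[OF mv(3)] mv(4,6) by auto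
      have M': "M e = {}" unfolding M_def emp by simp
      have emp': "{y \<in> e. b (f y) \<in> e \<and> y \<noteq> b (f y)} = {}" using v(2) mv cls[OF v(1)] by auto
      have S': "S e = {}" unfolding S_def emp' by simp
      have "{w \<in> ?L. e = {a w, c w}} = {v}"
      proof -
        have "w = v" if "w \<in> ?L" "e = {a w, c w}" for w
          using mem(4,6)[OF that(1)] mv(4,6) that(2) v(2) by (metis doubleton_eq_iff)
        then show ?thesis using v by blast
      qed
      then have T': "T e = g v" by (simp add: T_def)
      show ?thesis unfolding I_def M' S' T' using garc[OF v(1)] v(2) by (auto simp: p_def)
    qed
  next
    \<comment> \<open>Up to exchanging the two edges there are six combinations of kinds.\<close>
    have half: "z \<in> p ` (e \<inter> e')"
      if e: "e \<in> uedges G" "e' \<in> uedges G" "e \<noteq> e'" and z: "z \<in> M e \<and> z \<in> I e' \<or> z \<in> S e \<and> z \<in> S e' \<union> T e' \<or> z \<in> T e \<and> z \<in> T e'"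
      for e e' z
    proof -
      from z consider "z \<in> M e" "z \<in> M e'" | "z \<in> M e" "z \<in> S e'" | "z \<in> M e" "z \<in> T e'" | "z \<in> S e" "z \<in> S e'"
        | "z \<in> S e" "z \<in> T e'" | "z \<in> T e" "z \<in> T e'" unfolding I_def by blast
      then show ?thesis
      proof cases
        case 1
        then obtain x s y r where x: "x \<in> e" "e = {x, m x}" "\<tau> x \<le> s" "s \<le> 1" "z = h x s"
          and y: "y \<in> e'" "e' = {y, m y}" "\<tau> y \<le> r" "r \<le> 1" "z = h y r"
          unfolding M[OF e(1)] M[OF e(2)] by blast
        have V: "x \<in> ?V" "y \<in> ?V" using x(1) y(1) eV e by blast+
        have sr: "s \<in> {0..1}" "r \<in> {0..1}" using x y \<tau>1[OF V(1)] \<tau>1[OF V(2)] by auto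
        have "x = y \<or> y = m x"
        proof -
          have "x = y" if "s = 0" "r = 0" "f x = f y"
          proof -
            have "\<tau> x = 0" "\<tau> y = 0" using that x(3) y(3) \<tau>1[OF V(1)] \<tau>1[OF V(2)] by auto
            then show ?thesis using \<tau>0[OF V(1)] \<tau>0[OF V(2)] that(3) by simp
          qed
          then show ?thesis using meet[OF V sr] x(5) y(5) by auto
        qed
        then have "e = e'" using x(2) y(2) td(2)[OF V(1)] by (auto simp: insert_commute)
        then show ?thesis using e(3) by blast
      next
        case 2
        then obtain x s y r where x: "x \<in> e" "\<tau> x \<le> s" "s \<le> 1" "z = h x s"
          and y: "y \<in> e'" "e' = {y, b (f y)}" "0 \<le> r" "r \<le> \<tau> y" "z = h y r"
          unfolding M[OF e(1)] S[OF e(2)] by blast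
        have V: "x \<in> ?V" "y \<in> ?V" using x(1) y(1) eV e by blast+
        have sr: "s \<in> {0..1}" "r \<in> {0..1}" "r < 1" using x y \<tau>1[OF V(1)] \<tau>1[OF V(2)] by auto
        have "x = y \<and> s = r \<or> s = 0 \<and> f x = f y" using meet[OF V sr(1,2)] x(4) y(5) sr(3) by auto
        then have "x \<in> e' \<and> s = \<tau> x"
        proof
          assume "x = y \<and> s = r"
          then show ?thesis using x y by auto
        next
          assume s: "s = 0 \<and> f x = f y"
          then have "\<tau> x = 0" using x(2) \<tau>1[OF V(1)] by simp
          then show ?thesis using \<tau>0[OF V(1)] s y(2) by simp
        qed
        then show ?thesis using x(1,4) by (auto simp: p_def)
      next
        case 3
        then obtain x s v where x: "x \<in> e" "\<tau> x \<le> s" "s \<le> 1" "z = h x s" and v: "v \<in> ?L" "e' = {a v, c v}" "z \<in> g v"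
          unfolding M[OF e(1)] T by blast
        have V: "x \<in> ?V" using x(1) eV e by blast
        have "s \<in> {0..1}" using x \<tau>1[OF V] by auto
        then have "x \<in> e' \<and> s = \<tau> x" using gmeet[OF v(1) V] v(2,3) x(4) by blast
        then show ?thesis using x(1,4) by (auto simp: p_def)
      next
        case 4
        then obtain x s y r where x: "x \<in> e" "e = {x, b (f x)}" "0 \<le> s" "s \<le> \<tau> x" "z = h x s"
          and y: "y \<in> e'" "e' = {y, b (f y)}" "0 \<le> r" "r \<le> \<tau> y" "z = h y r"
          unfolding S[OF e(1)] S[OF e(2)] by blast
        have V: "x \<in> ?V" "y \<in> ?V" using x(1) y(1) eV e by blast+
        have sr: "s \<in> {0..1}" "r \<in> {0..1}" "r < 1" using x y \<tau>1[OF V(1)] \<tau>1[OF V(2)] by auto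
        have "x \<noteq> y" using x(2) y(2) e(3) by auto
        then have s: "s = 0" "f x = f y" using meet[OF V sr(1,2)] x(5) y(5) sr(3) by auto
        have fL: "f x \<in> ?L" using V by blast
        note bx = mem(2,5)[OF fL]
        have "z = p (b (f x))" unfolding p_def x(5) s(1) using meet[OF V(1) bx(1), of 0 0] \<tau>[OF fL] bx(2) by simp
        moreover have "b (f x) \<in> e \<inter> e'" using x(2) y(2) s(2) by auto
        ultimately show ?thesis by blast
      next
        case 5
        then obtain x s v where x: "x \<in> e" "0 \<le> s" "s \<le> \<tau> x" "z = h x s" and v: "v \<in> ?L" "e' = {a v, c v}" "z \<in> g v"
          unfolding S[OF e(1)] T by blast
        have V: "x \<in> ?V" using x(1) eV e by blast
        have "s \<in> {0..1}" using x \<tau>1[OF V] by auto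
        then have "x \<in> e' \<and> s = \<tau> x" using gmeet[OF v(1) V] v(2,3) x(4) by blast
        then show ?thesis using x(1,4) by (auto simp: p_def)
      next
        case 6
        then obtain v w where "v \<in> ?L" "w \<in> ?L" "e = {a v, c v}" "e' = {a w, c w}" "z \<in> g v \<inter> g w" unfolding T by blast
        then show ?thesis using gdisj[of v w] e(3) by blast
      qed
    qed
    fix e e' assume e: "e \<in> uedges G" "e' \<in> uedges G" "e \<noteq> e'"
    show "I e \<inter> I e' = p ` (e \<inter> e')"
    proof
      show "p ` (e \<inter> e') \<subseteq> I e \<inter> I e'" using pI[OF e(1)] pI[OF e(2)] by blast
      show "I e \<inter> I e' \<subseteq> p ` (e \<inter> e')"
      proof
        fix z assume z: "z \<in> I e \<inter> I e'"
        then have "(z \<in> M e \<and> z \<in> I e' \<or> z \<in> S e \<and> z \<in> S e' \<union> T e' \<or> z \<in> T e \<and> z \<in> T e') \<or>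
          (z \<in> M e' \<and> z \<in> I e \<or> z \<in> S e' \<and> z \<in> S e \<union> T e \<or> z \<in> T e' \<and> z \<in> T e)"
          unfolding I_def by blast
        then show "z \<in> p ` (e \<inter> e')"
          using half[OF e] half[OF e(2,1) e(3)[symmetric]] by (metis Int_commute)
      qed
    qed
  qed
qed

section \<open>Planarity of the truncation\<close>

text \<open>The theta multigraph is drawn by segments: its two vertices lie on the imaginary axis at
  heights 1 and -1, and the middles of its three edges are distinct points \<open>k x\<close> of the
  real axis.\<close>

lemma two_classes_planar:
  assumes G: "pair_graph G" and t: "truncation G f m" and two: "card (f ` pverts G) = 2"
  shows "planar G"
proof -
  let ?V = "pverts G"
  note td = truncationD[OF t]
  obtain u v \<rho> where uv: "f ` ?V = {u, v}" "u \<noteq> v" and c3: "card {y \<in> ?V. f y = u} = 3"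
    and \<rho>: "\<And>x. x \<in> ?V \<Longrightarrow> \<rho> x \<in> ?V \<and> f (\<rho> x) = u \<and> \<rho> x = (if f x = u then x else m x)"
    and cls: "\<And>x. x \<in> ?V \<Longrightarrow> f x = u \<or> f x = v"
    and \<rho>_eq: "\<And>x y. x \<in> ?V \<Longrightarrow> y \<in> ?V \<Longrightarrow> \<rho> x = \<rho> y \<longleftrightarrow> y = x \<or> y = m x"
    by (rule two_classes_representatives[OF G t two]) (rule that)
  obtain g :: "'a \<Rightarrow> nat" where g: "inj_on g ?V"
    using finite_imp_inj_to_nat_seg[OF pair_graphD(1)[OF G]] by metis
  define k where "k x = real (g (\<rho> x))" for x
  define \<sigma> where "\<sigma> x = (if f x = u then 1 else - 1 :: real)" for x
  have k: "k x = k y \<longleftrightarrow> y = x \<or> y = m x" if xy: "x \<in> ?V" "y \<in> ?V" for x y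
    unfolding k_def of_nat_eq_iff \<rho>_eq[OF xy, symmetric] using inj_on_eq_iff[OF g] \<rho>[OF xy(1)] \<rho>[OF xy(2)] by blast
  define h where "h x = linepath (Complex 0 (\<sigma> x)) (Complex (k x) 0)" for x
  have h: "h x s = Complex (s * k x) ((1 - s) * \<sigma> x)" for x s
    by (simp add: h_def linepath_def complex_eq_iff)
  have \<sigma>: "\<sigma> x = \<sigma> y \<longleftrightarrow> f x = f y" "\<sigma> x \<noteq> \<sigma> y \<Longrightarrow> \<sigma> x = - \<sigma> y" "\<sigma> x \<noteq> 0" if "x \<in> ?V" "y \<in> ?V" for x y
    using cls[OF that(1)] cls[OF that(2)] uv(2) by (auto simp: \<sigma>_def)
  have "half_arcs G f m h"
    unfolding half_arcs_def
  proof (intro conjI ballI)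
    fix x assume "x \<in> ?V"
    then show "arc (h x)" unfolding h_def using \<sigma>(3) by (intro arc_linepath) (simp add: complex_eq_iff)
  next
    fix x y s r assume xy: "x \<in> ?V" "y \<in> ?V" and s: "s \<in> {0..1::real}" and r: "r \<in> {0..1::real}"
    note \<sigma> = \<sigma>[OF xy]
    show "h x s = h y r \<longleftrightarrow> x = y \<and> s = r \<or> s = 0 \<and> r = 0 \<and> f x = f y \<or> s = 1 \<and> r = 1 \<and> y = m x"
    proof
      assume "h x s = h y r"
      then have eq: "s * k x = r * k y" "(1 - s) * \<sigma> x = (1 - r) * \<sigma> y" by (auto simp: h)
      \<comment> \<open>Halves from the same vertex are compared at equal height. Halves from
        different vertices meet only on the real axis, where both parameters are 1.\<close>
      show "x = y \<and> s = r \<or> s = 0 \<and> r = 0 \<and> f x = f y \<or> s = 1 \<and> r = 1 \<and> y = m x"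
      proof (cases "\<sigma> x = \<sigma> y")
        case True
        then have "s = r" "f x = f y" using eq(2) \<sigma> by auto
        moreover from this have "s = 0 \<or> k x = k y" using eq(1) by auto
        ultimately show ?thesis using k[OF xy] td(3)[OF xy(1)] by auto
      next
        case False
        then have "(2 - s - r) * \<sigma> y = 0" using eq(2) \<sigma>(2) by (simp add: algebra_simps)
        then have "s + r = 2" using \<sigma>(3) False \<sigma>(2) by auto
        then have "s = 1" "r = 1" using s r by auto
        moreover have "x \<noteq> y" using False by auto
        ultimately show ?thesis using eq(1) k[OF xy] by auto
      qed
    next
      assume "x = y \<and> s = r \<or> s = 0 \<and> r = 0 \<and> f x = f y \<or> s = 1 \<and> r = 1 \<and> y = m x"
      then show "h x s = h y r" using \<sigma>(1) k[OF xy] by (auto simp: h)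
    qed
  qed
  then show ?thesis by (rule planar_of_half_arcs[OF G t])
qed

text \<open>Every arc of the drawing is cut at parameter 1/2, and each half is traversed away from
  its own vertex.\<close>

lemma planar_of_quotient:
  assumes G: "pair_graph G" and t: "truncation G f m" and inj: "simple_quotient G f m"
    and pl: "planar (quotient_graph G f m)"
  shows "planar G"
proof -
  let ?V = "pverts G" and ?Q = "quotient_graph G f m"
  note td = truncationD[OF t]
  obtain p \<gamma> where d: "plane_drawing ?Q p \<gamma>" using pl by (auto simp: planar_def)
  define e where "e x = {f x, f (m x)}" for x
  have eU: "e x \<in> uedges ?Q" if "x \<in> ?V" for x using that by (auto simp: uedges_quotient e_def)
  have pinj: "p (f x) = p (f y) \<longleftrightarrow> f x = f y" if "x \<in> ?V" "y \<in> ?V" for x y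
    using d that by (auto simp: plane_drawing_def dest: inj_onD)
  have arc: "arc (\<gamma> (e x))" and ends: "{pathstart (\<gamma> (e x)), pathfinish (\<gamma> (e x))} = {p (f x), p (f (m x))}" if "x \<in> ?V" for x
    using d eU[OF that] unfolding plane_drawing_def by (auto simp: e_def)
  have cross: "path_image (\<gamma> (e x)) \<inter> path_image (\<gamma> (e y)) = p ` (e x \<inter> e y)" if "x \<in> ?V" "y \<in> ?V" "e x \<noteq> e y" for x y
    using d eU that unfolding plane_drawing_def by blast
  have e_eq: "e x = e y \<longleftrightarrow> y = x \<or> y = m x" if "x \<in> ?V" "y \<in> ?V" for x y
    unfolding e_def by (rule simple_quotient_edge_eq[OF t inj that])
  define o' where "o' x \<longleftrightarrow> pathstart (\<gamma> (e x)) = p (f x)" for x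
  \<comment> \<open>The position of \<open>h x s\<close> on the arc of its edge, counted from the
    start or from the end of the arc according to where the label of \<open>x\<close> is
    drawn.\<close>
  define w where "w x s = (if o' x then s / 2 else 1 - s / 2 :: real)" for x s
  define h where "h x = (if o' x then subpath 0 (1 / 2) (\<gamma> (e x)) else subpath 1 (1 / 2) (\<gamma> (e x)))" for x
  have h: "h x s = \<gamma> (e x) (w x s)" for x s by (simp add: h_def w_def subpath_def)
  have w01: "w x s \<in> {0..1}" if "s \<in> {0..1}" for x s using that by (auto simp: w_def)
  have pne: "p (f x) \<noteq> p (f (m x))" if "x \<in> ?V" for x using pinj[OF that td(1)[OF that]] td(3)[OF that] by simp
  have start: "h x 0 = p (f x)" if "x \<in> ?V" for x
    using ends[OF that] by (auto simp: h w_def o'_def pathstart_def pathfinish_def doubleton_eq_iff)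
  have o'm: "o' (m x) \<longleftrightarrow> \<not> o' x" if "x \<in> ?V" for x
  proof -
    have "e (m x) = e x" using e_eq[OF that td(1)[OF that]] by simp
    moreover have "pathstart (\<gamma> (e x)) \<noteq> pathfinish (\<gamma> (e x))" using arc[OF that] arc_distinct_ends by metis
    ultimately show ?thesis using ends[OF that] pne[OF that] unfolding o'_def by (auto simp: doubleton_eq_iff)
  qed
  have ginj: "\<gamma> (e x) s = \<gamma> (e x) r \<longleftrightarrow> s = r" if "x \<in> ?V" "s \<in> {0..1}" "r \<in> {0..1}" for x s r
    using arc[OF that(1)] that(2,3) by (auto simp: arc_def dest: inj_onD)
  \<comment> \<open>A half stops in the middle of its arc, so among the two end points of the edge
    it contains only its own start.\<close>
  have h_end: "s = 0 \<and> v = f x" if x: "x \<in> ?V" and s: "s \<in> {0..1}" and v: "v \<in> e x" "h x s = p v" for x s v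
  proof -
    have "p v \<in> {\<gamma> (e x) 0, \<gamma> (e x) 1}"
      using ends[OF x] v(1) by (auto simp: e_def pathstart_def pathfinish_def)
    then have "w x s = 0 \<or> w x s = 1" using v(2) ginj[OF x w01[OF s], of 0] ginj[OF x w01[OF s], of 1] unfolding h by auto
    then have "s = 0" using s by (auto simp: w_def split: if_splits)
    moreover from this have "p v = p (f x)" using v(2) start[OF x] by simp
    then have "v = f x" using v(1) pne[OF x] by (auto simp: e_def)
    ultimately show ?thesis by blast
  qed
  have "half_arcs G f m h"
    unfolding half_arcs_def
  proof (intro conjI ballI)
    fix x assume "x \<in> ?V"
    then show "arc (h x)" unfolding h_def using arc by (simp add: arc_subpath_arc)
  next
    fix x y s r assume xy: "x \<in> ?V" "y \<in> ?V" and s: "s \<in> {0..1::real}" and r: "r \<in> {0..1::real}"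
    show "h x s = h y r \<longleftrightarrow> x = y \<and> s = r \<or> s = 0 \<and> r = 0 \<and> f x = f y \<or> s = 1 \<and> r = 1 \<and> y = m x"
    proof (cases "e x = e y")
      case True
      then consider "y = x" | "y = m x" using e_eq[OF xy] by blast
      then show ?thesis
      proof cases
        case 1
        have "h x s = h y r \<longleftrightarrow> w x s = w x r" unfolding h 1 using ginj[OF xy(1) w01[OF s] w01[OF r]] .
        then show ?thesis using 1 td(4)[OF xy(1)] by (auto simp: w_def)
      next
        case 2
        have "h x s = h y r \<longleftrightarrow> w x s = w y r" unfolding h True[symmetric] using ginj[OF xy(1) w01[OF s] w01[OF r]] .
        also have "\<dots> \<longleftrightarrow> s + r = 2" using o'm[OF xy(1)] 2 by (auto simp: w_def)
        also have "\<dots> \<longleftrightarrow> s = 1 \<and> r = 1" using s r by auto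
        finally show ?thesis using 2 td(3,4)[OF xy(1)] by auto
      qed
    next
      case False
      then have ne: "y \<noteq> x" "y \<noteq> m x" using e_eq[OF xy] by blast+
      have "s = 0 \<and> r = 0 \<and> f x = f y" if eq: "h x s = h y r"
      proof -
        have "h x s \<in> path_image (\<gamma> (e x))" "h y r \<in> path_image (\<gamma> (e y))"
          unfolding h path_image_def using w01 s r by blast+
        then obtain v where v: "v \<in> e x" "v \<in> e y" "h x s = p v" using cross[OF xy False] eq by force
        then show ?thesis using h_end[OF xy(1) s v(1)] h_end[OF xy(2) r v(2)] eq by simp
      qed
      moreover have "h x 0 = h y 0" if "f x = f y" using start xy that by simp
      ultimately show ?thesis using ne by auto
    qed
  qed
  then show ?thesis by (rule planar_of_half_arcs[OF G t])
qed

section \<open>Planarity of the quotient\<close>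

text \<open>Each label \<open>v\<close> is drawn at a chosen vertex \<open>b v\<close> of its
  triangle. The edge at \<open>x\<close> follows the path from \<open>b (f x)\<close> over
  \<open>x\<close> and \<open>m x\<close> to \<open>b (f (m x))\<close>, so the side of each
  triangle opposite to its chosen vertex is left out. Paths of different edges share only chosen
  vertices.\<close>

lemma quotient_planar:
  assumes G: "pair_graph G" and t: "truncation G f m" and inj: "simple_quotient G f m" and pl: "planar G"
  shows "planar (quotient_graph G f m)"
proof -
  let ?V = "pverts G" and ?Q = "quotient_graph G f m"
  note td = truncationD[OF t]
  obtain p \<gamma> where d: "plane_drawing G p \<gamma>" using pl by (auto simp: planar_def)
  have pinj: "inj_on p ?V" using d by (simp add: plane_drawing_def)
  have pe: "p x = p y \<longleftrightarrow> x = y" if "x \<in> ?V" "y \<in> ?V" for x y using pinj that by (auto dest: inj_onD)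
  define A where "A e = path_image (\<gamma> e)" for e
  have AV: "A e \<inter> p ` ?V = p ` e" and eV: "e \<subseteq> ?V" if "e \<in> uedges G" for e
    using d that uedgesD(2)[OF G that] by (auto simp: plane_drawing_def A_def)
  have cross: "A e \<inter> A e' = p ` (e \<inter> e')" if "e \<in> uedges G" "e' \<in> uedges G" "e \<noteq> e'" for e e'
    using d that by (simp add: plane_drawing_def A_def)
  have ab: "arc_between (A {x, y}) (p x) (p y)" if "{x, y} \<in> uedges G" for x y
  proof -
    have "arc_between (A {x, y}) (pathstart (\<gamma> {x, y})) (pathfinish (\<gamma> {x, y}))"
      and "{pathstart (\<gamma> {x, y}), pathfinish (\<gamma> {x, y})} = {p x, p y}"
      using d that by (auto simp: plane_drawing_def A_def arc_between_def)
    then show ?thesis by (auto simp: doubleton_eq_iff arc_between_sym)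
  qed
  define b where "b v = inv_into ?V f v" for v
  have b: "b (f x) \<in> ?V" "f (b (f x)) = f x" if "x \<in> ?V" for x
    using that by (simp_all add: b_def inv_into_into f_inv_into_f)
  have mE: "{x, m x} \<in> uedges G" if "x \<in> ?V" for x
  proof -
    have "(x, m x) \<in> parcs G" using td[OF that] that by (simp add: truncation_arcs[OF t])
    then show ?thesis unfolding uedges_def by blast
  qed
  have bE: "{b (f x), x} \<in> uedges G" if "x \<in> ?V" "x \<noteq> b (f x)" for x
  proof -
    have "(b (f x), x) \<in> parcs G" using b[OF that(1)] that by (auto simp: truncation_arcs[OF t])
    then show ?thesis unfolding uedges_def by blast
  qed
  \<comment> \<open>The edges of \<open>G\<close> on this path. Both \<open>x\<close> and
    \<open>m x\<close> contribute, each adding the side to its chosen vertex unless it is chosen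
    itself.\<close>
  define F where "F e = (\<Union>x \<in> {x \<in> ?V. {f x, f (m x)} = e}. insert {x, m x} (if x = b (f x) then {} else {{b (f x), x}}))" for e
  define I where "I e = \<Union> (A ` F e)" for e
  have F: "\<epsilon> \<in> F e \<longleftrightarrow> (\<exists>x \<in> ?V. {f x, f (m x)} = e \<and> (\<epsilon> = {x, m x} \<or> x \<noteq> b (f x) \<and> \<epsilon> = {b (f x), x}))" for \<epsilon> e
    by (auto simp: F_def split: if_splits)
  have FU: "\<epsilon> \<in> uedges G" if "\<epsilon> \<in> F e" for \<epsilon> e using that mE bE unfolding F by blast
  have Fe: "f ` \<epsilon> \<subseteq> e" if "\<epsilon> \<in> F e" for \<epsilon> e using that b unfolding F by auto
  have Fx: "\<exists>x \<in> ?V. {f x, f (m x)} = e \<and> (w = x \<or> w = b (f w))" if \<epsilon>: "\<epsilon> \<in> F e" and w: "w \<in> \<epsilon>" for \<epsilon> e w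
  proof -
    obtain x where x: "x \<in> ?V" "{f x, f (m x)} = e" "\<epsilon> = {x, m x} \<or> \<epsilon> = {b (f x), x}" using \<epsilon> unfolding F by blast
    have "{f (m x), f (m (m x))} = e" using x(2) td(2)[OF x(1)] by (simp add: insert_commute)
    moreover have "w = x \<or> w = m x \<or> w = b (f w)" using x(3) w b(2)[OF x(1)] by auto
    ultimately show ?thesis using x(1,2) td(1)[OF x(1)] by blast
  qed
  have fb: "f (b v) = v" "b v \<in> ?V" if "v \<in> f ` ?V" for v using that b by auto
  show ?thesis
  proof (rule planarI[of "\<lambda>v. p (b v)" _ I])
    show "inj_on (\<lambda>v. p (b v)) (pverts ?Q)"
      using fb pe unfolding quotient_graph_simps by (intro inj_onI) metis
  next
    fix e assume "e \<in> uedges ?Q"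
    then obtain x where x: "x \<in> ?V" "e = {f x, f (m x)}" by (auto simp: uedges_quotient)
    note mx = td[OF x(1)]
    have eqs: "{y \<in> ?V. {f y, f (m y)} = e} = {x, m x}"
    proof -
      have "{f y, f (m y)} = e \<longleftrightarrow> y = x \<or> y = m x" if "y \<in> ?V" for y
        using simple_quotient_edge_eq[OF t inj x(1) that] unfolding x(2) by blast
      then show ?thesis using x(1) mx(1) by blast
    qed
    \<comment> \<open>A leg degenerates to a point if \<open>y\<close> is the chosen vertex of its
      triangle.\<close>
    define leg where "leg y = (if y = b (f y) then {p y} else A {b (f y), y})" for y
    have pA: "p y \<in> A {y, m y}" if "y \<in> ?V" for y using AV[OF mE[OF that]] by blast
    have Ieq: "I e = leg x \<union> A {x, m x} \<union> leg (m x)"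
    proof -
      have "I e = A {x, m x} \<union> (if x = b (f x) then {} else A {b (f x), x}) \<union>
          (A {m x, m (m x)} \<union> (if m x = b (f (m x)) then {} else A {b (f (m x)), m x}))"
        unfolding I_def F_def eqs by auto
      moreover have "{m x, m (m x)} = {x, m x}" using mx(2) by auto
      moreover have "p x \<in> A {x, m x}" "p (m x) \<in> A {x, m x}" using AV[OF mE[OF x(1)]] by blast+
      ultimately show ?thesis unfolding leg_def by auto
    qed
    have disj: "leg x \<inter> leg (m x) = {}"
    proof -
      have 1: "leg y \<subseteq> A {y, m y} \<or> {b (f y), y} \<in> uedges G \<and> leg y = A {b (f y), y}" if "y \<in> ?V" for y
        using that pA bE by (auto simp: leg_def)
      have legI: "z \<in> p ` \<epsilon>" if "y \<in> ?V" "\<epsilon> \<in> uedges G" "\<epsilon> \<noteq> {b (f y), y}" "z \<in> leg y" "z \<in> A \<epsilon>" for y \<epsilon> z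
      proof (cases "y = b (f y)")
        case True
        then have "z = p y" using that(4) by (simp add: leg_def)
        then show ?thesis using AV[OF that(2)] that(1,5) by blast
      next
        case False
        then have "z \<in> A {b (f y), y}" using that(4) by (simp add: leg_def)
        then show ?thesis using cross[OF that(2) bE[OF that(1) False] that(3)] that(5) by blast
      qed
      have legV: "y' \<in> {b (f y), y}" if "y \<in> ?V" "y' \<in> ?V" "p y' \<in> leg y" for y y'
      proof (cases "y = b (f y)")
        case True
        then show ?thesis using that pe by (simp add: leg_def)
      next
        case False
        then have "p y' \<in> p ` {b (f y), y}" using AV[OF bE[OF that(1) False]] that by (auto simp: leg_def)
        then show ?thesis using pe b(1)[OF that(1)] that(1,2) by auto
      qed
      have False if z: "z \<in> leg x" "z \<in> leg (m x)" for z
      proof (cases "m x = b (f (m x))")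
        case True
        then have "z = p (m x)" using z(2) by (simp add: leg_def)
        then have "m x \<in> {b (f x), x}" using legV[OF x(1) mx(1)] z(1) by simp
        then show False using b(2)[OF x(1)] mx(3,4) by auto
      next
        case False
        then have "z \<in> A {b (f (m x)), m x}" using z(2) by (simp add: leg_def)
        moreover have "{b (f (m x)), m x} \<noteq> {b (f x), x}"
          using b(2)[OF x(1)] b(2)[OF mx(1)] mx(3,4) by (auto simp: doubleton_eq_iff)
        ultimately have "z \<in> p ` {b (f (m x)), m x}" using legI[OF x(1) bE[OF mx(1) False]] z(1) by blast
        then obtain y where y: "y \<in> {b (f (m x)), m x}" "z = p y" by blast
        have "y \<in> ?V" "f y = f (m x)" using y(1) b[OF mx(1)] mx(1) by auto
        moreover from this have "y \<in> {b (f x), x}" using legV[OF x(1)] z(1) y(2) by blast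
        ultimately show False using b(2)[OF x(1)] mx(3) by auto
      qed
      then show ?thesis by blast
    qed
    have legm: "leg y \<inter> A {x, m x} \<subseteq> {p y}" if y: "y \<in> {x, m x}" for y
    proof (cases "y = b (f y)")
      case True
      then show ?thesis by (simp add: leg_def)
    next
      case False
      have yV: "y \<in> ?V" using y x(1) mx(1) by blast
      have "{b (f y), y} \<noteq> {x, m x}" "{b (f y), y} \<inter> {x, m x} \<subseteq> {y}"
        using y b(2)[OF yV] mx(2-4) False by (auto simp: doubleton_eq_iff)
      then show ?thesis using cross[OF bE[OF yV False] mE[OF x(1)]] False by (auto simp: leg_def)
    qed
    have legarc: "arc_between (leg y \<union> X) (p (b (f y))) q" if "y \<in> ?V" "arc_between X (p y) q" "leg y \<inter> X \<subseteq> {p y}" for y X q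
    proof (cases "y = b (f y)")
      case True
      have "p y \<in> X" using that(2) unfolding arc_between_def by (metis pathstart_in_path_image)
      then have "leg y \<union> X = X" using True by (auto simp: leg_def)
      then show ?thesis using that(2) True by simp
    next
      case False
      then have "leg y = A {b (f y), y}" by (simp add: leg_def)
      then show ?thesis using arc_between_join[OF ab[OF bE[OF that(1) False]] that(2)] that(3) by simp
    qed
    \<comment> \<open>The path is assembled from the middle edge outwards; the second leg is
      attached after reversing what has been built.\<close>
    have "arc_between (leg x \<union> A {x, m x}) (p (b (f x))) (p (m x))"
      by (rule legarc[OF x(1) ab[OF mE[OF x(1)]] legm]) simp
    then have "arc_between (leg (m x) \<union> (leg x \<union> A {x, m x})) (p (b (f (m x)))) (p (b (f x)))"
      using legm[of "m x"] disj by (intro legarc[OF mx(1) arc_between_sym]) auto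
    then show "\<exists>u w. e = {u, w} \<and> arc_between (I e) (p (b u)) (p (b w))"
      unfolding Ieq using x(2) by (intro exI[of _ "f (m x)"] exI[of _ "f x"]) (simp add: Un_ac insert_commute)
  next
    have sub: "p (b v) \<in> I e" if eQ: "e \<in> uedges ?Q" and ve: "v \<in> e" for e v
    proof -
      obtain y where y: "y \<in> ?V" "e = {f y, f (m y)}" using eQ by (auto simp: uedges_quotient)
      have "\<exists>x \<in> ?V. e = {f x, f (m x)} \<and> v = f x"
      proof (cases "v = f y")
        case False
        then have "v = f (m y)" "e = {f (m y), f (m (m y))}" using ve y(2) td(2)[OF y(1)] by auto
        then show ?thesis using td(1)[OF y(1)] by blast
      qed (use y in blast)
      then obtain x where x: "x \<in> ?V" "e = {f x, f (m x)}" "v = f x" by blast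
      show ?thesis
      proof (cases "x = b (f x)")
        case True
        have "{x, m x} \<in> F e" using x unfolding F by blast
        moreover have "p (b v) \<in> A {x, m x}" using AV[OF mE[OF x(1)]] x(3) True by auto
        ultimately show ?thesis unfolding I_def by blast
      next
        case False
        then have "{b (f x), x} \<in> F e" using x unfolding F by blast
        moreover have "p (b v) \<in> A {b (f x), x}" using AV[OF bE[OF x(1) False]] x(3) by auto
        ultimately show ?thesis unfolding I_def by blast
      qed
    qed
    have sub_V: "e \<subseteq> f ` ?V" if "e \<in> uedges ?Q" for e using uedgesD(2)[OF pair_graph_quotient[OF G t] that] by simp
    fix e assume e: "e \<in> uedges ?Q"
    have "v \<in> e" if vL: "v \<in> f ` ?V" and vI: "p (b v) \<in> I e" for v
    proof -
      obtain \<epsilon> where \<epsilon>: "\<epsilon> \<in> F e" "p (b v) \<in> A \<epsilon>" using vI by (auto simp: I_def)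
      then have "p (b v) \<in> p ` \<epsilon>" using AV[OF FU[OF \<epsilon>(1)]] fb(2)[OF vL] by blast
      then obtain w where "w \<in> \<epsilon>" "p (b v) = p w" by blast
      then have "b v \<in> \<epsilon>" using pe[OF fb(2)[OF vL], of w] eV[OF FU[OF \<epsilon>(1)]] by auto
      then show ?thesis using Fe[OF \<epsilon>(1)] fb(1)[OF vL] by force
    qed
    then show "I e \<inter> (\<lambda>v. p (b v)) ` pverts ?Q = (\<lambda>v. p (b v)) ` e"
      using sub[OF e] sub_V[OF e] by auto
    fix e' assume e': "e' \<in> uedges ?Q" "e \<noteq> e'"
    show "I e \<inter> I e' = (\<lambda>v. p (b v)) ` (e \<inter> e')"
    proof
      show "(\<lambda>v. p (b v)) ` (e \<inter> e') \<subseteq> I e \<inter> I e'" using sub[OF e] sub[OF e'(1)] by blast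
      show "I e \<inter> I e' \<subseteq> (\<lambda>v. p (b v)) ` (e \<inter> e')"
      proof
        fix z assume "z \<in> I e \<inter> I e'"
        then obtain \<epsilon> \<epsilon>' where \<epsilon>: "\<epsilon> \<in> F e" "z \<in> A \<epsilon>" "\<epsilon>' \<in> F e'" "z \<in> A \<epsilon>'" by (auto simp: I_def)
        \<comment> \<open>An edge of \<open>G\<close> serves only one edge of the quotient. An edge
          between partners carries two labels and a side only one, and within either kind the edge
          determines \<open>x\<close> up to \<open>m\<close>.\<close>
        have "\<epsilon> \<noteq> \<epsilon>'"
        proof
          assume eq: "\<epsilon> = \<epsilon>'"
          obtain x where x: "x \<in> ?V" "{f x, f (m x)} = e" "\<epsilon> = {x, m x} \<or> x \<noteq> b (f x) \<and> \<epsilon> = {b (f x), x}"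
            using \<epsilon>(1) unfolding F by blast
          obtain y where y: "y \<in> ?V" "{f y, f (m y)} = e'" "\<epsilon>' = {y, m y} \<or> y \<noteq> b (f y) \<and> \<epsilon>' = {b (f y), y}"
            using \<epsilon>(3) unfolding F by blast
          have fx: "f ` {z, m z} = {f z, f (m z)}" "f ` {b (f z), z} = {f z}" if "z \<in> ?V" for z
            using b(2)[OF that] by auto
          have img: "f ` {z, m z} \<noteq> f ` {b (f z'), z'}" if "z \<in> ?V" "z' \<in> ?V" for z z'
            unfolding fx[OF that(1)] fx[OF that(2)] using td(3)[OF that(1)] by auto
          have "x = y \<or> y = m x"
            using x(3) y(3)
          proof (elim disjE conjE)
            assume "\<epsilon> = {x, m x}" "\<epsilon>' = {y, m y}"
            then have "y \<in> {x, m x}" using eq by auto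
            then show ?thesis by auto
          next
            assume "\<epsilon> = {x, m x}" "\<epsilon>' = {b (f y), y}"
            then show ?thesis using img[OF x(1) y(1)] eq by auto
          next
            assume "\<epsilon> = {b (f x), x}" "\<epsilon>' = {y, m y}"
            then show ?thesis using img[OF y(1) x(1)] eq by auto
          next
            assume *: "\<epsilon> = {b (f x), x}" "\<epsilon>' = {b (f y), y}" "x \<noteq> b (f x)" "y \<noteq> b (f y)"
            then have "f ` {b (f x), x} = f ` {b (f y), y}" using eq by simp
            then have "f x = f y" unfolding fx[OF x(1)] fx[OF y(1)] by simp
            moreover have "x \<in> {b (f y), y}" using *(1,2) eq by blast
            ultimately show ?thesis using *(3) by auto
          qed
          then show False using simple_quotient_edge_eq[OF t inj x(1) y(1)] x(2) y(2) e'(2) by blast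
        qed
        then obtain w where w: "w \<in> \<epsilon>" "w \<in> \<epsilon>'" "z = p w" using cross[OF FU[OF \<epsilon>(1)] FU[OF \<epsilon>(3)]] \<epsilon>(2,4) by blast
        have "f w \<in> e \<inter> e'" using Fe[OF \<epsilon>(1)] Fe[OF \<epsilon>(3)] w by blast
        \<comment> \<open>A vertex that is not chosen lies on the path of a single edge of the
          quotient.\<close>
        moreover have "w = b (f w)"
          using Fx[OF \<epsilon>(1) w(1)] Fx[OF \<epsilon>(3) w(2)] e'(2) by blast
        ultimately show "z \<in> (\<lambda>v. p (b v)) ` (e \<inter> e')" using w(3) by (metis image_eqI)
      qed
    qed
  qed
qed

section \<open>The equivalence of the three conditions\<close>

theorem theorem1p2:
  fixes G :: "'a pair_pre_digraph"
  assumes "pair_graph G"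
  shows "(basic G \<longleftrightarrow> k_connected 3 G \<and> wheel_free G \<and> planar G \<and> is_line_graph G) \<and>
    (k_connected 3 G \<and> wheel_free G \<and> planar G \<and> is_line_graph G \<longleftrightarrow>
     k_connected 3 G \<and> planar G \<and> \<not> has_induced is_K4 G \<and> \<not> has_induced is_claw G \<and>
     \<not> has_induced is_diamond G \<and> \<not> has_induced is_butterfly G)"
proof -
  note G = assms
  have 12: "k_connected 3 G \<and> wheel_free G \<and> planar G \<and> is_line_graph G" if bas: "basic G"
  proof -
    obtain f m where b: "truncation_basic G f m" using basic_imp_truncation[OF G bas] by blast
    then have t: "truncation G f m" by (simp add: truncation_basic_def)
    have "k_connected 3 G \<and> planar G"
      using b k_connected_two_classes[OF G t] two_classes_planar[OF G t]
        k_connected_of_quotient[OF G t] planar_of_quotient[OF G t]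
      unfolding truncation_basic_def by blast
    moreover have "is_line_graph G" using bas unfolding basic_def is_line_graph_def by blast
    ultimately show ?thesis using truncation_wheel_free[OF G t] by blast
  qed
  have 23: "\<not> has_induced is_K4 G \<and> \<not> has_induced is_claw G \<and> \<not> has_induced is_diamond G \<and> \<not> has_induced is_butterfly G"
    if "k_connected 3 G" "wheel_free G" "is_line_graph G"
    using wheel_free_line_graph_forbidden[OF G that] by blast
  have 31: "basic G" if k: "k_connected 3 G" and pl: "planar G" and fb: "\<not> has_induced is_K4 G"
    "\<not> has_induced is_claw G" "\<not> has_induced is_diamond G" "\<not> has_induced is_butterfly G"
  proof -
    obtain f m where t: "truncation G f m" using forbidden_truncation[OF G k fb] by blast
    \<comment> \<open>Either the quotient is simple and inherits connectivity and planarity, or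
      there are only two triangles and no quotient is formed.\<close>
    have "truncation_basic G f m"
      using t not_simple_quotient_two_classes[OF G k t] k_connected_quotient[OF G k t] quotient_planar[OF G t _ pl]
      unfolding truncation_basic_def by blast
    then show ?thesis by (rule truncation_imp_basic[OF G])
  qed
  show ?thesis using 12 23 31 by blast
qed

end
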